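(* Let $T=(T_1,\ldots,T_d)$ be a pure, commuting, cyclic row contraction on some Hilbert space $\mathfrak{H}$. Let $\mathcal{J}=\mathrm{Ann}_{\mathrm{c}}(T)$ and let $M_{\mathcal{J}}$ be the compression of the standard commuting $d$-shift associated to $\mathcal{J}$. Then $M_{\mathcal{J}}$ is a quasi-affine transform of $T$.
   Context: Fix a positive integer $d$. The Drury--Arveson space $H^2_d$ is the Hilbert space of analytic functions $f=\sum_{\alpha\in\mathbb{N}^d}c_\alpha x^\alpha$ on the open unit ball $\mathbb{B}_d\subset\mathbb{C}^d$ with $\|f\|^2=\sum_{\alpha}\frac{\alpha!}{|\alpha|!}|c_\alpha|^2<\infty$ (equivalently, the reproducing kernel Hilbert space with kernel $1/(1-\langle z,w\rangle)$); $x_1,\dots,x_d$ are the coordinate functions. $\mathcal{M}_d$ is its multiplier algebra, viewed as a weak-$*$ closed unital subalgebra of $B(H^2_d)$ via $\phi\mapsto M_\phi$, $M_\phi f=\phi f$. The standard commuting $d$-shift is $M_x=(M_{x_1},\ldots,M_{x_d})$. A $d$-tuple $T=(T_1,\dots,T_d)$ of bounded operators on $\mathfrak{H}$ is a row contraction if $\sum_{k=1}^d T_kT_k^*\le I$; it is commuting if the $T_k$ commute with each other; it is pure if $\lim_{n\to\infty}\sum_{|w|=n}\|T_w^*\xi\|^2=0$ for all $\xi\in\mathfrak{H}$, where $w=i_1\cdots i_n$ ranges over words of length $n$ in $\{1,\dots,d\}$ and $T_w=T_{i_1}\cdots T_{i_n}$. $T$ is cyclic if there is a vector $\xi$ (a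 cyclic vector) such that $\mathfrak{H}$ is the closed linear span of $\{T_w\xi\}$ over all words $w$ (including the empty word). For a pure commuting row contraction $T$ there is a unique unital completely contractive weak-$*$ continuous homomorphism $\mathcal{M}_d\to B(\mathfrak{H})$ sending $M_{x_k}$ to $T_k$ for each $k$; the image of $\phi$ is written $\phi(T)$. $\mathrm{Ann}_{\mathrm{c}}(T)=\{\phi\in\mathcal{M}_d:\phi(T)=0\}$, a weak-$*$ closed ideal. For a weak-$*$ closed ideal $\mathcal{J}\subset\mathcal{M}_d$, let $[\mathcal{J}H^2_d]$ be the closed linear span of $\{\theta f:\theta\in\mathcal{J},f\in H^2_d\}$, $H_{\mathcal{J}}=H^2_d\ominus[\mathcal{J}H^2_d]$, and $M_{\mathcal{J}}=(P_{H_{\mathcal{J}}}M_{x_1}|_{H_{\mathcal{J}}},\ldots,P_{H_{\mathcal{J}}}M_{x_d}|_{H_{\mathcal{J}}})$. A $d$-tuple $T'$ on $\mathfrak{H}'$ is a quasi-affine transform of a $d$-tuple $T$ on $\mathfrak{H}$ (written $T'\prec T$) if there is an injective bounded linear operator $X:\mathfrak{H}'\to\mathfrak{H}$ with dense range such that $XT'_k=T_kX$ for $1\le k\le d$. *)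

theory Defs
  imports "HOL-Analysis.Analysis"
begin

section \<open>Complex Hilbert spaces\<close>

text \<open>The inner product is linear in its first argument. Norm, metric and completeness come from
  the underlying real Hilbert space, whose inner product is the real part of the complex one.\<close>

class chilbert_space = real_inner + complete_space +
  fixes scaleC :: "complex \<Rightarrow> 'a \<Rightarrow> 'a"  (infixr "*\<^sub>C" 75)
    and cinner :: "'a \<Rightarrow> 'a \<Rightarrow> complex"
  assumes scaleC_add_right: "c *\<^sub>C (x + y) = c *\<^sub>C x + c *\<^sub>C y"
    and scaleC_add_left: "(b + c) *\<^sub>C x = b *\<^sub>C x + c *\<^sub>C x"
    and scaleC_scaleC: "b *\<^sub>C c *\<^sub>C x = (b * c) *\<^sub>C x"
    and scaleC_of_real: "complex_of_real r *\<^sub>C x = r *\<^sub>R x"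
    and cinner_commute: "cinner x y = cnj (cinner y x)"
    and cinner_add_left: "cinner (x + y) z = cinner x z + cinner y z"
    and cinner_scaleC_left: "cinner (c *\<^sub>C x) y = c * cinner x y"
    and Re_cinner: "Re (cinner x y) = inner x y"

lemma scaleC_one: "1 *\<^sub>C x = (x :: 'a::chilbert_space)"
  using scaleC_of_real[of 1 x] by simp

global_interpretation complex_vector:
  vector_space "scaleC :: complex \<Rightarrow> 'a \<Rightarrow> 'a::chilbert_space"
  defines cspan = complex_vector.span
  by unfold_locales (auto simp: scaleC_add_right scaleC_add_left scaleC_scaleC scaleC_one)

lemma norm_scaleC: "norm (c *\<^sub>C x) = cmod c * norm (x :: 'a::chilbert_space)"
proof -
  have "cinner (c *\<^sub>C x) (c *\<^sub>C x) = c * cnj c * cinner x x"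
    by (metis cinner_commute cinner_scaleC_left complex_cnj_mult mult.assoc)
  also have "c * cnj c = complex_of_real ((cmod c)\<^sup>2)"
    by (metis complex_norm_square of_real_power)
  finally have "inner (c *\<^sub>C x) (c *\<^sub>C x) = (cmod c)\<^sup>2 * inner x x"
    by (simp flip: Re_cinner)
  then show ?thesis
    by (simp add: norm_eq_sqrt_inner real_sqrt_mult)
qed

section \<open>Bounded operators\<close>

text \<open>Elements of \<open>'a \<Rightarrow>\<^sub>L 'b\<close> are only real-linear; \<open>cbounded\<close> singles out the bounded
  complex-linear operators, so that \<open>B(H)\<close> is \<open>cbounded :: ('h \<Rightarrow>\<^sub>L 'h) set\<close>.\<close>

definition cbounded :: "('a::chilbert_space \<Rightarrow>\<^sub>L 'b::chilbert_space) set" where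
  "cbounded = {A. \<forall>c x. blinfun_apply A (c *\<^sub>C x) = c *\<^sub>C A x}"

lift_definition scale_op ::
    "complex \<Rightarrow> ('a::chilbert_space \<Rightarrow>\<^sub>L 'b::chilbert_space) \<Rightarrow> ('a \<Rightarrow>\<^sub>L 'b)"
  is "\<lambda>c A x. c *\<^sub>C A x"
proof -
  fix c and A :: "'a \<Rightarrow> 'b"
  assume "bounded_linear A"
  moreover have "bounded_linear (scaleC c :: 'b \<Rightarrow> 'b)"
    by (rule bounded_linear_intro[where K = "cmod c"])
       (auto simp: scaleC_add_right norm_scaleC scaleC_scaleC mult.commute
             simp flip: scaleC_of_real)
  ultimately show "bounded_linear (\<lambda>x. c *\<^sub>C A x)"
    using bounded_linear_compose by blast
qed

definition hadjoint ::
    "('a::chilbert_space \<Rightarrow>\<^sub>L 'b::chilbert_space) \<Rightarrow> ('b \<Rightarrow>\<^sub>L 'a)" where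
  "hadjoint A = (THE B. \<forall>x y. cinner (A x) y = cinner x (blinfun_apply B y))"

definition positive_op :: "('a::chilbert_space \<Rightarrow>\<^sub>L 'a) \<Rightarrow> bool" where
  "positive_op A \<longleftrightarrow> (\<forall>x. cinner (A x) x \<in> \<real>\<^sub>\<ge>\<^sub>0)"

definition ortho_proj :: "'a::chilbert_space set \<Rightarrow> 'a \<Rightarrow> 'a" where
  "ortho_proj S x = (THE u. u \<in> S \<and> (\<forall>w\<in>S. cinner (x - u) w = 0))"

text \<open>The norm of the operator on \<open>'a\<^sup>n\<close> given by the \<open>n \<times> n\<close> operator matrix
  \<open>(A i j)\<close> with \<open>i, j < n\<close>.\<close>

definition matrix_op_norm :: "nat \<Rightarrow> (nat \<Rightarrow> nat \<Rightarrow> 'a::chilbert_space \<Rightarrow>\<^sub>L 'a) \<Rightarrow> real" where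
  "matrix_op_norm n A =
     (SUP x \<in> {x. (\<Sum>j<n. (norm (x j))\<^sup>2) \<le> 1}.
        sqrt (\<Sum>i<n. (norm (\<Sum>j<n. A i j (x j)))\<^sup>2))"

text \<open>The weak-* topology of \<open>B(H)\<close> as the dual of the trace class: it is the initial topology
  for the functionals \<open>A \<mapsto> (\<Sum>n. \<langle>A \<xi>\<^sub>n, \<eta>\<^sub>n\<rangle>)\<close> with \<open>\<xi>\<close>, \<open>\<eta>\<close> square summable.\<close>

definition weak_star :: "('a::chilbert_space \<Rightarrow>\<^sub>L 'a) topology" where
  "weak_star = topology_generated_by
     {{A \<in> cbounded. (\<Sum>n. cinner (blinfun_apply A (\<xi> n)) (\<eta> n)) \<in> U} | \<xi> \<eta> U.
        summable (\<lambda>n. (norm (\<xi> n))\<^sup>2) \<and> summable (\<lambda>n. (norm (\<eta> n))\<^sup>2) \<and> open U}"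

section \<open>The Drury--Arveson space\<close>

definition da_weight :: "('d::finite \<Rightarrow> nat) \<Rightarrow> real" where
  "da_weight \<alpha> = (\<Prod>i\<in>UNIV. fact (\<alpha> i)) / fact (\<Sum>i\<in>UNIV. \<alpha> i)"

lemma da_weight_pos: "da_weight \<alpha> > 0"
  by (auto simp: da_weight_def intro!: divide_pos_pos prod_pos)

definition da_summable :: "(('d::finite \<Rightarrow> nat) \<Rightarrow> complex) \<Rightarrow> bool" where
  "da_summable c \<longleftrightarrow> (\<lambda>\<alpha>. da_weight \<alpha> * (cmod (c \<alpha>))\<^sup>2) summable_on UNIV"

lemma da_summable_scale: "da_summable c \<Longrightarrow> da_summable (\<lambda>\<alpha>. a * c \<alpha>)"
  unfolding da_summable_def
  by (drule summable_on_cmult_right[where c = "(cmod a)\<^sup>2"])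
     (simp add: norm_mult power_mult_distrib mult_ac)

lemma da_summable_add:
  assumes "da_summable c" "da_summable e"
  shows "da_summable (\<lambda>\<alpha>. c \<alpha> + e \<alpha>)"
proof -
  have "(\<lambda>\<alpha>. 2 * (da_weight \<alpha> * (cmod (c \<alpha>))\<^sup>2) + 2 * (da_weight \<alpha> * (cmod (e \<alpha>))\<^sup>2)) summable_on UNIV"
    using assms unfolding da_summable_def
    by (intro summable_on_add summable_on_cmult_right)
  moreover have "da_weight \<alpha> * (cmod (c \<alpha> + e \<alpha>))\<^sup>2
      \<le> 2 * (da_weight \<alpha> * (cmod (c \<alpha>))\<^sup>2) + 2 * (da_weight \<alpha> * (cmod (e \<alpha>))\<^sup>2)" for \<alpha>
  proof -
    have "(cmod (c \<alpha> + e \<alpha>))\<^sup>2 \<le> (cmod (c \<alpha>) + cmod (e \<alpha>))\<^sup>2"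
      by (simp add: norm_triangle_ineq power_mono)
    also have "\<dots> \<le> 2 * (cmod (c \<alpha>))\<^sup>2 + 2 * (cmod (e \<alpha>))\<^sup>2"
      using sum_squares_bound[of "cmod (c \<alpha>)" "cmod (e \<alpha>)"] by (simp add: power2_sum)
    finally show ?thesis
      using mult_left_mono[OF _ less_imp_le[OF da_weight_pos[of \<alpha>]]]
      by (fastforce simp: distrib_left mult_ac)
  qed
  ultimately show ?thesis
    unfolding da_summable_def
    by (rule summable_on_comparison_test) (auto simp: da_weight_pos less_imp_le)
qed

lemma da_abs_summable_prod:
  assumes "da_summable c" "da_summable e"
  shows "(\<lambda>\<alpha>. complex_of_real (da_weight \<alpha>) * c \<alpha> * cnj (e \<alpha>)) summable_on UNIV"
proof -
  have "(\<lambda>\<alpha>. da_weight \<alpha> * (cmod (c \<alpha>))\<^sup>2 + da_weight \<alpha> * (cmod (e \<alpha>))\<^sup>2) summable_on UNIV"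
    using assms unfolding da_summable_def by (intro summable_on_add)
  moreover have "norm (complex_of_real (da_weight \<alpha>) * c \<alpha> * cnj (e \<alpha>))
      \<le> da_weight \<alpha> * (cmod (c \<alpha>))\<^sup>2 + da_weight \<alpha> * (cmod (e \<alpha>))\<^sup>2" for \<alpha>
  proof -
    have "cmod (c \<alpha>) * cmod (e \<alpha>) \<le> (cmod (c \<alpha>))\<^sup>2 + (cmod (e \<alpha>))\<^sup>2"
      using sum_squares_bound[of "cmod (c \<alpha>)" "cmod (e \<alpha>)"]
        mult_nonneg_nonneg[OF norm_ge_zero[of "c \<alpha>"] norm_ge_zero[of "e \<alpha>"]] by linarith
    then show ?thesis
      using mult_left_mono[OF _ less_imp_le[OF da_weight_pos[of \<alpha>]]] da_weight_pos[of \<alpha>]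
      by (fastforce simp: norm_mult distrib_left mult_ac)
  qed
  ultimately have "(\<lambda>\<alpha>. norm (complex_of_real (da_weight \<alpha>) * c \<alpha> * cnj (e \<alpha>))) summable_on UNIV"
    by (rule summable_on_comparison_test) auto
  then show ?thesis
    by (rule abs_summable_summable)
qed

definition da_cinner ::
    "(('d::finite \<Rightarrow> nat) \<Rightarrow> complex) \<Rightarrow> (('d \<Rightarrow> nat) \<Rightarrow> complex) \<Rightarrow> complex" where
  "da_cinner c e = (\<Sum>\<^sub>\<infinity>\<alpha>. complex_of_real (da_weight \<alpha>) * c \<alpha> * cnj (e \<alpha>))"

lemma da_cinner_commute: "da_cinner c e = cnj (da_cinner e c)"
  unfolding da_cinner_def by (simp flip: infsum_cnj add: mult_ac)

lemma da_cinner_add_left: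
  "da_summable c \<Longrightarrow> da_summable c' \<Longrightarrow> da_summable e \<Longrightarrow>
     da_cinner (\<lambda>\<alpha>. c \<alpha> + c' \<alpha>) e = da_cinner c e + da_cinner c' e"
  unfolding da_cinner_def
  by (simp add: distrib_left distrib_right infsum_add da_abs_summable_prod)

lemma da_cinner_scale_left: "da_cinner (\<lambda>\<alpha>. a * c \<alpha>) e = a * da_cinner c e"
proof -
  have "da_cinner (\<lambda>\<alpha>. a * c \<alpha>) e
      = (\<Sum>\<^sub>\<infinity>\<alpha>. a * (complex_of_real (da_weight \<alpha>) * c \<alpha> * cnj (e \<alpha>)))"
    unfolding da_cinner_def by (intro infsum_cong) (simp add: mult_ac)
  then show ?thesis
    by (simp add: infsum_cmult_right' da_cinner_def)
qed

lemma da_cinner_self: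
  assumes "da_summable c"
  shows "da_cinner c c = complex_of_real (\<Sum>\<^sub>\<infinity>\<alpha>. da_weight \<alpha> * (cmod (c \<alpha>))\<^sup>2)"
proof -
  have "da_cinner c c = (\<Sum>\<^sub>\<infinity>\<alpha>. complex_of_real (da_weight \<alpha> * (cmod (c \<alpha>))\<^sup>2))"
    unfolding da_cinner_def
    by (intro infsum_cong) (simp add: mult.assoc complex_norm_square[symmetric])
  also have "\<dots> = complex_of_real (\<Sum>\<^sub>\<infinity>\<alpha>. da_weight \<alpha> * (cmod (c \<alpha>))\<^sup>2)"
    using assms by (intro infsumI has_sum_of_real has_sum_infsum) (simp add: da_summable_def)
  finally show ?thesis .
qed

text \<open>A function in the Drury--Arveson space is represented by its family of Taylor coefficients;
  \<open>da_fun\<close> below recovers the analytic function on the ball. The dimension is \<open>CARD('d)\<close>.\<close>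

typedef ('d::finite) drury_arveson =
    "{c :: ('d \<Rightarrow> nat) \<Rightarrow> complex. da_summable c}"
  morphisms coeff_da Abs_drury_arveson
  by (rule exI[of _ "\<lambda>_. 0"]) (simp add: da_summable_def)

setup_lifting type_definition_drury_arveson

instantiation drury_arveson :: (finite) real_inner
begin

lift_definition zero_drury_arveson :: "'a drury_arveson" is "\<lambda>_. 0"
  by (simp add: da_summable_def)

lift_definition plus_drury_arveson :: "'a drury_arveson \<Rightarrow> 'a drury_arveson \<Rightarrow> 'a drury_arveson"
  is "\<lambda>c e \<alpha>. c \<alpha> + e \<alpha>"
  by (rule da_summable_add)

lift_definition uminus_drury_arveson :: "'a drury_arveson \<Rightarrow> 'a drury_arveson"
  is "\<lambda>c \<alpha>. - c \<alpha>"
  by (simp add: da_summable_def)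

definition minus_drury_arveson :: "'a drury_arveson \<Rightarrow> 'a drury_arveson \<Rightarrow> 'a drury_arveson" where
  "minus_drury_arveson f g = f + - g"

lift_definition scaleR_drury_arveson :: "real \<Rightarrow> 'a drury_arveson \<Rightarrow> 'a drury_arveson"
  is "\<lambda>r c \<alpha>. complex_of_real r * c \<alpha>"
  by (rule da_summable_scale)

lift_definition inner_drury_arveson :: "'a drury_arveson \<Rightarrow> 'a drury_arveson \<Rightarrow> real"
  is "\<lambda>c e. Re (da_cinner c e)" .

lift_definition norm_drury_arveson :: "'a drury_arveson \<Rightarrow> real"
  is "\<lambda>c. sqrt (\<Sum>\<^sub>\<infinity>\<alpha>. da_weight \<alpha> * (cmod (c \<alpha>))\<^sup>2)" .

definition dist_drury_arveson :: "'a drury_arveson \<Rightarrow> 'a drury_arveson \<Rightarrow> real" where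
  "dist_drury_arveson f g = norm (f - g)"

definition sgn_drury_arveson :: "'a drury_arveson \<Rightarrow> 'a drury_arveson" where
  "sgn_drury_arveson f = inverse (norm f) *\<^sub>R f"

definition uniformity_drury_arveson :: "('a drury_arveson \<times> 'a drury_arveson) filter" where
  "uniformity_drury_arveson = (INF e\<in>{0<..}. principal {(x, y). dist x y < e})"

definition open_drury_arveson :: "'a drury_arveson set \<Rightarrow> bool" where
  "open_drury_arveson U \<longleftrightarrow>
     (\<forall>x\<in>U. eventually (\<lambda>(x', y). x' = x \<longrightarrow> y \<in> U) uniformity)"

lemma da_sum_le_norm:
  assumes "finite F"
  shows "(\<Sum>\<alpha>\<in>F. da_weight \<alpha> * (cmod (coeff_da f \<alpha>))\<^sup>2) \<le> (norm (f::'a drury_arveson))\<^sup>2"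
proof -
  have "(\<Sum>\<alpha>\<in>F. da_weight \<alpha> * (cmod (coeff_da f \<alpha>))\<^sup>2)
      \<le> (\<Sum>\<^sub>\<infinity>\<alpha>. da_weight \<alpha> * (cmod (coeff_da f \<alpha>))\<^sup>2)"
    using coeff_da[of f] assms
    by (intro finite_sum_le_infsum) (auto simp: da_summable_def da_weight_pos less_imp_le)
  also have "\<dots> = (norm f)\<^sup>2"
    by (simp add: norm_drury_arveson.rep_eq infsum_nonneg da_weight_pos less_imp_le)
  finally show ?thesis .
qed

lemma da_coeff_minus: "coeff_da (f - g) \<alpha> = coeff_da f \<alpha> - coeff_da (g::'a drury_arveson) \<alpha>"
  by (simp add: minus_drury_arveson_def plus_drury_arveson.rep_eq uminus_drury_arveson.rep_eq)

instance
proof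
  fix f g h :: "'a drury_arveson" and r s :: real
  show "f + g + h = f + (g + h)" "f + g = g + f" "0 + f = f" "- f + f = 0"
    by (transfer; simp add: add_ac)+
  show "f - g = f + - g"
    by (simp add: minus_drury_arveson_def)
  show "r *\<^sub>R (f + g) = r *\<^sub>R f + r *\<^sub>R g" "(r + s) *\<^sub>R f = r *\<^sub>R f + s *\<^sub>R f"
    "r *\<^sub>R s *\<^sub>R f = (r * s) *\<^sub>R f" "1 *\<^sub>R f = f"
    by (transfer; simp add: algebra_simps)+
  show "inner f g = inner g f"
    by transfer (metis da_cinner_commute cnj.sel(1))
  show "inner (f + g) h = inner f h + inner g h"
    by transfer (simp add: da_cinner_add_left)
  show "inner (r *\<^sub>R f) g = r * inner f g"
    by transfer (simp add: da_cinner_scale_left)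
  show "0 \<le> inner f f"
    by transfer (simp add: da_cinner_self infsum_nonneg da_weight_pos less_imp_le)
  show norm_inner: "norm f = sqrt (inner f f)"
    by transfer (simp add: da_cinner_self)
  show "inner f f = 0 \<longleftrightarrow> f = 0"
  proof
    assume "inner f f = 0"
    then have "norm f = 0"
      by (simp add: norm_inner)
    then have "coeff_da f \<alpha> = 0" for \<alpha>
      using da_sum_le_norm[of "{\<alpha>}" f] da_weight_pos[of \<alpha>] by (auto simp: mult_le_0_iff)
    then show "f = 0"
      by transfer auto
  next
    assume "f = 0"
    then show "inner f f = 0"
      by transfer (simp add: da_cinner_def)
  qed
  show "dist f g = norm (f - g)"
    by (simp add: dist_drury_arveson_def)
  show "sgn f = inverse (norm f) *\<^sub>R f"
    by (simp add: sgn_drury_arveson_def)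
  show "uniformity = (INF e\<in>{0<..}. principal {(x, y :: 'a drury_arveson). dist x y < e})"
    by (simp add: uniformity_drury_arveson_def)
  show "open U = (\<forall>x\<in>U. \<forall>\<^sub>F (x', y) in uniformity. x' = x \<longrightarrow> y \<in> U)"
    for U :: "'a drury_arveson set"
    by (simp add: open_drury_arveson_def)
qed

end

lemma da_Cauchy_convergent:
  fixes X :: "nat \<Rightarrow> 'a::finite drury_arveson"
  assumes X: "\<And>e. e > 0 \<Longrightarrow> \<exists>N. \<forall>m\<ge>N. \<forall>n\<ge>N. norm (X m - X n) < e"
  shows "\<exists>L. \<forall>e>0. \<exists>N. \<forall>n\<ge>N. norm (X n - L) < e"
proof -
  define c where "c n = coeff_da (X n)" for n
  have "convergent (\<lambda>n. c n \<alpha>)" for \<alpha>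
  proof (rule Cauchy_convergent, rule CauchyI)
    fix e :: real assume "e > 0"
    then have "e * sqrt (da_weight \<alpha>) > 0"
      by (simp add: da_weight_pos)
    from X[OF this] obtain N
      where N: "\<And>m n. m \<ge> N \<Longrightarrow> n \<ge> N \<Longrightarrow> norm (X m - X n) < e * sqrt (da_weight \<alpha>)"
      by blast
    have "cmod (c m \<alpha> - c n \<alpha>) < e" if "m \<ge> N" "n \<ge> N" for m n
    proof -
      have "da_weight \<alpha> * (cmod (c m \<alpha> - c n \<alpha>))\<^sup>2 \<le> (norm (X m - X n))\<^sup>2"
        using da_sum_le_norm[of "{\<alpha>}" "X m - X n"] by (simp add: c_def da_coeff_minus)
      also have "\<dots> < (e * sqrt (da_weight \<alpha>))\<^sup>2"
        using N[OF that] by (intro power_strict_mono) (auto simp: norm_drury_arveson.rep_eq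
            intro!: infsum_nonneg mult_nonneg_nonneg less_imp_le[OF da_weight_pos])
      also have "\<dots> = da_weight \<alpha> * e\<^sup>2"
        using da_weight_pos[of \<alpha>] by (simp add: power_mult_distrib)
      finally show ?thesis
        using da_weight_pos[of \<alpha>] \<open>e > 0\<close> by (simp add: power_less_imp_less_base)
    qed
    then show "\<exists>M. \<forall>m\<ge>M. \<forall>n\<ge>M. norm (c m \<alpha> - c n \<alpha>) < e" by blast
  qed
  then obtain l where l: "\<And>\<alpha>. (\<lambda>n. c n \<alpha>) \<longlonglongrightarrow> l \<alpha>"
    unfolding convergent_def by metis
  have tail: "\<exists>N. \<forall>n\<ge>N. \<forall>F. finite F \<longrightarrow>
      (\<Sum>\<alpha>\<in>F. da_weight \<alpha> * (cmod (c n \<alpha> - l \<alpha>))\<^sup>2) \<le> e\<^sup>2" if e: "e > 0" for e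
  proof -
    from X[OF e] obtain N where N: "\<And>m n. m \<ge> N \<Longrightarrow> n \<ge> N \<Longrightarrow> norm (X m - X n) < e"
      by blast
    have "(\<Sum>\<alpha>\<in>F. da_weight \<alpha> * (cmod (c n \<alpha> - l \<alpha>))\<^sup>2) \<le> e\<^sup>2"
      if "n \<ge> N" "finite F" for n F
    proof (rule LIMSEQ_le_const2)
      show "(\<lambda>m. \<Sum>\<alpha>\<in>F. da_weight \<alpha> * (cmod (c n \<alpha> - c m \<alpha>))\<^sup>2)
          \<longlonglongrightarrow> (\<Sum>\<alpha>\<in>F. da_weight \<alpha> * (cmod (c n \<alpha> - l \<alpha>))\<^sup>2)"
        by (intro tendsto_intros l)
      have "(\<Sum>\<alpha>\<in>F. da_weight \<alpha> * (cmod (c n \<alpha> - c m \<alpha>))\<^sup>2) \<le> e\<^sup>2" if "m \<ge> N" for m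
      proof -
        have "(\<Sum>\<alpha>\<in>F. da_weight \<alpha> * (cmod (c n \<alpha> - c m \<alpha>))\<^sup>2) \<le> (norm (X n - X m))\<^sup>2"
          using da_sum_le_norm[OF \<open>finite F\<close>, of "X n - X m"] by (simp add: c_def da_coeff_minus)
        also have "\<dots> \<le> e\<^sup>2"
          using N[OF \<open>n \<ge> N\<close> that] by (intro power_mono) (auto simp: norm_drury_arveson.rep_eq
            intro!: infsum_nonneg mult_nonneg_nonneg less_imp_le[OF da_weight_pos])
        finally show ?thesis .
      qed
      then show "\<exists>N. \<forall>m\<ge>N. (\<Sum>\<alpha>\<in>F. da_weight \<alpha> * (cmod (c n \<alpha> - c m \<alpha>))\<^sup>2) \<le> e\<^sup>2"
        by blast
    qed
    then show ?thesis by blast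
  qed
  have summ: "(\<lambda>\<alpha>. da_weight \<alpha> * (cmod (c n \<alpha> - l \<alpha>))\<^sup>2) summable_on UNIV"
    if "\<And>F. finite F \<Longrightarrow> (\<Sum>\<alpha>\<in>F. da_weight \<alpha> * (cmod (c n \<alpha> - l \<alpha>))\<^sup>2) \<le> B" for n B
    using that by (intro nonneg_bdd_above_summable_on)
      (auto simp: bdd_above_def da_weight_pos less_imp_le)
  obtain N where "\<And>F. finite F \<Longrightarrow> (\<Sum>\<alpha>\<in>F. da_weight \<alpha> * (cmod (c N \<alpha> - l \<alpha>))\<^sup>2) \<le> 1\<^sup>2"
    using tail[of 1] by fastforce
  then have "da_summable (\<lambda>\<alpha>. c N \<alpha> - l \<alpha>)"
    unfolding da_summable_def by (rule summ)
  then have "da_summable (\<lambda>\<alpha>. c N \<alpha> + (- 1) * (c N \<alpha> - l \<alpha>))"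
    using coeff_da[of "X N"] unfolding c_def
    by (intro da_summable_add da_summable_scale) auto
  then have l_summ: "da_summable l"
    by simp
  define L where "L = Abs_drury_arveson l"
  have L: "coeff_da L = l"
    unfolding L_def using l_summ by (simp add: Abs_drury_arveson_inverse)
  have "\<exists>N. \<forall>n\<ge>N. norm (X n - L) < e" if "e > 0" for e
  proof -
    from tail[of "e/2"] that obtain N where N: "\<And>n F. n \<ge> N \<Longrightarrow> finite F \<Longrightarrow>
        (\<Sum>\<alpha>\<in>F. da_weight \<alpha> * (cmod (c n \<alpha> - l \<alpha>))\<^sup>2) \<le> (e/2)\<^sup>2"
      by auto
    have "norm (X n - L) < e" if "n \<ge> N" for n
    proof -
      have "(\<Sum>\<^sub>\<infinity>\<alpha>. da_weight \<alpha> * (cmod (c n \<alpha> - l \<alpha>))\<^sup>2) \<le> (e/2)\<^sup>2"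
        using N[OF that] by (intro infsum_le_finite_sums summ) auto
      then have "norm (X n - L) \<le> sqrt ((e/2)\<^sup>2)"
        by (simp only: norm_drury_arveson.rep_eq da_coeff_minus L c_def real_sqrt_le_iff)
      then show ?thesis using \<open>e > 0\<close> by simp
    qed
    then show ?thesis by blast
  qed
  then show ?thesis by blast
qed

instantiation drury_arveson :: (finite) chilbert_space
begin

lift_definition scaleC_drury_arveson :: "complex \<Rightarrow> 'a drury_arveson \<Rightarrow> 'a drury_arveson"
  is "\<lambda>a c \<alpha>. a * c \<alpha>"
  by (rule da_summable_scale)

lift_definition cinner_drury_arveson :: "'a drury_arveson \<Rightarrow> 'a drury_arveson \<Rightarrow> complex"
  is da_cinner .

instance
proof
  fix f g h :: "'a drury_arveson" and a b :: complex and r :: real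
  show "a *\<^sub>C (f + g) = a *\<^sub>C f + a *\<^sub>C g" "(a + b) *\<^sub>C f = a *\<^sub>C f + b *\<^sub>C f"
    "a *\<^sub>C b *\<^sub>C f = (a * b) *\<^sub>C f" "complex_of_real r *\<^sub>C f = r *\<^sub>R f"
    by (transfer; simp add: algebra_simps)+
  show "cinner f g = cnj (cinner g f)"
    by transfer (rule da_cinner_commute)
  show "cinner (f + g) h = cinner f h + cinner g h"
    by transfer (rule da_cinner_add_left)
  show "cinner (a *\<^sub>C f) g = a * cinner f g"
    by transfer (rule da_cinner_scale_left)
  show "Re (cinner f g) = inner f g"
    by transfer simp
next
  fix X :: "nat \<Rightarrow> 'a drury_arveson"
  assume "Cauchy X"
  then have "\<exists>L. \<forall>e>0. \<exists>N. \<forall>n\<ge>N. norm (X n - L) < e"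
    by (intro da_Cauchy_convergent) (auto simp: Cauchy_iff)
  then show "convergent X"
    by (auto simp: convergent_def lim_sequentially dist_norm)
qed

end

text \<open>The value of \<open>f = (\<Sum>\<alpha>. c\<^sub>\<alpha> x\<^sup>\<alpha>)\<close> at a point; the series converges absolutely on the open unit ball.\<close>

definition da_fun :: "'d::finite drury_arveson \<Rightarrow> complex ^ 'd \<Rightarrow> complex" where
  "da_fun f z = (\<Sum>\<^sub>\<infinity>\<alpha>. coeff_da f \<alpha> * (\<Prod>i\<in>UNIV. (z $ i) ^ \<alpha> i))"

section \<open>Multipliers\<close>

definition is_mult_op ::
    "(complex ^ 'd \<Rightarrow> complex) \<Rightarrow> ('d::finite drury_arveson \<Rightarrow>\<^sub>L 'd drury_arveson) \<Rightarrow> bool" where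
  "is_mult_op \<phi> M \<longleftrightarrow> (\<forall>f. \<forall>z\<in>ball 0 1. da_fun (M f) z = \<phi> z * da_fun f z)"

text \<open>The multiplier algebra, as an algebra of operators. Requiring \<open>M\<^sub>\<phi>\<close> to be bounded is no
  restriction, by the closed graph theorem.\<close>

definition multiplier_algebra :: "('d::finite drury_arveson \<Rightarrow>\<^sub>L 'd drury_arveson) set" where
  "multiplier_algebra = {M. \<exists>\<phi>. is_mult_op \<phi> M}"

definition shift :: "'d \<Rightarrow> ('d::finite drury_arveson \<Rightarrow>\<^sub>L 'd drury_arveson)" where
  "shift k = (THE M. is_mult_op (\<lambda>z. z $ k) M)"

section \<open>Row contractions\<close>

definition row_contraction :: "('d::finite \<Rightarrow> ('h::chilbert_space \<Rightarrow>\<^sub>L 'h)) \<Rightarrow> bool" where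
  "row_contraction T \<longleftrightarrow>
     (\<forall>k. T k \<in> cbounded) \<and> positive_op (id_blinfun - (\<Sum>k\<in>UNIV. T k o\<^sub>L hadjoint (T k)))"

definition commuting_tuple :: "('d::finite \<Rightarrow> ('h::chilbert_space \<Rightarrow>\<^sub>L 'h)) \<Rightarrow> bool" where
  "commuting_tuple T \<longleftrightarrow> (\<forall>i j. T i o\<^sub>L T j = T j o\<^sub>L T i)"

definition word_op :: "('d::finite \<Rightarrow> ('h::chilbert_space \<Rightarrow>\<^sub>L 'h)) \<Rightarrow> 'd list \<Rightarrow> ('h \<Rightarrow>\<^sub>L 'h)" where
  "word_op T w = foldr (\<lambda>k A. T k o\<^sub>L A) w id_blinfun"

definition pure_tuple :: "('d::finite \<Rightarrow> ('h::chilbert_space \<Rightarrow>\<^sub>L 'h)) \<Rightarrow> bool" where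
  "pure_tuple T \<longleftrightarrow>
     (\<forall>\<xi>. (\<lambda>n. \<Sum>w | length w = n. (norm (hadjoint (word_op T w) \<xi>))\<^sup>2) \<longlonglongrightarrow> 0)"

definition cyclic_vector :: "('d::finite \<Rightarrow> ('h::chilbert_space \<Rightarrow>\<^sub>L 'h)) \<Rightarrow> 'h \<Rightarrow> bool" where
  "cyclic_vector T \<xi> \<longleftrightarrow> closure (cspan (range (\<lambda>w. word_op T w \<xi>))) = UNIV"

definition cyclic_tuple :: "('d::finite \<Rightarrow> ('h::chilbert_space \<Rightarrow>\<^sub>L 'h)) \<Rightarrow> bool" where
  "cyclic_tuple T \<longleftrightarrow> (\<exists>\<xi>. cyclic_vector T \<xi>)"

section \<open>Functional calculus and annihilator\<close>

definition completely_contractive ::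
    "('a::chilbert_space \<Rightarrow>\<^sub>L 'a) set \<Rightarrow> (('a \<Rightarrow>\<^sub>L 'a) \<Rightarrow> ('h::chilbert_space \<Rightarrow>\<^sub>L 'h)) \<Rightarrow> bool" where
  "completely_contractive S \<Phi> \<longleftrightarrow>
     (\<forall>n A. (\<forall>i<n. \<forall>j<n. A i j \<in> S) \<longrightarrow>
        matrix_op_norm n (\<lambda>i j. \<Phi> (A i j)) \<le> matrix_op_norm n A)"

text \<open>The membership in \<open>\<rightarrow>\<^sub>E\<close> fixes the irrelevant values outside the multiplier algebra, so that
  for a pure commuting row contraction exactly one \<open>\<Phi>\<close> satisfies this predicate.\<close>

definition is_functional_calculus ::
    "('d::finite \<Rightarrow> ('h::chilbert_space \<Rightarrow>\<^sub>L 'h)) \<Rightarrow>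
     (('d drury_arveson \<Rightarrow>\<^sub>L 'd drury_arveson) \<Rightarrow> ('h \<Rightarrow>\<^sub>L 'h)) \<Rightarrow> bool" where
  "is_functional_calculus T \<Phi> \<longleftrightarrow>
     \<Phi> \<in> multiplier_algebra \<rightarrow>\<^sub>E cbounded \<and>
     (\<forall>A\<in>multiplier_algebra. \<forall>B\<in>multiplier_algebra. \<Phi> (A + B) = \<Phi> A + \<Phi> B) \<and>
     (\<forall>c. \<forall>A\<in>multiplier_algebra. \<Phi> (scale_op c A) = scale_op c (\<Phi> A)) \<and>
     (\<forall>A\<in>multiplier_algebra. \<forall>B\<in>multiplier_algebra. \<Phi> (A o\<^sub>L B) = \<Phi> A o\<^sub>L \<Phi> B) \<and>
     \<Phi> id_blinfun = id_blinfun \<and>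
     completely_contractive multiplier_algebra \<Phi> \<and>
     continuous_map (subtopology weak_star multiplier_algebra) weak_star \<Phi> \<and>
     (\<forall>k. \<Phi> (shift k) = T k)"

definition functional_calculus ::
    "('d::finite \<Rightarrow> ('h::chilbert_space \<Rightarrow>\<^sub>L 'h)) \<Rightarrow>
     ('d drury_arveson \<Rightarrow>\<^sub>L 'd drury_arveson) \<Rightarrow> ('h \<Rightarrow>\<^sub>L 'h)" where
  "functional_calculus T = (THE \<Phi>. is_functional_calculus T \<Phi>)"

definition Ann_c ::
    "('d::finite \<Rightarrow> ('h::chilbert_space \<Rightarrow>\<^sub>L 'h)) \<Rightarrow> ('d drury_arveson \<Rightarrow>\<^sub>L 'd drury_arveson) set" where
  "Ann_c T = {\<phi> \<in> multiplier_algebra. functional_calculus T \<phi> = 0}"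

section \<open>The compressed shift and quasi-affine transforms\<close>

definition ideal_space ::
    "('d::finite drury_arveson \<Rightarrow>\<^sub>L 'd drury_arveson) set \<Rightarrow> 'd drury_arveson set" where
  "ideal_space J = closure (cspan {blinfun_apply \<theta> f | \<theta> f. \<theta> \<in> J})"

definition quotient_space ::
    "('d::finite drury_arveson \<Rightarrow>\<^sub>L 'd drury_arveson) set \<Rightarrow> 'd drury_arveson set" where
  "quotient_space J = {g. \<forall>f\<in>ideal_space J. cinner g f = 0}"

definition compressed_shift ::
    "('d::finite drury_arveson \<Rightarrow>\<^sub>L 'd drury_arveson) set \<Rightarrow>
     'd \<Rightarrow> 'd drury_arveson \<Rightarrow> 'd drury_arveson" where
  "compressed_shift J k f = ortho_proj (quotient_space J) (shift k f)"

text \<open>\<open>quasi_affine_transform E A F B\<close>: the tuple \<open>A\<close> on the closed subspace \<open>E\<close> is a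
  quasi-affine transform of the tuple \<open>B\<close> on the closed subspace \<open>F\<close>. Values of \<open>A\<close>, \<open>B\<close>
  and \<open>X\<close> outside these subspaces play no role.\<close>

definition quasi_affine_transform ::
    "'a::chilbert_space set \<Rightarrow> ('d \<Rightarrow> 'a \<Rightarrow> 'a) \<Rightarrow>
     'b::chilbert_space set \<Rightarrow> ('d \<Rightarrow> 'b \<Rightarrow> 'b) \<Rightarrow> bool" where
  "quasi_affine_transform E A F B \<longleftrightarrow>
     (\<exists>X. X \<in> E \<rightarrow> F \<and>
       (\<forall>x\<in>E. \<forall>y\<in>E. X (x + y) = X x + X y) \<and>
       (\<forall>c. \<forall>x\<in>E. X (c *\<^sub>C x) = c *\<^sub>C X x) \<and>
       (\<exists>K. \<forall>x\<in>E. norm (X x) \<le> K * norm x) \<and>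
       inj_on X E \<and>
       F \<subseteq> closure (X ` E) \<and>
       (\<forall>k. \<forall>x\<in>E. X (A k x) = B k (X x)))"

end

theory Submission
  imports Defs "HOL-Complex_Analysis.Cauchy_Integral_Formula" "HOL-Combinatorics.Multiset_Permutations"
begin

text \<open>
  The Poisson kernel of \<open>T\<close> embeds the space isometrically into a direct sum of copies of \<open>H\<^sup>2\<close>;
  its adjoint \<open>X\<close> intertwines the ampliated shift with \<open>T\<close>, and \<open>A \<mapsto> X (A \<otimes> I) X\<^sup>*\<close> is the functional
  calculus. Everything else rests on one fact: each vector \<open>F\<close> of such a direct sum generates the
  same closed invariant subspace as \<open>C 1\<close> for some bounded \<open>C\<close> commuting with the shifts. To see this,
  lift \<open>F\<close> to the full Fock space, where the shifts are isometries with orthogonal ranges, take the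
  wandering vector of the cyclic subspace, and symmetrize. Consequently closed invariant subspaces
  are invariant under all multipliers, so that polynomials are weak-* dense and the functional
  calculus is unique. Finally, choose \<open>C\<close> for the image \<open>F\<close> of a cyclic vector and put \<open>Y = X C\<close>. Then \<open>Y\<close>
  intertwines the shift with \<open>T\<close> and has dense range. If \<open>Y f = 0\<close>, then \<open>f\<close> generates the same invariant
  subspace as some multiplier, which annihilates \<open>T\<close>; hence the kernel of \<open>Y\<close> is \<open>[J H\<^sup>2]\<close> and the
  restriction of \<open>Y\<close> to its orthogonal complement is the required quasi-affinity.
\<close>

section \<open>Complex Hilbert spaces\<close>

text \<open>\<open>functional_calculus\<close> is a definite description, so nothing can be said
  about \<open>Ann_c T\<close> until a calculus is known to exist and to be unique. For existence
  the obstacle is that the kernel of \<open>X\<close> is a priori invariant under the shifts only,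
  while multiplicativity of the calculus uses its invariance under every multiplier. For d > 1
  distinct words can have the same content and then act identically on H^2, so an orthogonal orbit
  over all words is available only on Fock space. There the orbit of the wandering vector w
  satisfies ||sum c_u L_u w|| = ||w|| (sum |c_u|^2)^(1/2). Symmetrization turns this into an upper
  bound, which is exactly what makes 1 -> w extend to a bounded operator on H^2. \<open>X\<close>
  alone does not finish the proof, since its domain consists of countably many copies of H^2;
  composing with \<open>C\<close> leaves one copy. Cyclicity enters three times: it makes the space
  separable, so that countably many copies suffice; it gives \<open>Y\<close> dense range; and it
  turns one vanishing value of an operator commuting with \<open>T\<close> into vanishing of the
  operator.\<close>

lemma cinner_add_right: "cinner x (y + z) = cinner x y + cinner x z"
  by (metis cinner_commute cinner_add_left complex_cnj_add)

lemma cinner_scaleC_right: "cinner x (c *\<^sub>C y) = cnj c * cinner x y"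
  by (metis cinner_commute cinner_scaleC_left complex_cnj_mult)

lemma cinner_Cauchy_Schwarz: "cmod (cinner x y) \<le> norm x * norm y"
proof (cases "cinner x y = 0")
  case False
  \<comment> \<open>The unimodular factor that rotates \<open>cinner x y\<close> onto the positive
    real axis, where it agrees with the real inner product.\<close>
  define c where "c = cnj (cinner x y) / of_real (cmod (cinner x y))"
  have "cinner (c *\<^sub>C x) y = of_real (cmod (cinner x y))"
    using False by (simp add: c_def cinner_scaleC_left mult.commute complex_norm_square[symmetric]
        power2_eq_square)
  then have "cmod (cinner x y) = inner (c *\<^sub>C x) y"
    by (simp flip: Re_cinner)
  also have "\<dots> \<le> norm (c *\<^sub>C x) * norm y"
    by (rule norm_cauchy_schwarz)
  also have "norm (c *\<^sub>C x) = norm x"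
    using False by (simp add: norm_scaleC c_def norm_divide)
  finally show ?thesis .
qed simp

global_interpretation cinner: bounded_bilinear cinner
proof
  fix x x' y y' :: 'a and r :: real
  show "cinner (x + x') y = cinner x y + cinner x' y" "cinner x (y + y') = cinner x y + cinner x y'"
    by (rule cinner_add_left cinner_add_right)+
  show "cinner (r *\<^sub>R x) y = r *\<^sub>R cinner x y" "cinner x (r *\<^sub>R y) = r *\<^sub>R cinner x y"
    by (simp_all add: scaleC_of_real[symmetric] cinner_scaleC_left cinner_scaleC_right scaleR_conv_of_real)
  show "\<exists>K. \<forall>x y. norm (cinner x y) \<le> norm x * norm y * K"
    by (rule exI[of _ 1]) (simp add: cinner_Cauchy_Schwarz)
qed

global_interpretation scaleC: bounded_bilinear "scaleC :: complex \<Rightarrow> 'a \<Rightarrow> 'a::chilbert_space"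
proof
  fix c c' :: complex and y y' :: 'a and r :: real
  show "(c + c') *\<^sub>C y = c *\<^sub>C y + c' *\<^sub>C y" "c *\<^sub>C (y + y') = c *\<^sub>C y + c *\<^sub>C y'"
    by (rule scaleC_add_left scaleC_add_right)+
  show "(r *\<^sub>R c) *\<^sub>C y = r *\<^sub>R c *\<^sub>C y" "c *\<^sub>C r *\<^sub>R y = r *\<^sub>R c *\<^sub>C y"
    by (simp_all add: scaleC_of_real[symmetric] scaleC_scaleC scaleR_conv_of_real mult.commute)
  show "\<exists>K. \<forall>c (y::'a). norm (c *\<^sub>C y) \<le> norm c * norm y * K"
    by (rule exI[of _ 1]) (simp add: norm_scaleC)
qed

lemma cinner_self: "cinner x x = of_real ((norm x)\<^sup>2)"
proof (rule complex_eqI)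
  show "Re (cinner x x) = Re (of_real ((norm x)\<^sup>2))"
    by (simp add: Re_cinner power2_norm_eq_inner)
  show "Im (cinner x x) = Im (of_real ((norm x)\<^sup>2))"
    using cinner_commute[of x x] by (metis Im_complex_of_real complex_In_mult_cnj_zero
        cnj.simps(2) equal_neg_zero)
qed

lemma cinner_eq_0_commute: "cinner x y = 0 \<longleftrightarrow> cinner y x = 0"
  by (metis cinner_commute complex_cnj_zero)

lemma cinner_ext: "(\<And>z. cinner x z = cinner y z) \<Longrightarrow> x = y"
  using cinner_self[of "x - y"] by (simp add: cinner.diff_left)

lemma norm_add_Pythagorean:
  "cinner x y = 0 \<Longrightarrow> (norm (x + y))\<^sup>2 = (norm x)\<^sup>2 + (norm y)\<^sup>2"
  by (metis Re_cinner norm_add_Pythagorean orthogonal_def zero_complex.sel(1))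

section \<open>Closed complex subspaces and closed spans\<close>

abbreviation csubspace :: "'a::chilbert_space set \<Rightarrow> bool" where
  "csubspace \<equiv> complex_vector.subspace"

lemma csubspace_imp_subspace: "csubspace M \<Longrightarrow> subspace M"
  by (auto simp: complex_vector.subspace_def subspace_def scaleC_of_real[symmetric])

lemma csubspace_closure:
  fixes M :: "'a::chilbert_space set"
  assumes "csubspace M" shows "csubspace (closure M)"
proof (rule complex_vector.subspaceI)
  show "0 \<in> closure M"
    using assms closure_subset complex_vector.subspace_0 by blast
  show "x + y \<in> closure M" if xy: "x \<in> closure M" "y \<in> closure M" for x y
  proof -
    obtain f g where "\<forall>n. f n \<in> M" "f \<longlonglongrightarrow> x" "\<forall>n. g n \<in> M" "g \<longlonglongrightarrow> y"
      using xy closure_sequential by metis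
    then show ?thesis
      using assms unfolding closure_sequential
      by (intro exI[of _ "\<lambda>n. f n + g n"]) (auto intro: tendsto_add complex_vector.subspace_add)
  qed
  show "c *\<^sub>C x \<in> closure M" if x: "x \<in> closure M" for c x
  proof -
    obtain f where "\<forall>n. f n \<in> M" "f \<longlonglongrightarrow> x"
      using x closure_sequential by metis
    then show ?thesis
      using assms unfolding closure_sequential
      by (intro exI[of _ "\<lambda>n. c *\<^sub>C f n"])
         (auto intro!: scaleC.tendsto complex_vector.subspace_scale)
  qed
qed

abbreviation cclosed_span :: "'a::chilbert_space set \<Rightarrow> 'a set" where
  "cclosed_span S \<equiv> closure (cspan S)"

lemma csubspace_cclosed_span: "csubspace (cclosed_span S)"
  by (simp add: csubspace_closure)

lemma cclosed_span_superset: "x \<in> S \<Longrightarrow> x \<in> cclosed_span S"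
  using closure_subset complex_vector.span_base by blast

lemma cclosed_span_minimal: "S \<subseteq> M \<Longrightarrow> csubspace M \<Longrightarrow> closed M \<Longrightarrow> cclosed_span S \<subseteq> M"
  by (simp add: closure_minimal complex_vector.span_minimal)

lemma csubspace_orthogonal: "csubspace {y. \<forall>x\<in>S. cinner y x = 0}"
  by (rule complex_vector.subspaceI) (auto simp: cinner_add_left cinner_scaleC_left cinner.zero_left)

lemma closed_orthogonal: "closed {y :: 'a::chilbert_space. \<forall>x\<in>S. cinner y x = 0}"
proof -
  have "{y. \<forall>x\<in>S. cinner y x = 0} = (\<Inter>x\<in>S. {y. cinner y x = 0})"
    by auto
  also have "closed \<dots>"
    by (intro closed_INT ballI closed_Collect_eq continuous_intros cinner.continuous_on)
  finally show ?thesis .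
qed

lemma orthogonal_cclosed_span:
  assumes "\<And>x. x \<in> S \<Longrightarrow> cinner y x = 0" and "x \<in> cclosed_span S"
  shows "cinner y x = 0"
proof -
  have "S \<subseteq> {x. \<forall>z\<in>{y}. cinner x z = 0}"
    using assms(1) by (auto simp: cinner_eq_0_commute)
  from cclosed_span_minimal[OF this csubspace_orthogonal closed_orthogonal] show ?thesis
    using assms(2) cinner_eq_0_commute by blast
qed

section \<open>Orthogonal projection and the Riesz representation theorem\<close>

lemma projection_real:
  fixes M :: "'a::{real_inner,complete_space} set"
  assumes "subspace M" "closed M"
  shows "\<exists>u\<in>M. \<forall>w\<in>M. inner (x - u) w = 0"
proof -
  define d where "d = infdist x M"
  have ne: "M \<noteq> {}" using assms(1) subspace_0 by blast
  have d_le: "d \<le> norm (x - m)" if "m \<in> M" for m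
    using infdist_le[OF that, of x] by (simp add: d_def dist_norm)
  have "d \<ge> 0" by (simp add: d_def infdist_nonneg)
  have "\<exists>m\<in>M. norm (x - m) < d + inverse (Suc n)" for n
  proof -
    have "infdist x M < d + inverse (Suc n)" by (simp add: d_def)
    then obtain m where "m \<in> M" "dist x m < d + inverse (Suc n)"
      using ne by (auto simp: infdist_def cINF_less_iff split: if_splits)
    then show ?thesis by (auto simp: dist_norm)
  qed
  then obtain m where m: "\<And>n. m n \<in> M" "\<And>n. norm (x - m n) < d + inverse (Suc n)"
    by metis
  \<comment> \<open>Parallelogram law at the midpoint of \<open>m i\<close> and \<open>m j\<close>,
    which lies in \<open>M\<close> and so has distance at least d from \<open>x\<close>. The 2 in
    \<open>4 * d + 2\<close> absorbs the squares, since t^2 <= t for t = 1/(n+1).\<close>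
  have gap: "(norm (m i - m j))\<^sup>2 \<le> (4 * d + 2) * (inverse (Suc i) + inverse (Suc j))" for i j
  proof -
    have mid: "(1/2) *\<^sub>R (m i + m j) \<in> M"
      using assms(1) m(1) by (intro subspace_scale subspace_add)
    have "(norm (m i - m j))\<^sup>2 = 2 * (norm (x - m i))\<^sup>2 + 2 * (norm (x - m j))\<^sup>2
        - 4 * (norm (x - (1/2) *\<^sub>R (m i + m j)))\<^sup>2"
      by (simp add: power2_norm_eq_inner inner_simps inner_commute algebra_simps)
    also have "\<dots> \<le> 2 * (d + inverse (Suc i))\<^sup>2 + 2 * (d + inverse (Suc j))\<^sup>2 - 4 * d\<^sup>2"
      using power_mono[OF d_le[OF mid] \<open>d \<ge> 0\<close>, of 2]
        power_mono[OF less_imp_le[OF m(2)[of i]] norm_ge_zero, of 2]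
        power_mono[OF less_imp_le[OF m(2)[of j]] norm_ge_zero, of 2] by linarith
    also have "\<dots> = 4 * d * (inverse (Suc i) + inverse (Suc j))
        + 2 * (inverse (Suc i))\<^sup>2 + 2 * (inverse (Suc j))\<^sup>2"
      by (simp add: power2_sum algebra_simps)
    also have "\<dots> \<le> (4 * d + 2) * (inverse (Suc i) + inverse (Suc j))"
    proof -
      have "(inverse (real (Suc n)))\<^sup>2 \<le> inverse (real (Suc n))" for n
        by (simp add: power2_eq_square divide_simps)
      from this[of i] this[of j] show ?thesis by (simp add: algebra_simps)
    qed
    finally show ?thesis .
  qed
  have "Cauchy m"
  proof (rule CauchyI)
    fix e :: real assume "e > 0"
    define q where "q = e\<^sup>2 / (4 * d + 2)"
    have "q / 2 > 0" using \<open>d \<ge> 0\<close> \<open>e > 0\<close> by (simp add: q_def)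
    then obtain N where N: "inverse (real (Suc N)) < q / 2"
      using reals_Archimedean by blast
    have "norm (m i - m j) < e" if "i \<ge> N" "j \<ge> N" for i j
    proof -
      have *: "inverse (real (Suc k)) \<le> inverse (real (Suc N))" if "k \<ge> N" for k
        using that by simp
      have "inverse (real (Suc i)) + inverse (real (Suc j)) < q"
        using *[OF that(1)] *[OF that(2)] N by linarith
      then have "(4 * d + 2) * (inverse (real (Suc i)) + inverse (real (Suc j))) < e\<^sup>2"
        using \<open>d \<ge> 0\<close> by (simp add: q_def pos_less_divide_eq mult.commute)
      then have "(norm (m i - m j))\<^sup>2 < e\<^sup>2"
        using gap[of i j] by linarith
      then show ?thesis using \<open>e > 0\<close> by (simp add: power_less_imp_less_base)
    qed
    then show "\<exists>N. \<forall>i\<ge>N. \<forall>j\<ge>N. norm (m i - m j) < e" by blast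
  qed
  then obtain u where u: "m \<longlonglongrightarrow> u"
    using Cauchy_convergent convergent_def by blast
  have "u \<in> M"
    using assms(2) m(1) u closed_sequentially by blast
  have "norm (x - u) \<le> d"
  proof (rule LIMSEQ_le)
    show "(\<lambda>n. norm (x - m n)) \<longlonglongrightarrow> norm (x - u)"
      by (intro tendsto_intros u)
    show "(\<lambda>n. d + inverse (real (Suc n))) \<longlonglongrightarrow> d"
      using tendsto_add[OF tendsto_const LIMSEQ_inverse_real_of_nat, of d] by simp
    show "\<exists>N. \<forall>n\<ge>N. norm (x - m n) \<le> d + inverse (real (Suc n))"
      using m(2) less_imp_le by blast
  qed
  have expand: "(norm (y - t *\<^sub>R w))\<^sup>2 = (norm y)\<^sup>2 - 2 * t * inner y w + t\<^sup>2 * (norm w)\<^sup>2" for y w :: 'a and t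
    unfolding power2_norm_eq_inner
    by (simp add: inner_diff_left inner_diff_right inner_commute power2_eq_square algebra_simps)
  have "inner (x - u) w = 0" if "w \<in> M" for w
  proof -
    define a where "a = inner (x - u) w"
    \<comment> \<open>Moving the nearest point \<open>u\<close> along \<open>w\<close> cannot
      decrease the distance. Taking t = a / ||w||^2 below then forces a = 0.\<close>
    have ineq: "2 * t * a \<le> t\<^sup>2 * (norm w)\<^sup>2" for t
    proof -
      have "u + t *\<^sub>R w \<in> M"
        using assms(1) \<open>u \<in> M\<close> that by (intro subspace_add subspace_scale)
      from d_le[OF this] have "norm (x - u) \<le> norm (x - u - t *\<^sub>R w)"
        using \<open>norm (x - u) \<le> d\<close> by (simp add: diff_diff_eq)
      then have "(norm (x - u))\<^sup>2 \<le> (norm (x - u - t *\<^sub>R w))\<^sup>2"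
        by (simp add: power_mono)
      also have "\<dots> = (norm (x - u))\<^sup>2 - 2 * t * a + t\<^sup>2 * (norm w)\<^sup>2"
        unfolding a_def
        by (simp only: expand)
      finally show ?thesis by simp
    qed
    show ?thesis
    proof (cases "w = 0")
      case False
      have "a\<^sup>2 \<le> 0"
        using ineq[of "a / (norm w)\<^sup>2"] False
        by (simp add: field_simps power2_eq_square)
      then show ?thesis by (simp add: a_def)
    qed simp
  qed
  with \<open>u \<in> M\<close> show ?thesis by blast
qed

lemma projection_exists:
  assumes "csubspace M" "closed M"
  obtains u where "u \<in> M" "\<And>w. w \<in> M \<Longrightarrow> cinner (x - u) w = 0"
proof -
  obtain u where u: "u \<in> M" "\<And>w. w \<in> M \<Longrightarrow> inner (x - u) w = 0"
    using projection_real[OF csubspace_imp_subspace[OF assms(1)] assms(2)] by blast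
  have "cinner (x - u) w = 0" if "w \<in> M" for w
  proof (rule complex_eqI)
    show "Re (cinner (x - u) w) = Re 0"
      using u(2)[OF that] by (simp add: Re_cinner)
    \<comment> \<open>Real orthogonality to \<open>\<i> *\<^sub>C w\<close> controls the imaginary
      part; this is where \<open>M\<close> has to be a complex subspace.\<close>
    have "inner (x - u) (\<i> *\<^sub>C w) = 0"
      using assms(1) that u(2) complex_vector.subspace_scale by blast
    then show "Im (cinner (x - u) w) = Im 0"
      by (simp flip: Re_cinner add: cinner_scaleC_right)
  qed
  with u(1) that show thesis by blast
qed

text \<open>Double orthogonal complement: split off the projection of \<open>x\<close> and test the
  hypothesis on the remainder \<open>x - u\<close>.\<close>

lemma in_cclosed_spanI:
  assumes "\<And>y. (\<And>s. s \<in> S \<Longrightarrow> cinner y s = 0) \<Longrightarrow> cinner y x = 0"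
  shows "x \<in> cclosed_span S"
proof -
  obtain u where u: "u \<in> cclosed_span S" "\<And>w. w \<in> cclosed_span S \<Longrightarrow> cinner (x - u) w = 0"
    using projection_exists[OF csubspace_cclosed_span closed_closure] by metis
  have "cinner (x - u) x = 0"
    by (rule assms) (simp add: u(2) cclosed_span_superset)
  then have "cinner (x - u) (x - u) = 0"
    by (simp add: cinner.diff_right u)
  then have "x = u"
    by (simp add: cinner_self)
  with u(1) show ?thesis by simp
qed

lemma ortho_proj_eqI:
  assumes "csubspace M" "u \<in> M" "\<And>w. w \<in> M \<Longrightarrow> cinner (x - u) w = 0"
  shows "ortho_proj M x = u"
  unfolding ortho_proj_def
proof (rule the_equality)
  fix v assume v: "v \<in> M \<and> (\<forall>w\<in>M. cinner (x - v) w = 0)"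
  then have "v - u \<in> M" by (simp add: assms complex_vector.subspace_diff)
  then have "cinner (x - u) (v - u) - cinner (x - v) (v - u) = 0"
    using assms(3) v by simp
  then have "cinner (v - u) (v - u) = 0"
    by (simp flip: cinner.diff_left)
  then show "v = u" by (simp add: cinner_self)
qed (use assms in blast)

lemma Riesz_representation:
  fixes f :: "'a::chilbert_space \<Rightarrow> complex"
  assumes "bounded_linear f" and hom: "\<And>c x. f (c *\<^sub>C x) = c * f x"
  obtains y where "\<And>x. f x = cinner x y"
proof (cases "\<forall>x. f x = 0")
  case True
  then show ?thesis using that[of 0] by (simp add: cinner.zero_right)
next
  case False
  then obtain x0 where x0: "f x0 \<noteq> 0" by blast
  interpret f: bounded_linear f by fact
  define M where "M = {x. f x = 0}"
  have "csubspace M" "closed M"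
    by (auto intro!: complex_vector.subspaceI closed_Collect_eq continuous_intros
        f.continuous_on simp: M_def f.add hom f.zero)
  from projection_exists[OF this] obtain u
    where u: "u \<in> M" "\<And>w. w \<in> M \<Longrightarrow> cinner (x0 - u) w = 0" by metis
  define z where "z = x0 - u"
  have fz: "f z = f x0" using u(1) by (simp add: z_def f.diff M_def)
  then have "z \<noteq> 0" using x0 f.zero by auto
  then have zz: "cinner z z \<noteq> 0" by (simp add: cinner_self)
  have "f x = cinner x ((cnj (f z) / cinner z z) *\<^sub>C z)" for x
  proof -
    \<comment> \<open>This combination is chosen to lie in the kernel of \<open>f\<close>. Since
      \<open>z\<close> is orthogonal to the kernel, pairing with \<open>z\<close> expresses
      \<open>f x\<close> as an inner product with a multiple of \<open>z\<close>.\<close>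
    have "f x *\<^sub>C z - f z *\<^sub>C x \<in> M" by (simp add: M_def f.diff hom)
    then have "cinner (f x *\<^sub>C z - f z *\<^sub>C x) z = 0"
      using u(2) cinner_eq_0_commute z_def by blast
    then have "f x * cinner z z = f z * cinner x z"
      by (simp add: cinner.diff_left cinner_scaleC_left)
    moreover have "cnj (cinner z z) = cinner z z" by (simp flip: cinner_commute)
    ultimately show ?thesis
      using zz by (simp add: cinner_scaleC_right field_simps)
  qed
  then show ?thesis using that by blast
qed

section \<open>Bounded operators and adjoints\<close>

lemma cboundedI: "(\<And>c x. blinfun_apply A (c *\<^sub>C x) = c *\<^sub>C A x) \<Longrightarrow> A \<in> cbounded"
  by (simp add: cbounded_def)

lemma cbounded_scaleC: "A \<in> cbounded \<Longrightarrow> blinfun_apply A (c *\<^sub>C x) = c *\<^sub>C A x"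
  by (simp add: cbounded_def)

lemma cbounded_id: "id_blinfun \<in> cbounded"
  by (simp add: cbounded_def)

lemma cbounded_compose: "A \<in> cbounded \<Longrightarrow> B \<in> cbounded \<Longrightarrow> A o\<^sub>L B \<in> cbounded"
  by (simp add: cbounded_def)

lemma cbounded_add: "A \<in> cbounded \<Longrightarrow> B \<in> cbounded \<Longrightarrow> A + B \<in> cbounded"
  by (simp add: cbounded_def blinfun.add_left scaleC_add_right)

lemma cbounded_scale_op: "A \<in> cbounded \<Longrightarrow> scale_op c A \<in> cbounded"
  by (simp add: cbounded_def scale_op.rep_eq scaleC_scaleC mult.commute)

lemma csubspace_vimage:
  assumes "A \<in> cbounded" "csubspace M" shows "csubspace {x. blinfun_apply A x \<in> M}"
  using assms(2) by (intro complex_vector.subspaceI)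
    (auto simp: blinfun.add_right cbounded_scaleC[OF assms(1)] blinfun.zero_right
      complex_vector.subspace_0 intro: complex_vector.subspace_add complex_vector.subspace_scale)

lemma closed_vimage_blinfun:
  "closed M \<Longrightarrow> closed {x. blinfun_apply A x \<in> M}"
  using continuous_closed_vimage[of M "blinfun_apply A"]
  by (simp add: vimage_def linear_continuous_at blinfun.bounded_linear_right)

lemma csubspace_equalizer:
  assumes "A \<in> cbounded" "B \<in> cbounded" shows "csubspace {x. blinfun_apply A x = blinfun_apply B x}"
  by (intro complex_vector.subspaceI)
    (auto simp: blinfun.add_right cbounded_scaleC[OF assms(1)] cbounded_scaleC[OF assms(2)] blinfun.zero_right)

lemma closed_equalizer: "closed {x. blinfun_apply A x = blinfun_apply B x}"
  by (intro closed_Collect_eq continuous_intros)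

lemma adjoint_exists:
  fixes A :: "'a::chilbert_space \<Rightarrow>\<^sub>L 'b::chilbert_space"
  assumes "A \<in> cbounded"
  obtains B where "\<And>x y. cinner (A x) y = cinner x (blinfun_apply B y)"
proof -
  have "\<exists>z. \<forall>x. cinner (A x) y = cinner x z" for y
    by (rule Riesz_representation[of "\<lambda>x. cinner (A x) y"])
       (auto intro: bounded_linear_intros cinner.bounded_linear_left
         bounded_linear_compose[OF cinner.bounded_linear_left blinfun.bounded_linear_right]
         simp: cbounded_scaleC[OF assms] cinner_scaleC_left)
  then obtain g where g: "\<And>x y. cinner (A x) y = cinner x (g y)" by metis
  have g': "cinner (g y) x = cinner y (A x)" for x y
    by (metis g cinner_commute)
  have "bounded_linear g"
  proof (rule bounded_linear_intro[where K = "norm A"])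
    show "g (y + z) = g y + g z" for y z
      by (rule cinner_ext) (simp add: g' cinner_add_left)
    show "g (r *\<^sub>R y) = r *\<^sub>R g y" for r y
      by (rule cinner_ext) (simp add: g' cinner.scaleR_left)
    show "norm (g y) \<le> norm y * norm A" for y
    proof (cases "g y = 0")
      case False
      have "(norm (g y))\<^sup>2 = cmod (cinner (A (g y)) y)"
        by (simp add: g cinner_self norm_power)
      also have "\<dots> \<le> norm (A (g y)) * norm y"
        by (rule cinner_Cauchy_Schwarz)
      also have "\<dots> \<le> norm A * norm (g y) * norm y"
        by (intro mult_right_mono norm_blinfun) simp
      finally show ?thesis
        using False by (simp add: power2_eq_square mult_ac)
    qed simp
  qed
  from that[of "Blinfun g"] show thesis
    by (simp add: bounded_linear_Blinfun_apply[OF \<open>bounded_linear g\<close>] g)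
qed

lemma hadjoint_unique:
  assumes "\<And>x y. cinner (blinfun_apply A x) y = cinner x (blinfun_apply B y)"
  shows "hadjoint A = B"
  unfolding hadjoint_def
proof (rule the_equality)
  fix B' assume "\<forall>x y. cinner (A x) y = cinner x (blinfun_apply B' y)"
  then show "B' = B"
    by (intro blinfun_eqI cinner_ext) (metis assms cinner_commute)
qed (use assms in blast)

lemma hadjoint: "A \<in> cbounded \<Longrightarrow> cinner (blinfun_apply A x) y = cinner x (hadjoint A y)"
  by (metis adjoint_exists hadjoint_unique)

lemma hadjoint': "A \<in> cbounded \<Longrightarrow> cinner (hadjoint A x) y = cinner x (blinfun_apply A y)"
  by (metis hadjoint cinner_commute)

lemma hadjoint_cbounded: "A \<in> cbounded \<Longrightarrow> hadjoint A \<in> cbounded"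
  by (intro cboundedI cinner_ext) (simp add: hadjoint' cinner_scaleC_left)

lemma hadjoint_compose:
  "A \<in> cbounded \<Longrightarrow> B \<in> cbounded \<Longrightarrow> hadjoint (A o\<^sub>L B) = hadjoint B o\<^sub>L hadjoint A"
  by (rule hadjoint_unique) (simp add: hadjoint)

lemma hadjoint_id: "hadjoint id_blinfun = id_blinfun"
  by (rule hadjoint_unique) simp

lemma norm_hadjoint_le:
  assumes "A \<in> cbounded" "\<And>x. norm (blinfun_apply A x) \<le> K * norm x" "K \<ge> 0"
  shows "norm (hadjoint A y) \<le> K * norm y"
proof (cases "hadjoint A y = 0")
  case False
  let ?z = "hadjoint A y"
  have "(norm ?z)\<^sup>2 = cmod (cinner (A ?z) y)"
    by (simp add: hadjoint assms(1) cinner_self norm_power)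
  also have "\<dots> \<le> norm (A ?z) * norm y"
    by (rule cinner_Cauchy_Schwarz)
  also have "\<dots> \<le> K * norm ?z * norm y"
    by (intro mult_right_mono assms) simp
  finally show ?thesis
    using False by (simp add: power2_eq_square mult_ac)
qed (use assms(3) in simp)

section \<open>Words\<close>

lemma word_op_Nil [simp]: "word_op T [] = id_blinfun"
  by (simp add: word_op_def)

lemma word_op_Cons [simp]: "word_op T (k # w) = T k o\<^sub>L word_op T w"
  by (simp add: word_op_def)

lemma blinfun_compose_assoc: "(A o\<^sub>L B) o\<^sub>L C = A o\<^sub>L (B o\<^sub>L C)"
  by (rule blinfun_eqI) simp

lemma word_op_append: "word_op T (u @ v) = word_op T u o\<^sub>L word_op T v"
  by (induction u) (auto simp: blinfun_compose_assoc intro!: blinfun_eqI)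

lemma word_op_cbounded: "(\<And>k. T k \<in> cbounded) \<Longrightarrow> word_op T w \<in> cbounded"
  by (induction w) (auto intro: cbounded_id cbounded_compose)

lemma word_op_commute:
  assumes "\<And>k. A o\<^sub>L T k = T' k o\<^sub>L A" shows "A o\<^sub>L word_op T w = word_op T' w o\<^sub>L A"
proof (induction w)
  case (Cons k w)
  have "A o\<^sub>L word_op T (k # w) = T' k o\<^sub>L (A o\<^sub>L word_op T w)"
    by (simp add: blinfun_compose_assoc[symmetric] assms)
  then show ?case by (simp add: Cons blinfun_compose_assoc)
qed (simp add: blinfun_eqI)

section \<open>Closed invariant subspaces generated by one vector\<close>

definition cyclic_space :: "('d::finite \<Rightarrow> 'h::chilbert_space \<Rightarrow>\<^sub>L 'h) \<Rightarrow> 'h \<Rightarrow> 'h set" where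
  "cyclic_space T x = cclosed_span (range (\<lambda>w. word_op T w x))"

lemma csubspace_cyclic_space: "csubspace (cyclic_space T x)"
  unfolding cyclic_space_def by (rule csubspace_cclosed_span)

lemma closed_cyclic_space: "closed (cyclic_space T x)"
  by (simp add: cyclic_space_def)

lemma word_in_cyclic_space: "word_op T w x \<in> cyclic_space T x"
  by (simp add: cyclic_space_def cclosed_span_superset)

lemma cyclic_space_self: "x \<in> cyclic_space T x"
  using word_in_cyclic_space[of T "[]" x] by simp

lemma cyclic_space_minimal:
  assumes "csubspace M" "closed M" "x \<in> M" "\<And>k y. y \<in> M \<Longrightarrow> blinfun_apply (T k) y \<in> M"
  shows "cyclic_space T x \<subseteq> M"
  unfolding cyclic_space_def
proof (rule cclosed_span_minimal)
  have "word_op T w x \<in> M" for w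
    by (induction w) (auto simp: assms)
  then show "range (\<lambda>w. word_op T w x) \<subseteq> M" by blast
qed fact+

lemma cyclic_space_image:
  assumes "A \<in> cbounded" "\<And>k. A o\<^sub>L T k = T' k o\<^sub>L A" "y \<in> cyclic_space T x"
  shows "blinfun_apply A y \<in> cyclic_space T' (A x)"
proof -
  have "cyclic_space T x \<subseteq> {y. A y \<in> cyclic_space T' (A x)}"
    unfolding cyclic_space_def[of T]
  proof (rule cclosed_span_minimal)
    show "range (\<lambda>w. word_op T w x) \<subseteq> {y. A y \<in> cyclic_space T' (A x)}"
      using word_op_commute[of A T T', OF assms(2)] word_in_cyclic_space[of T' _ "A x"]
      by (auto simp flip: blinfun_apply_blinfun_compose)
  qed (auto intro: csubspace_vimage closed_vimage_blinfun assms csubspace_cyclic_space closed_cyclic_space)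
  with assms(3) show ?thesis by blast
qed

lemma cyclic_space_invariant:
  assumes "\<And>k. T k \<in> cbounded" "y \<in> cyclic_space T x"
  shows "blinfun_apply (T k) y \<in> cyclic_space T x"
proof -
  have "cyclic_space T x \<subseteq> {y. T k y \<in> cyclic_space T x}"
    unfolding cyclic_space_def[of T x]
  proof (rule cclosed_span_minimal)
    have "T k (word_op T w x) \<in> cyclic_space T x" for w
      using word_in_cyclic_space[of T "k # w" x] by simp
    then show "range (\<lambda>w. word_op T w x) \<subseteq> {y. T k y \<in> cclosed_span (range (\<lambda>w. word_op T w x))}"
      by (auto simp: cyclic_space_def)
  qed (auto intro: csubspace_vimage closed_vimage_blinfun assms csubspace_cclosed_span)
  with assms(2) show ?thesis by blast
qed

section \<open>Square-summable families\<close>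

text \<open>The scalars are made a Hilbert space so that the full Fock space becomes the case of
  complex fibres of \<open>ell2\<close>.\<close>

instantiation complex :: chilbert_space
begin

definition scaleC_complex :: "complex \<Rightarrow> complex \<Rightarrow> complex" where
  "scaleC_complex a x = a * x"

definition cinner_complex :: "complex \<Rightarrow> complex \<Rightarrow> complex" where
  "cinner_complex x y = x * cnj y"

instance
  by standard (auto simp: scaleC_complex_def cinner_complex_def algebra_simps scaleR_conv_of_real
      inner_complex_def)

end

lemma norm_add_sq_le: "(norm (x + y))\<^sup>2 \<le> 2 * (norm x)\<^sup>2 + 2 * (norm (y::'a::real_normed_vector))\<^sup>2"
proof -
  have "(norm (x + y))\<^sup>2 \<le> (norm x + norm y)\<^sup>2"
    by (simp add: norm_triangle_ineq power_mono)
  also have "\<dots> \<le> 2 * (norm x)\<^sup>2 + 2 * (norm y)\<^sup>2"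
    using sum_squares_bound[of "norm x" "norm y"] by (simp add: power2_sum)
  finally show ?thesis .
qed

definition sq_summable :: "('i \<Rightarrow> 'v::chilbert_space) \<Rightarrow> bool" where
  "sq_summable f \<longleftrightarrow> (\<lambda>i. (norm (f i))\<^sup>2) summable_on UNIV"

lemma sq_summableI:
  assumes "\<And>F. finite F \<Longrightarrow> (\<Sum>i\<in>F. (norm (f i))\<^sup>2) \<le> B" shows "sq_summable f"
  unfolding sq_summable_def
  using assms by (intro nonneg_bdd_above_summable_on) (auto simp: bdd_above_def)

lemma sq_summable_add:
  assumes "sq_summable f" "sq_summable g" shows "sq_summable (\<lambda>i. f i + g i)"
proof -
  have "(\<lambda>i. 2 * (norm (f i))\<^sup>2 + 2 * (norm (g i))\<^sup>2) summable_on UNIV"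
    using assms unfolding sq_summable_def by (intro summable_on_add summable_on_cmult_right)
  then show ?thesis
    unfolding sq_summable_def by (rule summable_on_comparison_test) (auto simp: norm_add_sq_le)
qed

lemma sq_summable_bound:
  assumes "sq_summable f" "\<And>i. norm (g i) \<le> K * norm (f i)" shows "sq_summable g"
proof -
  have "(\<lambda>i. K\<^sup>2 * (norm (f i))\<^sup>2) summable_on UNIV"
    using assms(1) unfolding sq_summable_def by (rule summable_on_cmult_right)
  moreover have "(norm (g i))\<^sup>2 \<le> K\<^sup>2 * (norm (f i))\<^sup>2" for i
    using power_mono[OF assms(2) norm_ge_zero, of i 2] by (simp add: power_mult_distrib)
  ultimately show ?thesis
    unfolding sq_summable_def by (rule summable_on_comparison_test) auto
qed

lemma sq_summable_scaleC: "sq_summable f \<Longrightarrow> sq_summable (\<lambda>i. c *\<^sub>C f i)"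
  by (rule sq_summable_bound[where K = "cmod c"]) (auto simp: norm_scaleC)

lemma sq_summable_scaleR: "sq_summable f \<Longrightarrow> sq_summable (\<lambda>i. r *\<^sub>R f i)"
  by (rule sq_summable_bound[where K = "\<bar>r\<bar>"]) auto

lemma sq_summable_uminus: "sq_summable f \<Longrightarrow> sq_summable (\<lambda>i. - f i)"
  by (simp add: sq_summable_def)

lemma cinner_abs_summable:
  assumes "sq_summable f" "sq_summable g"
  shows "(\<lambda>i. norm (cinner (f i) (g i))) summable_on UNIV"
proof -
  have "(\<lambda>i. (norm (f i))\<^sup>2 + (norm (g i))\<^sup>2) summable_on UNIV"
    using assms unfolding sq_summable_def by (rule summable_on_add)
  moreover have "norm (cinner (f i) (g i)) \<le> (norm (f i))\<^sup>2 + (norm (g i))\<^sup>2" for i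
    using cinner_Cauchy_Schwarz[of "f i" "g i"] sum_squares_bound[of "norm (f i)" "norm (g i)"]
      mult_nonneg_nonneg[OF norm_ge_zero[of "f i"] norm_ge_zero[of "g i"]] by linarith
  ultimately show ?thesis
    by (rule summable_on_comparison_test) auto
qed

lemma cinner_summable:
  "sq_summable f \<Longrightarrow> sq_summable g \<Longrightarrow> (\<lambda>i. cinner (f i) (g i)) summable_on UNIV"
  by (rule abs_summable_summable) (rule cinner_abs_summable)

text \<open>The Hilbert space tensor product of l^2 over the index type with the fibre. One type
  serves twice: words with scalar fibres give Fock space, and copies of H^2 or of Fock space carry
  the ampliations.\<close>

typedef (overloaded) ('i, 'v::chilbert_space) ell2 = "{f :: 'i \<Rightarrow> 'v. sq_summable f}"
  morphisms coord Abs_ell2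
  by (rule exI[of _ "\<lambda>_. 0"]) (simp add: sq_summable_def)

setup_lifting type_definition_ell2

instantiation ell2 :: (type, chilbert_space) real_inner
begin

lift_definition zero_ell2 :: "('a, 'b) ell2" is "\<lambda>_. 0"
  by (simp add: sq_summable_def)

lift_definition plus_ell2 :: "('a, 'b) ell2 \<Rightarrow> ('a, 'b) ell2 \<Rightarrow> ('a, 'b) ell2"
  is "\<lambda>f g i. f i + g i" by (rule sq_summable_add)

lift_definition uminus_ell2 :: "('a, 'b) ell2 \<Rightarrow> ('a, 'b) ell2"
  is "\<lambda>f i. - f i" by (rule sq_summable_uminus)

definition minus_ell2 :: "('a, 'b) ell2 \<Rightarrow> ('a, 'b) ell2 \<Rightarrow> ('a, 'b) ell2" where
  "minus_ell2 f g = f + - g"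

lift_definition scaleR_ell2 :: "real \<Rightarrow> ('a, 'b) ell2 \<Rightarrow> ('a, 'b) ell2"
  is "\<lambda>r f i. r *\<^sub>R f i" by (rule sq_summable_scaleR)

lift_definition inner_ell2 :: "('a, 'b) ell2 \<Rightarrow> ('a, 'b) ell2 \<Rightarrow> real"
  is "\<lambda>f g. Re (\<Sum>\<^sub>\<infinity>i. cinner (f i) (g i))" .

lift_definition norm_ell2 :: "('a, 'b) ell2 \<Rightarrow> real"
  is "\<lambda>f. sqrt (\<Sum>\<^sub>\<infinity>i. (norm (f i))\<^sup>2)" .

definition dist_ell2 :: "('a, 'b) ell2 \<Rightarrow> ('a, 'b) ell2 \<Rightarrow> real" where
  "dist_ell2 f g = norm (f - g)"

definition sgn_ell2 :: "('a, 'b) ell2 \<Rightarrow> ('a, 'b) ell2" where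
  "sgn_ell2 f = inverse (norm f) *\<^sub>R f"

definition uniformity_ell2 :: "(('a, 'b) ell2 \<times> ('a, 'b) ell2) filter" where
  "uniformity_ell2 = (INF e\<in>{0<..}. principal {(x, y). dist x y < e})"

definition open_ell2 :: "('a, 'b) ell2 set \<Rightarrow> bool" where
  "open_ell2 U \<longleftrightarrow> (\<forall>x\<in>U. eventually (\<lambda>(x', y). x' = x \<longrightarrow> y \<in> U) uniformity)"

lemma ell2_inner_self:
  "sq_summable f \<Longrightarrow> Re (\<Sum>\<^sub>\<infinity>i. cinner (f i) (f i)) = (\<Sum>\<^sub>\<infinity>i. (norm (f i))\<^sup>2)"
proof -
  assume f: "sq_summable f"
  have "((\<lambda>i. complex_of_real ((norm (f i))\<^sup>2)) has_sum of_real (\<Sum>\<^sub>\<infinity>i. (norm (f i))\<^sup>2)) UNIV"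
    using f by (intro has_sum_of_real has_sum_infsum) (simp add: sq_summable_def)
  then show ?thesis
    unfolding cinner_self by (simp add: infsumI)
qed

instance
proof
  fix f g h :: "('a, 'b) ell2" and r s :: real
  show "f + g + h = f + (g + h)" "f + g = g + f" "0 + f = f" "- f + f = 0"
    by (transfer; simp add: add_ac)+
  show "f - g = f + - g"
    by (simp add: minus_ell2_def)
  show "r *\<^sub>R (f + g) = r *\<^sub>R f + r *\<^sub>R g" "(r + s) *\<^sub>R f = r *\<^sub>R f + s *\<^sub>R f"
    "r *\<^sub>R s *\<^sub>R f = (r * s) *\<^sub>R f" "1 *\<^sub>R f = f"
    by (transfer; simp add: algebra_simps)+
  show "inner f g = inner g f"
    by transfer (subst cinner_commute, simp)
  show "inner (f + g) h = inner f h + inner g h"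
    by transfer (simp add: cinner_add_left infsum_add cinner_summable)
  show "inner (r *\<^sub>R f) g = r * inner f g"
    by transfer (simp add: cinner.scaleR_left infsum_scaleR_right)
  show "0 \<le> inner f f"
    by transfer (simp add: ell2_inner_self infsum_nonneg)
  show "norm f = sqrt (inner f f)"
    by transfer (simp add: ell2_inner_self)
  show "inner f f = 0 \<longleftrightarrow> f = 0"
  proof
    show "inner f f = 0 \<Longrightarrow> f = 0"
    proof (transfer, rule ext)
      fix f :: "'a \<Rightarrow> 'b" and i
      assume f: "sq_summable f" "Re (\<Sum>\<^sub>\<infinity>i. cinner (f i) (f i)) = 0"
      then have "(norm (f i))\<^sup>2 = 0"
        by (intro nonneg_infsum_le_0D[where A = UNIV]) (auto simp: ell2_inner_self sq_summable_def)
      then show "f i = 0" by simp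
    qed
    show "f = 0 \<Longrightarrow> inner f f = 0"
      by transfer (simp add: cinner.zero_left)
  qed
  show "dist f g = norm (f - g)"
    by (simp add: dist_ell2_def)
  show "sgn f = inverse (norm f) *\<^sub>R f"
    by (simp add: sgn_ell2_def)
  show "uniformity = (INF e\<in>{0<..}. principal {(x, y :: ('a, 'b) ell2). dist x y < e})"
    by (simp add: uniformity_ell2_def)
  show "open U = (\<forall>x\<in>U. \<forall>\<^sub>F (x', y) in uniformity. x' = x \<longrightarrow> y \<in> U)"
    for U :: "('a, 'b) ell2 set"
    by (simp add: open_ell2_def)
qed

end

lemma coord_sq_summable: "sq_summable (coord f)"
  using coord by blast

lemma coord_summable: "(\<lambda>i. (norm (coord f i))\<^sup>2) summable_on UNIV"
  using coord_sq_summable by (simp add: sq_summable_def)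

lemma coord_add: "coord (f + g) i = coord f i + coord g i"
  by transfer simp

lemma coord_minus: "coord (f - g) i = coord f i - coord g i"
  unfolding minus_ell2_def plus_ell2.rep_eq uminus_ell2.rep_eq by simp

lemma norm_ell2_sq: "(norm f)\<^sup>2 = (\<Sum>\<^sub>\<infinity>i. (norm (coord f i))\<^sup>2)"
  by (simp add: norm_ell2.rep_eq infsum_nonneg)

lemma has_sum_norm_ell2: "((\<lambda>i. (norm (coord f i))\<^sup>2) has_sum (norm f)\<^sup>2) UNIV"
  using coord_summable[of f] by (simp add: norm_ell2_sq)

lemma ell2_finite_sum_le: "finite F \<Longrightarrow> (\<Sum>i\<in>F. (norm (coord f i))\<^sup>2) \<le> (norm f)\<^sup>2"
  unfolding norm_ell2_sq by (intro finite_sum_le_infsum coord_summable) auto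

lemma norm_coord_le: "norm (coord f i) \<le> norm f"
  using ell2_finite_sum_le[of "{i}" f] by (auto intro: power2_le_imp_le[OF _ norm_ge_zero])

lemma norm_ell2_leI:
  assumes "\<And>F. finite F \<Longrightarrow> (\<Sum>i\<in>F. (norm (coord f i))\<^sup>2) \<le> B\<^sup>2" "B \<ge> 0"
  shows "norm f \<le> B"
proof -
  have "(norm f)\<^sup>2 \<le> B\<^sup>2"
    unfolding norm_ell2_sq by (rule infsum_le_finite_sums[OF coord_summable]) (rule assms(1))
  then show ?thesis using assms(2) by (rule power2_le_imp_le)
qed

instantiation ell2 :: (type, chilbert_space) chilbert_space
begin

lift_definition scaleC_ell2 :: "complex \<Rightarrow> ('a, 'b) ell2 \<Rightarrow> ('a, 'b) ell2"
  is "\<lambda>c f i. c *\<^sub>C f i" by (rule sq_summable_scaleC)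

lift_definition cinner_ell2 :: "('a, 'b) ell2 \<Rightarrow> ('a, 'b) ell2 \<Rightarrow> complex"
  is "\<lambda>f g. \<Sum>\<^sub>\<infinity>i. cinner (f i) (g i)" .

instance
proof
  fix f g h :: "('a, 'b) ell2" and a b :: complex and r :: real
  show "a *\<^sub>C (f + g) = a *\<^sub>C f + a *\<^sub>C g" "(a + b) *\<^sub>C f = a *\<^sub>C f + b *\<^sub>C f"
    "a *\<^sub>C b *\<^sub>C f = (a * b) *\<^sub>C f" "complex_of_real r *\<^sub>C f = r *\<^sub>R f"
    by (transfer; simp add: scaleC_add_left scaleC_add_right scaleC_scaleC scaleC_of_real)+
  show "cinner f g = cnj (cinner g f)"
    by transfer (subst cinner_commute, simp)
  show "cinner (f + g) h = cinner f h + cinner g h"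
    by transfer (simp add: cinner_add_left infsum_add cinner_summable)
  show "cinner (a *\<^sub>C f) g = a * cinner f g"
    by transfer (simp add: cinner_scaleC_left infsum_cmult_right')
  show "Re (cinner f g) = inner f g"
    by transfer simp
next
  fix X :: "nat \<Rightarrow> ('a, 'b) ell2"
  assume X: "Cauchy X"
  have "Cauchy (\<lambda>n. coord (X n) i)" for i
  proof (rule CauchyI)
    fix e :: real assume "e > 0"
    from CauchyD[OF X this]
    obtain M where M: "\<And>m n. m \<ge> M \<Longrightarrow> n \<ge> M \<Longrightarrow> norm (X m - X n) < e"
      by blast
    have "norm (coord (X m) i - coord (X n) i) < e" if "m \<ge> M" "n \<ge> M" for m n
      using norm_coord_le[of "X m - X n" i] M[OF that] by (simp add: coord_minus)
    then show "\<exists>M. \<forall>m\<ge>M. \<forall>n\<ge>M. norm (coord (X m) i - coord (X n) i) < e" by blast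
  qed
  then have "\<forall>i. \<exists>l. (\<lambda>n. coord (X n) i) \<longlonglongrightarrow> l"
    by (simp add: Cauchy_convergent_iff convergent_def)
  then obtain l where l: "\<And>i. (\<lambda>n. coord (X n) i) \<longlonglongrightarrow> l i"
    by metis
  \<comment> \<open>Bounds over finite sets survive the limit in m; the infinite sum is reached only
    afterwards, through \<open>norm_ell2_leI\<close>.\<close>
  have tail: "\<exists>N. \<forall>n\<ge>N. \<forall>F. finite F \<longrightarrow> (\<Sum>i\<in>F. (norm (coord (X n) i - l i))\<^sup>2) \<le> e\<^sup>2"
    if "e > 0" for e
  proof -
    from CauchyD[OF X \<open>e > 0\<close>]
    obtain N where N: "\<And>m n. m \<ge> N \<Longrightarrow> n \<ge> N \<Longrightarrow> norm (X m - X n) < e"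
      by blast
    have "(\<Sum>i\<in>F. (norm (coord (X n) i - l i))\<^sup>2) \<le> e\<^sup>2" if "n \<ge> N" "finite F" for n F
    proof (rule LIMSEQ_le_const2)
      show "(\<lambda>m. \<Sum>i\<in>F. (norm (coord (X n) i - coord (X m) i))\<^sup>2)
          \<longlonglongrightarrow> (\<Sum>i\<in>F. (norm (coord (X n) i - l i))\<^sup>2)"
        by (intro tendsto_intros l)
      have "(\<Sum>i\<in>F. (norm (coord (X n) i - coord (X m) i))\<^sup>2) \<le> e\<^sup>2" if "m \<ge> N" for m
        using ell2_finite_sum_le[OF \<open>finite F\<close>, of "X n - X m"]
          power_mono[OF less_imp_le[OF N[OF \<open>n \<ge> N\<close> that]] norm_ge_zero, of 2]
        by (simp add: coord_minus)
      then show "\<exists>M. \<forall>m\<ge>M. (\<Sum>i\<in>F. (norm (coord (X n) i - coord (X m) i))\<^sup>2) \<le> e\<^sup>2"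
        by blast
    qed
    then show ?thesis by blast
  qed
  obtain N where N: "\<And>F. finite F \<Longrightarrow> (\<Sum>i\<in>F. (norm (coord (X N) i - l i))\<^sup>2) \<le> 1\<^sup>2"
    using tail[OF zero_less_one] by blast
  have "sq_summable (\<lambda>i. coord (X N) i - l i)"
    using N by (rule sq_summableI)
  from sq_summable_add[OF coord_sq_summable[of "X N"] sq_summable_uminus[OF this]]
  have "sq_summable l" by simp
  define L where "L = Abs_ell2 l"
  have L: "coord L = l"
    unfolding L_def using \<open>sq_summable l\<close> by (simp add: Abs_ell2_inverse)
  have "X \<longlonglongrightarrow> L"
  proof (rule LIMSEQ_I)
    fix e :: real assume "e > 0"
    from tail[OF half_gt_zero[OF this]] obtain N where N: "\<And>n F. n \<ge> N \<Longrightarrow> finite F \<Longrightarrow>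
        (\<Sum>i\<in>F. (norm (coord (X n) i - l i))\<^sup>2) \<le> (e/2)\<^sup>2"
      by blast
    have "norm (X n - L) < e" if "n \<ge> N" for n
    proof -
      have "norm (X n - L) \<le> e/2"
        using N[OF that] \<open>e > 0\<close> by (intro norm_ell2_leI) (auto simp: coord_minus L)
      then show ?thesis using \<open>e > 0\<close> by simp
    qed
    then show "\<exists>N. \<forall>n\<ge>N. norm (X n - L) < e" by blast
  qed
  then show "convergent X" by (auto simp: convergent_def)
qed

end

lemma coord_scaleC: "coord (c *\<^sub>C f) i = c *\<^sub>C coord f i"
  by transfer simp

lemma coord_scaleR: "coord (c *\<^sub>R f) i = c *\<^sub>R coord f i"
  by transfer simp

lemma coord_sum: "coord (sum f A) i = (\<Sum>a\<in>A. coord (f a) i)"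
  by (induction A rule: infinite_finite_induct) (auto simp: coord_add zero_ell2.rep_eq)

lemma ell2_eqI: "(\<And>i. coord f i = coord g i) \<Longrightarrow> f = g"
  using coord_inject by blast

lemma coord_Abs_ell2: "sq_summable f \<Longrightarrow> coord (Abs_ell2 f) = f"
  by (simp add: Abs_ell2_inverse)

lemma has_sum_cinner_ell2: "((\<lambda>i. cinner (coord f i) (coord g i)) has_sum cinner f g) UNIV"
  by transfer (simp add: cinner_summable)

section \<open>Coordinate vectors, coordinate maps and ampliations\<close>

lift_definition single :: "'i \<Rightarrow> 'v::chilbert_space \<Rightarrow> ('i, 'v) ell2" is "\<lambda>i v j. if j = i then v else 0"
proof -
  fix i :: 'i and v :: 'v
  have "(\<Sum>j\<in>F. (norm (if j = i then v else 0))\<^sup>2) \<le> (norm v)\<^sup>2" if "finite F" for F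
    using that by (auto simp: if_distrib[of norm] if_distrib[of "\<lambda>x. x\<^sup>2"] sum.delta cong: if_cong)
  then show "sq_summable (\<lambda>j. if j = i then v else 0)" by (rule sq_summableI)
qed

lemma cinner_single: "cinner f (single i v) = cinner (coord f i) v"
proof -
  have "((\<lambda>j. cinner (coord f j) (coord (single i v) j)) has_sum cinner (coord f i) v) {i}"
    by (rule has_sum_finiteI) (auto simp: single.rep_eq)
  then have "((\<lambda>j. cinner (coord f j) (coord (single i v) j)) has_sum cinner (coord f i) v) UNIV"
    by (rule has_sum_cong_neutral[THEN iffD1, rotated -1]) (auto simp: single.rep_eq cinner.zero_right)
  then show ?thesis using has_sum_cinner_ell2 has_sum_unique by blast
qed

lift_definition proj :: "'i \<Rightarrow> ('i, 'v::chilbert_space) ell2 \<Rightarrow>\<^sub>L 'v" is "\<lambda>i f. coord f i"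
  by (rule bounded_linear_intro[where K = 1]) (auto simp: coord_add coord_scaleR norm_coord_le)

lemma proj_cbounded: "proj i \<in> cbounded"
  by (simp add: cbounded_def proj.rep_eq coord_scaleC)

text \<open>The ampliation \<open>A \<otimes> I\<close>.\<close>

lift_definition amp_fun :: "('a::chilbert_space \<Rightarrow>\<^sub>L 'b::chilbert_space) \<Rightarrow> ('i, 'a) ell2 \<Rightarrow> ('i, 'b) ell2"
  is "\<lambda>A f i. A (f i)"
  by (erule sq_summable_bound, erule onorm)

lemma norm_amp_fun_le:
  assumes "\<And>x. norm (blinfun_apply A x) \<le> K * norm x" "K \<ge> 0"
  shows "norm (amp_fun A f) \<le> K * norm f"
proof (rule norm_ell2_leI)
  fix F :: "'c set" assume "finite F"
  have "(\<Sum>i\<in>F. (norm (coord (amp_fun A f) i))\<^sup>2) \<le> (\<Sum>i\<in>F. K\<^sup>2 * (norm (coord f i))\<^sup>2)"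
    using power_mono[OF assms(1) norm_ge_zero, of _ 2]
    by (intro sum_mono) (simp add: amp_fun.rep_eq power_mult_distrib)
  also have "\<dots> \<le> K\<^sup>2 * (norm f)\<^sup>2"
    unfolding sum_distrib_left[symmetric] by (intro mult_left_mono ell2_finite_sum_le \<open>finite F\<close>) simp
  finally show "(\<Sum>i\<in>F. (norm (coord (amp_fun A f) i))\<^sup>2) \<le> (K * norm f)\<^sup>2"
    by (simp add: power_mult_distrib)
qed (use assms(2) in simp)

lift_definition amp :: "('a::chilbert_space \<Rightarrow>\<^sub>L 'b::chilbert_space) \<Rightarrow> ('i, 'a) ell2 \<Rightarrow>\<^sub>L ('i, 'b) ell2"
  is amp_fun
proof (rule bounded_linear_intro)
  fix A :: "'a \<Rightarrow>\<^sub>L 'b" and f g :: "('i, 'a) ell2" and r :: real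
  show "amp_fun A (f + g) = amp_fun A f + amp_fun A g" "amp_fun A (r *\<^sub>R f) = r *\<^sub>R amp_fun A f"
    by (auto intro!: ell2_eqI simp: amp_fun.rep_eq coord_add coord_scaleR blinfun.add_right blinfun.scaleR_right)
  show "norm (amp_fun A f) \<le> norm f * norm A"
    using norm_amp_fun_le[of A "norm A" f] norm_blinfun[of A] by (simp add: mult.commute)
qed

lemma coord_amp [simp]: "coord (amp A f) i = A (coord f i)"
  by (simp add: amp.rep_eq amp_fun.rep_eq)

lemma norm_amp_le:
  "(\<And>x. norm (blinfun_apply A x) \<le> K * norm x) \<Longrightarrow> K \<ge> 0 \<Longrightarrow> norm (amp A f) \<le> K * norm f"
  by (simp add: amp.rep_eq norm_amp_fun_le)

lemma amp_cbounded: "A \<in> cbounded \<Longrightarrow> amp A \<in> cbounded"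
  by (intro cboundedI ell2_eqI) (simp add: coord_scaleC cbounded_scaleC)

lemma amp_compose: "amp (A o\<^sub>L B) = amp A o\<^sub>L amp B"
  by (intro blinfun_eqI ell2_eqI) simp

lemma amp_id: "amp id_blinfun = id_blinfun"
  by (intro blinfun_eqI ell2_eqI) simp

lemma amp_add: "amp (A + B) = amp A + amp B"
  by (intro blinfun_eqI ell2_eqI) (simp add: blinfun.add_left coord_add)

lemma amp_scale_op: "amp (scale_op c A) = scale_op c (amp A)"
  by (intro blinfun_eqI ell2_eqI) (simp add: scale_op.rep_eq coord_scaleC)

lemma proj_amp: "proj i o\<^sub>L amp A = A o\<^sub>L proj i"
  by (rule blinfun_eqI) (simp add: proj.rep_eq)

lemma word_op_amp: "word_op (\<lambda>k. amp (T k)) w = amp (word_op T w)"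
  by (induction w) (auto simp: amp_id amp_compose)

lemma amp_adjoint:
  assumes "\<And>x y. cinner (blinfun_apply A x) y = cinner x (blinfun_apply B y)"
  shows "cinner (amp A f) g = cinner f (amp B g)"
  using has_sum_cinner_ell2[of "amp A f" g] has_sum_cinner_ell2[of f "amp B g"]
  by (simp add: assms has_sum_unique)

section \<open>Words and multi-indices\<close>

definition word_content :: "'d list \<Rightarrow> 'd \<Rightarrow> nat" where
  "word_content w = count (mset w)"

definition incr :: "'d \<Rightarrow> ('d \<Rightarrow> nat) \<Rightarrow> 'd \<Rightarrow> nat" where
  "incr k \<alpha> = \<alpha>(k := Suc (\<alpha> k))"

lemma content_Nil [simp]: "word_content [] = (\<lambda>_. 0)"
  by (simp add: word_content_def fun_eq_iff)

lemma content_Cons [simp]: "word_content (k # w) = incr k (word_content w)"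
  by (auto simp: word_content_def incr_def fun_eq_iff)

lemma content_append_single: "word_content (w @ [k]) = incr k (word_content w)"
  by (auto simp: word_content_def incr_def fun_eq_iff)

lemma incr_dec: "\<alpha> k \<noteq> 0 \<Longrightarrow> incr k (\<alpha>(k := \<alpha> k - 1)) = \<alpha>"
  by (auto simp: incr_def fun_eq_iff)

lemma dec_incr: "(incr k \<alpha>)(k := incr k \<alpha> k - 1) = \<alpha>"
  by (auto simp: incr_def fun_eq_iff)

lemma inj_incr: "inj (incr k)"
  by (rule inj_on_inverseI[where g = "\<lambda>\<alpha>. \<alpha>(k := \<alpha> k - 1)"]) (rule dec_incr)

lemma incr_nonzero: "incr k \<alpha> k \<noteq> 0"
  by (simp add: incr_def)

lemma range_incr: "range (incr k) = {\<alpha>. \<alpha> k \<noteq> 0}"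
proof -
  have "\<alpha> \<in> range (incr k)" if "\<alpha> k \<noteq> 0" for \<alpha>
    by (metis incr_dec rangeI that)
  then show ?thesis by (auto simp: incr_def)
qed

text \<open>Permutations of a multiset are counted by the multinomial coefficient
  |\<alpha>|!/\<alpha>!, the reciprocal of the norm weight. Every later comparison of sums over
  words with sums over multi-indices rests on this.\<close>

lemma content_fibre:
  fixes \<alpha> :: "'d::finite \<Rightarrow> nat"
  shows "finite {w. word_content w = \<alpha>}" and "real (card {w. word_content w = \<alpha>}) = 1 / da_weight \<alpha>"
proof -
  define M where "M = Abs_multiset \<alpha>"
  have M: "count M = \<alpha>" by (simp add: M_def count_Abs_multiset)
  have fib: "{w. word_content w = \<alpha>} = permutations_of_multiset M"
    by (auto simp: word_content_def permutations_of_multiset_def M[symmetric] multiset_eq_iff fun_eq_iff)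
  then show "finite {w. word_content w = \<alpha>}" by simp
  have "size M = (\<Sum>i\<in>UNIV. \<alpha> i)"
    unfolding size_multiset_overloaded_eq M
    by (rule sum.mono_neutral_left) (auto simp flip: M simp: not_in_iff)
  moreover have "(\<Prod>x\<in>set_mset M. fact (count M x)) = (\<Prod>i\<in>UNIV. fact (\<alpha> i) :: nat)"
    unfolding M by (rule prod.mono_neutral_left) (auto simp flip: M simp: not_in_iff)
  ultimately have "card (permutations_of_multiset M) * (\<Prod>i\<in>UNIV. fact (\<alpha> i)) = fact (\<Sum>i\<in>UNIV. \<alpha> i)"
    using card_permutations_of_multiset_aux[of M] by simp
  from arg_cong[OF this, of real]
  have "real (card (permutations_of_multiset M)) * (\<Prod>i\<in>UNIV. fact (\<alpha> i)) = fact (\<Sum>i\<in>UNIV. \<alpha> i)"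
    by simp
  then show "real (card {w. word_content w = \<alpha>}) = 1 / da_weight \<alpha>"
    by (simp add: fib da_weight_def field_simps)
qed

lemma content_fibre_nonempty: "\<exists>w. word_content w = (\<alpha> :: 'd::finite \<Rightarrow> nat)"
proof (rule ccontr)
  assume "\<nexists>w. word_content w = \<alpha>"
  then have "{w. word_content w = \<alpha>} = {}" by auto
  then have "1 / da_weight \<alpha> = 0" using content_fibre(2)[of \<alpha>] by simp
  then show False using da_weight_pos[of \<alpha>] by simp
qed

definition word_of :: "('d::finite \<Rightarrow> nat) \<Rightarrow> 'd list" where
  "word_of \<alpha> = (SOME w. word_content w = \<alpha>)"

lemma content_word_of [simp]: "word_content (word_of \<alpha>) = \<alpha>"
  unfolding word_of_def by (rule someI_ex) (rule content_fibre_nonempty)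

lemma sum_content_fibre:
  "(\<Sum>w | word_content w = \<alpha>. G (word_content w)) = G \<alpha> / complex_of_real (da_weight \<alpha>)"
proof -
  have "(\<Sum>w | word_content w = \<alpha>. G (word_content w)) = (\<Sum>w | word_content w = \<alpha>. G \<alpha>)"
    by (rule sum.cong) auto
  also have "\<dots> = of_real (real (card {w. word_content w = \<alpha>})) * G \<alpha>"
    by simp
  finally show ?thesis
    by (simp only: content_fibre(2)) simp
qed

lemma sum_content_fibre_real:
  "(\<Sum>w | word_content w = \<alpha>. G (word_content w)) = G \<alpha> / da_weight \<alpha>"
proof -
  have "(\<Sum>w | word_content w = \<alpha>. G (word_content w)) = (\<Sum>w | word_content w = \<alpha>. G \<alpha>)"
    by (rule sum.cong) auto
  then show ?thesis by (simp add: content_fibre(2))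
qed

lemma sum_words_content:
  "finite A \<Longrightarrow> (\<Sum>\<alpha>\<in>A. \<Sum>w | word_content w = \<alpha>. G w) = (\<Sum>w | word_content w \<in> A. G w)"
  "finite A \<Longrightarrow> finite {w. word_content w \<in> (A :: ('d::finite \<Rightarrow> nat) set)}"
proof -
  assume A: "finite A"
  have eq: "{w. word_content w \<in> A} = (\<Union>\<alpha>\<in>A. {w. word_content w = \<alpha>})" by auto
  show "(\<Sum>\<alpha>\<in>A. \<Sum>w | word_content w = \<alpha>. G w) = (\<Sum>w | word_content w \<in> A. G w)"
    unfolding eq using A content_fibre(1) by (intro sum.UNION_disjoint[symmetric]) auto
  show "finite {w. word_content w \<in> A}"
    unfolding eq using A content_fibre(1) by blast
qed

lemma finite_words: "finite {w :: 'd::finite list. length w = n}"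
  using finite_lists_length_eq[OF finite[of UNIV], of n] by simp

lemma sum_words_Suc:
  "(\<Sum>w | length w = Suc n. G w) = (\<Sum>k\<in>(UNIV::'d::finite set). \<Sum>w | length w = n. G (k # w))"
proof -
  have "{w :: 'd list. length w = Suc n} = (\<lambda>(k, w). k # w) ` (UNIV \<times> {w. length w = n})"
    by (auto simp: length_Suc_conv image_iff)
  then have "(\<Sum>w | length w = Suc n. G w) = (\<Sum>(k, w)\<in>UNIV \<times> {w. length w = n}. G (k # w))"
    by (simp add: sum.reindex inj_on_def case_prod_unfold)
  then show ?thesis
    by (simp add: sum.cartesian_product)
qed

section \<open>The Drury--Arveson space\<close>

lemma coeff_add: "coeff_da (f + g) \<alpha> = coeff_da f \<alpha> + coeff_da g \<alpha>"
  by transfer simp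

lemma coeff_scaleC: "coeff_da (c *\<^sub>C f) \<alpha> = c * coeff_da f \<alpha>"
  by transfer simp

lemma coeff_scaleR: "coeff_da (r *\<^sub>R f) \<alpha> = of_real r * coeff_da f \<alpha>"
  by transfer simp

lemma da_eqI: "(\<And>\<alpha>. coeff_da f \<alpha> = coeff_da g \<alpha>) \<Longrightarrow> f = g"
  using coeff_da_inject by blast

lemma coeff_Abs: "da_summable c \<Longrightarrow> coeff_da (Abs_drury_arveson c) = c"
  by (simp add: Abs_drury_arveson_inverse)

lemma da_summableI:
  assumes "\<And>A. finite A \<Longrightarrow> (\<Sum>\<alpha>\<in>A. da_weight \<alpha> * (cmod (c \<alpha>))\<^sup>2) \<le> B" shows "da_summable c"
  unfolding da_summable_def using assms
  by (intro nonneg_bdd_above_summable_on) (auto simp: bdd_above_def less_imp_le da_weight_pos)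

lemma norm_da_sq: "((\<lambda>\<alpha>. da_weight \<alpha> * (cmod (coeff_da f \<alpha>))\<^sup>2) has_sum (norm f)\<^sup>2) UNIV"
proof -
  have "(norm f)\<^sup>2 = (\<Sum>\<^sub>\<infinity>\<alpha>. da_weight \<alpha> * (cmod (coeff_da f \<alpha>))\<^sup>2)"
    by (simp add: norm_drury_arveson.rep_eq infsum_nonneg da_weight_pos less_imp_le)
  then show ?thesis
    using coeff_da[of f] by (simp add: da_summable_def)
qed

lemma norm_da_leI:
  assumes "\<And>A. finite A \<Longrightarrow> (\<Sum>\<alpha>\<in>A. da_weight \<alpha> * (cmod (coeff_da f \<alpha>))\<^sup>2) \<le> B\<^sup>2" "B \<ge> 0"
  shows "norm f \<le> B"
proof -
  have "(norm f)\<^sup>2 \<le> B\<^sup>2"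
    using norm_da_sq by (rule has_sum_le_finite_sums) (rule assms(1))
  then show ?thesis using assms(2) by (rule power2_le_imp_le)
qed

lemma cinner_da:
  "((\<lambda>\<alpha>. complex_of_real (da_weight \<alpha>) * coeff_da f \<alpha> * cnj (coeff_da g \<alpha>)) has_sum cinner f g) UNIV"
  using da_abs_summable_prod[of "coeff_da f" "coeff_da g"] coeff_da[of f] coeff_da[of g]
  by (simp add: cinner_drury_arveson.rep_eq da_cinner_def)

lift_definition da_mono :: "('d::finite \<Rightarrow> nat) \<Rightarrow> 'd drury_arveson" is "\<lambda>\<alpha> \<beta>. if \<beta> = \<alpha> then 1 else 0"
proof -
  fix \<alpha> :: "'d \<Rightarrow> nat"
  have "(\<Sum>\<beta>\<in>A. da_weight \<beta> * (cmod (if \<beta> = \<alpha> then 1 else 0))\<^sup>2) \<le> da_weight \<alpha>" if "finite A" for A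
    using that da_weight_pos[of \<alpha>]
    by (simp add: if_distrib[of cmod] if_distrib[of "\<lambda>x. x\<^sup>2"] if_distrib[of "\<lambda>x. _ * x"]
        sum.delta' less_imp_le cong: if_cong)
  then show "da_summable (\<lambda>\<beta>. if \<beta> = \<alpha> then 1 else 0)" by (rule da_summableI)
qed

abbreviation da_one :: "'d::finite drury_arveson" where
  "da_one \<equiv> da_mono (\<lambda>_. 0)"

lemma cinner_mono: "cinner f (da_mono \<alpha>) = of_real (da_weight \<alpha>) * coeff_da f \<alpha>"
proof -
  let ?h = "\<lambda>\<beta>. complex_of_real (da_weight \<beta>) * coeff_da f \<beta> * cnj (coeff_da (da_mono \<alpha>) \<beta>)"
  have "(?h has_sum of_real (da_weight \<alpha>) * coeff_da f \<alpha>) {\<alpha>}"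
    by (rule has_sum_finiteI) (auto simp: da_mono.rep_eq)
  then have "(?h has_sum of_real (da_weight \<alpha>) * coeff_da f \<alpha>) UNIV"
    by (rule has_sum_cong_neutral[THEN iffD1, rotated -1]) (auto simp: da_mono.rep_eq)
  then show ?thesis using cinner_da has_sum_unique by blast
qed

subsection \<open>The shift\<close>

text \<open>The quotient of the two weights is (\<alpha>_k + 1) / (|\<alpha>| + 1). This makes
  multiplication by a coordinate a contraction.\<close>

lemma da_weight_incr_le: "da_weight (incr k \<alpha>) \<le> da_weight \<alpha>"
proof -
  have p: "(\<Prod>i\<in>UNIV. fact (incr k \<alpha> i)) = real (Suc (\<alpha> k)) * (\<Prod>i\<in>UNIV. fact (\<alpha> i))"
    by (simp add: prod.remove[of UNIV k] incr_def)
  have s: "(\<Sum>i\<in>UNIV. incr k \<alpha> i) = Suc (\<Sum>i\<in>UNIV. \<alpha> i)"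
    by (simp add: sum.remove[of UNIV k] incr_def)
  have "\<alpha> k \<le> (\<Sum>i\<in>UNIV. \<alpha> i)" by (rule member_le_sum) auto
  then have "real (Suc (\<alpha> k)) / real (Suc (\<Sum>i\<in>UNIV. \<alpha> i)) \<le> 1"
    by (intro divide_le_eq_1_pos[THEN iffD2])
       (simp_all only: of_nat_le_iff Suc_le_mono of_nat_0_less_iff zero_less_Suc)
  moreover have "da_weight (incr k \<alpha>) = real (Suc (\<alpha> k)) / real (Suc (\<Sum>i\<in>UNIV. \<alpha> i)) * da_weight \<alpha>"
    unfolding da_weight_def p s by simp
  ultimately show ?thesis
    using mult_right_mono[of "real (Suc (\<alpha> k)) / real (Suc (\<Sum>i\<in>UNIV. \<alpha> i))" 1 "da_weight \<alpha>"]
    by (simp only: mult_1 less_imp_le[OF da_weight_pos])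
qed

lemma shift_sum_le:
  assumes "finite A"
  shows "(\<Sum>\<alpha>\<in>A. da_weight \<alpha> * (cmod (if \<alpha> k = 0 then 0 else coeff_da f (\<alpha>(k := \<alpha> k - 1))))\<^sup>2)
    \<le> (norm (f :: 'd::finite drury_arveson))\<^sup>2"
proof -
  let ?d = "\<lambda>\<alpha>. \<alpha>(k := \<alpha> k - 1)"
  let ?A = "{\<alpha>\<in>A. \<alpha> k \<noteq> 0}"
  have "(\<Sum>\<alpha>\<in>A. da_weight \<alpha> * (cmod (if \<alpha> k = 0 then 0 else coeff_da f (?d \<alpha>)))\<^sup>2)
      = (\<Sum>\<alpha>\<in>?A. da_weight \<alpha> * (cmod (coeff_da f (?d \<alpha>)))\<^sup>2)"
    using assms by (intro sum.mono_neutral_cong_right) auto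
  also have "\<dots> \<le> (\<Sum>\<alpha>\<in>?A. da_weight (?d \<alpha>) * (cmod (coeff_da f (?d \<alpha>)))\<^sup>2)"
  proof (intro sum_mono mult_right_mono)
    show "da_weight \<alpha> \<le> da_weight (?d \<alpha>)" if "\<alpha> \<in> ?A" for \<alpha>
      using da_weight_incr_le[of k "?d \<alpha>"] incr_dec[of \<alpha> k] that by auto
  qed simp
  also have "\<dots> = (\<Sum>\<beta>\<in>?d ` ?A. da_weight \<beta> * (cmod (coeff_da f \<beta>))\<^sup>2)"
  proof (subst sum.reindex)
    show "inj_on ?d ?A"
      by (rule inj_on_inverseI[where g = "incr k"]) (use incr_dec in auto)
  qed simp
  also have "\<dots> \<le> (norm f)\<^sup>2"
    using assms by (intro da_sum_le_norm) simp
  finally show ?thesis .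
qed

lift_definition shift_fun :: "'d \<Rightarrow> 'd::finite drury_arveson \<Rightarrow> 'd drury_arveson"
  is "\<lambda>k c \<alpha>. if \<alpha> k = 0 then 0 else c (\<alpha>(k := \<alpha> k - 1))"
proof -
  fix k :: 'd and c :: "('d \<Rightarrow> nat) \<Rightarrow> complex" assume c: "da_summable c"
  show "da_summable (\<lambda>\<alpha>. if \<alpha> k = 0 then 0 else c (\<alpha>(k := \<alpha> k - 1)))"
    by (rule da_summableI, rule shift_sum_le[of _ k "Abs_drury_arveson c", unfolded coeff_Abs[OF c]])
qed

lemma norm_shift_fun_le: "norm (shift_fun k f) \<le> norm f"
  by (rule norm_da_leI) (simp_all only: shift_fun.rep_eq shift_sum_le norm_ge_zero)

lift_definition shift_op :: "'d \<Rightarrow> 'd::finite drury_arveson \<Rightarrow>\<^sub>L 'd drury_arveson" is shift_fun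
proof (rule bounded_linear_intro[where K = 1])
  fix k :: 'd and f g :: "'d drury_arveson" and r :: real
  show "shift_fun k (f + g) = shift_fun k f + shift_fun k g" "shift_fun k (r *\<^sub>R f) = r *\<^sub>R shift_fun k f"
    by (auto intro!: da_eqI simp: shift_fun.rep_eq coeff_add coeff_scaleR)
  show "norm (shift_fun k f) \<le> norm f * 1"
    by (simp add: norm_shift_fun_le)
qed

lemma coeff_shift_op:
  "coeff_da (shift_op k f) \<alpha> = (if \<alpha> k = 0 then 0 else coeff_da f (\<alpha>(k := \<alpha> k - 1)))"
  by (simp add: shift_op.rep_eq shift_fun.rep_eq)

lemma coeff_shift_op_incr [simp]: "coeff_da (shift_op k f) (incr k \<alpha>) = coeff_da f \<alpha>"
  by (simp only: coeff_shift_op dec_incr incr_nonzero if_False)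

lemma shift_op_cbounded: "shift_op k \<in> cbounded"
  by (intro cboundedI da_eqI) (simp add: coeff_shift_op coeff_scaleC)

lemma shift_op_mono: "shift_op k (da_mono \<alpha>) = da_mono (incr k \<alpha>)"
proof (rule da_eqI)
  fix \<beta> show "coeff_da (shift_op k (da_mono \<alpha>)) \<beta> = coeff_da (da_mono (incr k \<alpha>)) \<beta>"
  proof (cases "\<beta> k = 0")
    case False
    then show ?thesis
      using incr_dec[of \<beta> k] dec_incr[of k \<alpha>] by (auto simp: coeff_shift_op da_mono.rep_eq)
  qed (auto simp: coeff_shift_op da_mono.rep_eq incr_def)
qed

lemma word_shift_one: "word_op shift_op w da_one = da_mono (word_content w)"
  by (induction w) (auto simp: shift_op_mono)

lemma shift_op_commute: "shift_op i o\<^sub>L shift_op j = shift_op j o\<^sub>L shift_op i"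
proof (cases "i = j")
  case False
  then show ?thesis
    by (intro blinfun_eqI da_eqI) (simp add: coeff_shift_op fun_upd_twist)
qed simp

lemma cyclic_one: "cyclic_space shift_op da_one = UNIV"
proof -
  have "f \<in> cyclic_space shift_op da_one" for f :: "'d::finite drury_arveson"
    unfolding cyclic_space_def
  proof (rule in_cclosed_spanI)
    fix g :: "'d drury_arveson" assume g: "\<And>s. s \<in> range (\<lambda>w. word_op shift_op w da_one) \<Longrightarrow> cinner g s = 0"
    have "coeff_da g \<alpha> = 0" for \<alpha>
    proof -
      have "cinner g (word_op shift_op (word_of \<alpha>) da_one) = 0" by (rule g) blast
      then show ?thesis
        using da_weight_pos[of \<alpha>] by (simp add: word_shift_one cinner_mono)
    qed
    then have "g = 0" by (intro da_eqI) (simp add: zero_drury_arveson.rep_eq)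
    then show "cinner g f = 0" by (simp add: cinner.zero_left)
  qed
  then show ?thesis by blast
qed

subsection \<open>Point evaluations\<close>

definition zpow :: "complex ^ 'd \<Rightarrow> ('d::finite \<Rightarrow> nat) \<Rightarrow> complex" where
  "zpow z \<alpha> = (\<Prod>i\<in>UNIV. (z $ i) ^ \<alpha> i)"

lemma zpow_0 [simp]: "zpow z (\<lambda>_. 0) = 1"
  by (simp add: zpow_def)

lemma zpow_incr: "zpow z (incr k \<alpha>) = z $ k * zpow z \<alpha>"
  by (simp add: zpow_def prod.remove[of UNIV k] incr_def mult_ac)

text \<open>The squared moduli multiply along words, so the sum over words of length n is the n-th
  power of the sum over letters, which is ||z||^2.\<close>

lemma sum_zpow_words:
  "(\<Sum>w | length w = n. (cmod (zpow z (word_content w)))\<^sup>2) = (norm (z :: complex ^ 'd::finite)) ^ (2 * n)"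
proof (induction n)
  case (Suc n)
  have "(\<Sum>w | length w = Suc n. (cmod (zpow z (word_content w)))\<^sup>2)
      = (\<Sum>k\<in>UNIV. (cmod (z $ k))\<^sup>2) * (\<Sum>w | length w = n. (cmod (zpow z (word_content w)))\<^sup>2)"
    by (simp add: sum_words_Suc zpow_incr norm_mult power_mult_distrib sum_product)
  also have "(\<Sum>k\<in>UNIV. (cmod (z $ k))\<^sup>2) = (norm z)\<^sup>2"
    by (simp add: norm_vec_def L2_set_def sum_nonneg)
  finally show ?case
    by (simp only: Suc.IH flip: power_add) simp
qed simp

lemma kernel_summable:
  assumes "norm (z :: complex ^ 'd::finite) < 1"
  shows "da_summable (\<lambda>\<alpha>. cnj (zpow z \<alpha>) / of_real (da_weight \<alpha>))"
proof (rule da_summableI)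
  fix A :: "('d \<Rightarrow> nat) set" assume "finite A"
  let ?g = "\<lambda>w. (cmod (zpow z (word_content w)))\<^sup>2"
  let ?W = "{w. word_content w \<in> A}"
  have fin: "finite ?W" using \<open>finite A\<close> by (rule sum_words_content)
  define N where "N = Suc (Max (insert 0 (length ` ?W)))"
  have N: "length w < N" if "w \<in> ?W" for w
    using that fin by (simp add: N_def less_Suc_eq_le)
  have "(\<Sum>\<alpha>\<in>A. da_weight \<alpha> * (cmod (cnj (zpow z \<alpha>) / of_real (da_weight \<alpha>)))\<^sup>2)
      = (\<Sum>\<alpha>\<in>A. (cmod (zpow z \<alpha>))\<^sup>2 / da_weight \<alpha>)"
    using da_weight_pos by (intro sum.cong refl) (simp add: norm_divide power_divide power2_eq_square)
  \<comment> \<open>Dividing by the weight counts words, so this becomes a sum over words; sorted by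
    length it is dominated by a geometric series in ||z||^2.\<close>
  also have "\<dots> = (\<Sum>\<alpha>\<in>A. \<Sum>w | word_content w = \<alpha>. ?g w)"
    by (simp only: sum_content_fibre_real[where G = "\<lambda>\<alpha>. (cmod (zpow z \<alpha>))\<^sup>2"])
  also have "\<dots> = (\<Sum>w\<in>?W. ?g w)"
    using \<open>finite A\<close> by (rule sum_words_content)
  also have "\<dots> \<le> (\<Sum>w\<in>(\<Union>n<N. {w. length w = n}). ?g w)"
    using N by (intro sum_mono2) (auto intro!: finite_words)
  also have "\<dots> = (\<Sum>n<N. norm z ^ (2 * n))"
    by (subst sum.UNION_disjoint) (auto simp: finite_words sum_zpow_words)
  also have "\<dots> = (\<Sum>n<N. ((norm z)\<^sup>2) ^ n)"
    by (simp add: power_mult)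
  also have "\<dots> \<le> (\<Sum>n. ((norm z)\<^sup>2) ^ n)"
    using assms by (intro sum_le_suminf summable_geometric) (auto simp: abs_square_less_1)
  finally show "(\<Sum>\<alpha>\<in>A. da_weight \<alpha> * (cmod (cnj (zpow z \<alpha>) / of_real (da_weight \<alpha>)))\<^sup>2)
      \<le> (\<Sum>n. ((norm z)\<^sup>2) ^ n)" .
qed

text \<open>Taylor coefficients of w -> 1 / (1 - <w, z>), the reproducing kernel at
  \<open>z\<close>.\<close>

definition da_kernel :: "complex ^ 'd \<Rightarrow> 'd::finite drury_arveson" where
  "da_kernel z = Abs_drury_arveson (\<lambda>\<alpha>. cnj (zpow z \<alpha>) / of_real (da_weight \<alpha>))"

lemma has_sum_da_fun:
  assumes "norm z < 1"
  shows "((\<lambda>\<alpha>. coeff_da f \<alpha> * zpow z \<alpha>) has_sum cinner f (da_kernel z)) UNIV"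
proof -
  have "(\<lambda>\<alpha>. complex_of_real (da_weight \<alpha>) * coeff_da f \<alpha> * cnj (coeff_da (da_kernel z) \<alpha>))
      = (\<lambda>\<alpha>. coeff_da f \<alpha> * zpow z \<alpha>)"
  proof
    fix \<alpha> show "complex_of_real (da_weight \<alpha>) * coeff_da f \<alpha> * cnj (coeff_da (da_kernel z) \<alpha>)
        = coeff_da f \<alpha> * zpow z \<alpha>"
      using da_weight_pos[of \<alpha>] kernel_summable[OF assms] by (simp add: da_kernel_def coeff_Abs)
  qed
  then show ?thesis using cinner_da[of f "da_kernel z"] by simp
qed

lemma da_fun_kernel: "norm z < 1 \<Longrightarrow> da_fun f z = cinner f (da_kernel z)"
  using has_sum_da_fun[of z f] by (simp add: da_fun_def zpow_def infsumI)

lemma da_fun_shift_op: "da_fun (shift_op k f) z = z $ k * da_fun f z"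
proof -
  have "da_fun (shift_op k f) z = (\<Sum>\<^sub>\<infinity>\<alpha>\<in>range (incr k). coeff_da (shift_op k f) \<alpha> * zpow z \<alpha>)"
    unfolding da_fun_def zpow_def
    by (rule infsum_cong_neutral) (auto simp: range_incr coeff_shift_op)
  also have "\<dots> = (\<Sum>\<^sub>\<infinity>\<alpha>. z $ k * (coeff_da f \<alpha> * zpow z \<alpha>))"
    by (subst infsum_reindex) (auto simp: inj_incr zpow_incr o_def mult_ac intro!: infsum_cong)
  finally show ?thesis
    by (simp add: infsum_cmult_right' da_fun_def zpow_def)
qed

section \<open>The identity theorem on the ball\<close>

lemma has_sum_fibres:
  fixes f :: "'a \<Rightarrow> 'b::banach"
  assumes "(f has_sum S) X"
  shows "((\<lambda>a. infsum f {x\<in>X. p x = a}) has_sum S) UNIV"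
proof (rule has_sum_SigmaD[where f = "f \<circ> snd" and B = "\<lambda>a. {x\<in>X. p x = a}"])
  have "(\<lambda>x. (p x, x)) ` X = Sigma UNIV (\<lambda>a. {x\<in>X. p x = a})" by auto
  moreover have "(f \<circ> snd has_sum S) ((\<lambda>x. (p x, x)) ` X)"
    using assms by (subst has_sum_reindex) (auto simp: inj_on_def o_def)
  ultimately show "(f \<circ> snd has_sum S) (Sigma UNIV (\<lambda>a. {x\<in>X. p x = a}))" by simp
  show "((\<lambda>y. (f \<circ> snd) (a, y)) has_sum infsum f {x\<in>X. p x = a}) {x\<in>X. p x = a}" for a
    using summable_on_subset_banach[OF has_sum_imp_summable[OF assms], of "{x\<in>X. p x = a}"] by auto
qed

lemma powser_identity:
  fixes a :: "nat \<Rightarrow> complex"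
  assumes "\<And>t. cmod t < 1 \<Longrightarrow> (\<lambda>n. a n * t ^ n) sums 0"
  shows "a n = 0"
proof (cases "n = 0")
  case True
  then show ?thesis using assms[of 0] by simp
next
  case False
  show ?thesis
  proof (rule ccontr)
    assume "a n \<noteq> 0"
    have "(\<lambda>n. a n * (x - 0) ^ n) sums 0" if "norm (x - 0) < 1" for x
      using assms that by simp
    from powser_0_nonzero[OF zero_less_one this refl \<open>a n \<noteq> 0\<close>] False
    obtain s :: real where "0 < s" "\<And>z. z \<in> cball 0 s - {0 :: complex} \<Longrightarrow> (0 :: complex) \<noteq> 0"
      by blast
    from this(2)[of "of_real s"] this(1) show False by simp
  qed
qed

text \<open>The coefficients are isolated by varying one variable at a time.\<close>

lemma da_fun_eq_0_imp:
  fixes f :: "'d::finite drury_arveson"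
  assumes "\<And>z. norm z < 1 \<Longrightarrow> da_fun f z = 0"
  shows "f = 0"
proof -
  have "((\<lambda>\<alpha>. coeff_da f \<alpha> * zpow z \<alpha>) has_sum 0) {\<alpha>. \<forall>i\<in>A. \<alpha> i = a i}"
    if "norm z < 1" for A a z
    using finite[of A] that
  proof (induction A arbitrary: a z rule: finite_induct)
    case empty
    then show ?case using has_sum_da_fun[of z f] assms by (simp add: da_fun_kernel)
  next
    case (insert k A)
    \<comment> \<open>Rescaling the k-th coordinate by t turns the vanishing series into a power
      series in t whose n-th coefficient, \<open>h n\<close> below, collects the multi-indices with
      entry n at k.\<close>
    define Z where "Z t = (\<chi> i. if i = k then t * z $ i else z $ i)" for t :: complex
    define X where "X = {\<alpha>. \<forall>i\<in>A. \<alpha> i = a i}"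
    have Xn: "{\<alpha>\<in>X. \<alpha> k = n} = {\<alpha>. \<forall>i\<in>insert k A. \<alpha> i = (a(k := n)) i}" for n
      using insert.hyps by (auto simp: X_def)
    define h where "h n = infsum (\<lambda>\<alpha>. coeff_da f \<alpha> * zpow z \<alpha>) {\<alpha>\<in>X. \<alpha> k = n}" for n
    have zpow_Z: "zpow (Z t) \<alpha> = t ^ \<alpha> k * zpow z \<alpha>" for t \<alpha>
      by (simp add: zpow_def Z_def prod.remove[of UNIV k] power_mult_distrib mult_ac)
    have "(\<lambda>n. h n * t ^ n) sums 0" if "cmod t < 1" for t
    proof -
      have "cmod (t * z $ k) \<le> cmod (z $ k)"
        using that mult_left_le_one_le[of "cmod (z $ k)" "cmod t"] by (simp add: norm_mult)
      then have "norm (Z t) \<le> norm z"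
        by (intro norm_le_componentwise_cart) (auto simp: Z_def)
      then have "((\<lambda>\<alpha>. coeff_da f \<alpha> * zpow (Z t) \<alpha>) has_sum 0) X"
        using insert.IH[of "Z t" a] insert.prems by (simp add: X_def)
      from has_sum_fibres[OF this, of "\<lambda>\<alpha>. \<alpha> k"]
      have "((\<lambda>n. infsum (\<lambda>\<alpha>. coeff_da f \<alpha> * zpow (Z t) \<alpha>) {\<alpha>\<in>X. \<alpha> k = n}) has_sum 0) UNIV" .
      moreover have "infsum (\<lambda>\<alpha>. coeff_da f \<alpha> * zpow (Z t) \<alpha>) {\<alpha>\<in>X. \<alpha> k = n} = h n * t ^ n" for n
      proof -
        have "infsum (\<lambda>\<alpha>. coeff_da f \<alpha> * zpow (Z t) \<alpha>) {\<alpha>\<in>X. \<alpha> k = n}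
            = infsum (\<lambda>\<alpha>. coeff_da f \<alpha> * zpow z \<alpha> * t ^ n) {\<alpha>\<in>X. \<alpha> k = n}"
          by (rule infsum_cong) (auto simp: zpow_Z)
        then show ?thesis by (simp add: infsum_cmult_left' h_def)
      qed
      ultimately show ?thesis by (simp add: has_sum_imp_sums)
    qed
    then have h0: "h (a k) = 0" by (rule powser_identity)
    have summ: "(\<lambda>\<alpha>. coeff_da f \<alpha> * zpow z \<alpha>) summable_on {\<alpha>\<in>X. \<alpha> k = a k}"
      by (rule summable_on_subset_banach[OF has_sum_imp_summable[OF has_sum_da_fun[OF insert.prems, of f]]]) simp
    have "{\<alpha>. \<forall>i\<in>insert k A. \<alpha> i = a i} = {\<alpha>\<in>X. \<alpha> k = a k}"
      unfolding Xn by simp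
    then show ?case
      using has_sum_infsum[OF summ] h0 by (simp only: h_def)
  qed
  note main = this
  have "coeff_da f a = 0" for a
  proof -
    \<comment> \<open>Small enough to keep the point in the ball, as the moduli of its coordinates
      add up to 1/2, and nonzero so that the monomial can be cancelled.\<close>
    define r where "r = 1 / (2 * real CARD('d))"
    define z :: "complex ^ 'd" where "z = (\<chi> i. of_real r)"
    have "r > 0" by (simp add: r_def)
    have "norm z \<le> (\<Sum>i\<in>(UNIV :: 'd set). norm (z $ i))" unfolding norm_vec_def by (rule L2_set_le_sum) simp
    also have "\<dots> = 1/2" by (simp add: z_def r_def norm_divide)
    finally have "norm z < 1" by simp
    from main[OF this, of UNIV a] have "((\<lambda>\<alpha>. coeff_da f \<alpha> * zpow z \<alpha>) has_sum 0) {\<alpha>. \<forall>i\<in>UNIV. \<alpha> i = a i}" .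
    moreover have "{\<alpha>. \<forall>i\<in>UNIV. \<alpha> i = a i} = {a}" by auto
    ultimately have "((\<lambda>\<alpha>. coeff_da f \<alpha> * zpow z \<alpha>) has_sum 0) {a}" by simp
    from has_sum_unique[OF this has_sum_finite] have "coeff_da f a * zpow z a = 0" by simp
    moreover have "zpow z a \<noteq> 0" using \<open>r > 0\<close> by (simp add: zpow_def z_def)
    ultimately show ?thesis by simp
  qed
  then show ?thesis by (intro da_eqI) (simp add: zero_drury_arveson.rep_eq)
qed

lemma da_fun_inject:
  assumes "\<And>z. norm z < 1 \<Longrightarrow> da_fun f z = da_fun g z"
  shows "f = g"
  using da_fun_eq_0_imp[of "f - g"] assms by (simp add: da_fun_kernel cinner.diff_left)

lemma shift_eq: "shift k = shift_op k"
  unfolding shift_def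
proof (rule the_equality)
  show "is_mult_op (\<lambda>z. z $ k) (shift_op k)"
    by (simp add: is_mult_op_def da_fun_shift_op)
  fix M assume "is_mult_op (\<lambda>z. z $ k) M"
  then show "M = shift_op k"
    by (intro blinfun_eqI da_fun_inject) (simp add: is_mult_op_def da_fun_shift_op)
qed

subsection \<open>Multipliers are the commutant of the shift\<close>

lemma multiplier_cbounded:
  assumes "A \<in> multiplier_algebra" shows "A \<in> cbounded"
  using assms unfolding multiplier_algebra_def is_mult_op_def
  by (intro cboundedI da_fun_inject) (auto simp: da_fun_kernel cinner_scaleC_left)

lemma multiplier_commute_shift:
  assumes "A \<in> multiplier_algebra" shows "A o\<^sub>L shift_op k = shift_op k o\<^sub>L A"
  using assms unfolding multiplier_algebra_def is_mult_op_def
  by (intro blinfun_eqI da_fun_inject) (auto simp: da_fun_shift_op)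

text \<open>The symbol can only be the image of 1. The multiplier identity holds at 1, passes from f
  to its shifts, and is linear and closed in f, so cyclicity of 1 spreads it over H^2.\<close>

lemma commute_shift_imp_is_mult_op:
  assumes "A \<in> cbounded" "\<And>k. A o\<^sub>L shift_op k = shift_op k o\<^sub>L A"
  shows "is_mult_op (da_fun (A da_one)) A"
  unfolding is_mult_op_def
proof (intro allI ballI)
  fix f z assume z: "z \<in> ball (0 :: complex ^ 'a) 1"
  define M where "M = {f. da_fun (A f) z = da_fun (A da_one) z * da_fun f z}"
  have M: "M = {f. cinner (A f) (da_kernel z) = cinner (A da_one) (da_kernel z) * cinner f (da_kernel z)}"
    using z by (simp add: M_def da_fun_kernel)
  have "cyclic_space shift_op da_one \<subseteq> M"
  proof (rule cyclic_space_minimal)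
    show "csubspace M" unfolding M
      by (intro complex_vector.subspaceI) (auto simp: cinner_add_left cinner_scaleC_left blinfun.add_right
          blinfun.zero_right cinner.zero_left cbounded_scaleC[OF assms(1)] algebra_simps)
    show "closed M" unfolding M
      by (intro closed_Collect_eq continuous_intros cinner.continuous_on)
    show "da_one \<in> M"
    proof -
      have "cinner da_one (da_kernel z) = 1"
        using z kernel_summable[of z] cinner_mono[of "da_kernel z" "\<lambda>_. 0"]
        by (subst cinner_commute) (simp add: da_kernel_def coeff_Abs da_weight_def)
      then show ?thesis by (simp add: M)
    qed
    show "shift_op k f \<in> M" if "f \<in> M" for k f
    proof -
      have "A (shift_op k f) = shift_op k (A f)"
        by (metis assms(2) blinfun_apply_blinfun_compose)
      then show ?thesis using that by (simp add: M_def da_fun_shift_op)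
    qed
  qed
  then show "da_fun (A f) z = da_fun (A da_one) z * da_fun f z"
    by (auto simp: cyclic_one M_def)
qed

lemma multiplier_algebra_eq:
  "multiplier_algebra = {A \<in> cbounded. \<forall>k. A o\<^sub>L shift_op k = shift_op k o\<^sub>L A}"
proof (intro equalityI subsetI)
  fix A assume "A \<in> {A \<in> cbounded. \<forall>k. A o\<^sub>L shift_op k = shift_op k o\<^sub>L A}"
  then have "is_mult_op (da_fun (A da_one)) A" by (simp add: commute_shift_imp_is_mult_op)
  then show "A \<in> multiplier_algebra" by (auto simp: multiplier_algebra_def)
qed (simp add: multiplier_cbounded multiplier_commute_shift)

lemma multiplier_algebra_comm:
  assumes "A \<in> multiplier_algebra" "B \<in> multiplier_algebra"
  shows "A o\<^sub>L B = B o\<^sub>L A"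
  using assms unfolding multiplier_algebra_def is_mult_op_def
  by (intro blinfun_eqI da_fun_inject) auto

lemma multiplier_algebra_id: "id_blinfun \<in> multiplier_algebra"
  by (auto simp: multiplier_algebra_eq cbounded_id intro!: blinfun_eqI)

lemma multiplier_algebra_add:
  "A \<in> multiplier_algebra \<Longrightarrow> B \<in> multiplier_algebra \<Longrightarrow> A + B \<in> multiplier_algebra"
  by (auto simp: multiplier_algebra_eq cbounded_add bounded_bilinear.add_left[OF bounded_bilinear_blinfun_compose] bounded_bilinear.add_right[OF bounded_bilinear_blinfun_compose])

lemma multiplier_algebra_scale_op:
  assumes "A \<in> multiplier_algebra" shows "scale_op c A \<in> multiplier_algebra"
proof -
  have "scale_op c A o\<^sub>L shift_op k = scale_op c (A o\<^sub>L shift_op k)" for k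
    by (rule blinfun_eqI) (simp add: scale_op.rep_eq)
  moreover have "shift_op k o\<^sub>L scale_op c A = scale_op c (shift_op k o\<^sub>L A)" for k
    by (rule blinfun_eqI) (simp add: scale_op.rep_eq cbounded_scaleC[OF shift_op_cbounded])
  ultimately show ?thesis
    using assms by (simp add: multiplier_algebra_eq cbounded_scale_op)
qed

lemma multiplier_algebra_compose:
  assumes "A \<in> multiplier_algebra" "B \<in> multiplier_algebra" shows "A o\<^sub>L B \<in> multiplier_algebra"
proof -
  have "(A o\<^sub>L B) o\<^sub>L shift_op k = shift_op k o\<^sub>L (A o\<^sub>L B)" for k
    using assms by (metis blinfun_compose_assoc multiplier_commute_shift)
  then show ?thesis using assms by (simp add: multiplier_algebra_eq cbounded_compose)
qed

lemma multiplier_algebra_shift: "shift_op k \<in> multiplier_algebra"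
  by (simp add: multiplier_algebra_eq shift_op_cbounded shift_op_commute)

lemma multiplier_algebra_word: "word_op shift_op w \<in> multiplier_algebra"
  by (induction w) (auto intro: multiplier_algebra_id multiplier_algebra_compose multiplier_algebra_shift)

lemma blinfun_compose_eqD: "A o\<^sub>L B = C o\<^sub>L D \<Longrightarrow> A (blinfun_apply B x) = C (blinfun_apply D x)"
  by (metis blinfun_apply_blinfun_compose)

section \<open>Wandering vectors of row isometries\<close>

text \<open>Abstracts Fock space and its ampliations: \<open>L\<close> are the creation operators,
  \<open>Ls\<close> their adjoints, \<open>E\<close> the vacuum component. By \<open>pure\<close>,
  the vacuum components of all backward translates determine a vector.\<close>

locale pure_row_isometry =
  fixes L Ls :: "'d::finite \<Rightarrow> 'v::chilbert_space \<Rightarrow>\<^sub>L 'v" and E :: "'v \<Rightarrow>\<^sub>L 'e::chilbert_space"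
  assumes L_cbounded: "L k \<in> cbounded" and Ls_cbounded: "Ls k \<in> cbounded" and E_cbounded: "E \<in> cbounded"
    and adj: "cinner (L k x) y = cinner x (Ls k y)"
    and Ls_L: "Ls j (L k x) = (if j = k then x else 0)"
    and E_L: "E (L k x) = 0"
    and pure: "(\<And>u. E (word_op Ls u x) = 0) \<Longrightarrow> x = 0"
begin

lemma norm_word: "norm (word_op L u x) = norm x"
proof (induction u)
  case (Cons k u)
  have "norm (L k y) = norm y" for y
  proof -
    have "complex_of_real ((norm (L k y))\<^sup>2) = of_real ((norm y)\<^sup>2)"
      by (simp only: cinner_self[symmetric] adj Ls_L refl if_True)
    then show ?thesis
      by (simp only: of_real_eq_iff power2_eq_iff_nonneg norm_ge_zero)
  qed
  then show ?case using Cons by simp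
qed simp

text \<open>\<open>w\<close> is the part of \<open>v\<close> orthogonal to the closed span
  \<open>M\<close> of its translates by nonempty words. As the \<open>L k\<close> are isometries
  with orthogonal ranges, cancelling common first letters reduces orthogonality of two translates of
  \<open>w\<close> to the case where one word is empty.\<close>

lemma wandering_vector:
  obtains w where "w \<in> cyclic_space L v" "v \<in> cyclic_space L w"
    "\<And>u u'. u \<noteq> u' \<Longrightarrow> cinner (word_op L u w) (word_op L u' w) = 0"
proof -
  define N where "N = cyclic_space L v"
  define M where "M = cclosed_span {word_op L u v |u. u \<noteq> []}"
  have csN: "csubspace N" and clN: "closed N" and csM: "csubspace M" and clM: "closed M"
    by (simp_all add: N_def M_def csubspace_cyclic_space closed_cyclic_space csubspace_cclosed_span)
  have MN: "M \<subseteq> N" unfolding M_def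
    by (rule cclosed_span_minimal) (auto simp: N_def word_in_cyclic_space csubspace_cyclic_space closed_cyclic_space)
  obtain p where p: "p \<in> M" "\<And>x. x \<in> M \<Longrightarrow> cinner (v - p) x = 0"
    using projection_exists[OF csM clM] by metis
  define w where "w = v - p"
  have wN: "w \<in> N"
    using p(1) MN csN cyclic_space_self[of v L] by (auto simp: w_def N_def intro!: complex_vector.subspace_diff)
  have L_N: "L k y \<in> M" if "y \<in> N" for k y
  proof -
    have "N \<subseteq> {y. L k y \<in> M}" unfolding N_def cyclic_space_def
    proof (rule cclosed_span_minimal)
      have "L k (word_op L u v) \<in> M" for u
        unfolding M_def by (intro cclosed_span_superset CollectI exI[of _ "k # u"]) simp
      then show "range (\<lambda>u. word_op L u v) \<subseteq> {y. L k y \<in> M}" by blast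
    qed (auto intro: csubspace_vimage closed_vimage_blinfun L_cbounded csM clM)
    then show ?thesis using that by blast
  qed
  have word_N: "word_op L u w \<in> N" for u
    by (induction u) (use wN L_N MN in auto)
  have orth_Nil: "cinner w (word_op L (k # u) w) = 0" for k u
    using p(2)[OF L_N[OF word_N]] by (simp add: w_def)
  have orth: "cinner (word_op L u w) (word_op L u' w) = 0" if "u \<noteq> u'" for u u'
    using that
  proof (induction u arbitrary: u')
    case Nil
    then show ?case using orth_Nil by (cases u') auto
  next
    case (Cons k u)
    show ?case
    proof (cases u')
      case Nil
      then show ?thesis using orth_Nil[of k u] cinner_eq_0_commute by auto
    next
      case (Cons j u'')
      then show ?thesis using Cons.IH[of u''] Cons.prems by (auto simp: adj Ls_L cinner.zero_right)
    qed
  qed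
  \<comment> \<open>The orthogonal complement of the orbit of \<open>w\<close> within
    \<open>N\<close>. It lies in \<open>M\<close>, where \<open>E\<close> vanishes, and is stable
    under \<open>Ls\<close>; purity then leaves only 0, so \<open>w\<close> generates
    \<open>v\<close>.\<close>
  define Q where "Q x \<longleftrightarrow> x \<in> N \<and> (\<forall>u. cinner x (word_op L u w) = 0)" for x
  have Q_M: "x \<in> M" if "Q x" for x
  proof -
    obtain q where q: "q \<in> M" "\<And>y. y \<in> M \<Longrightarrow> cinner (x - q) y = 0"
      using projection_exists[OF csM clM] by metis
    define y where "y = x - q"
    have yN: "y \<in> N"
      using q(1) MN csN that by (auto simp: y_def Q_def intro!: complex_vector.subspace_diff)
    have "cinner q w = 0"
      unfolding w_def using p(2)[OF q(1)] by (subst cinner_eq_0_commute)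
    moreover have "cinner x w = 0"
      using that by (auto simp: Q_def dest: spec[of _ "[]"])
    ultimately have "cinner y w = 0" by (simp add: y_def cinner.diff_left)
    moreover have "cinner y p = 0" using q(2)[OF p(1)] by (simp add: y_def)
    \<comment> \<open>\<open>v = w + p\<close> and \<open>y\<close> is orthogonal to both summands.
      Being orthogonal to \<open>M\<close> as well, \<open>y\<close> is orthogonal to all of
      \<open>N\<close>.\<close>
    ultimately have "cinner y v = 0"
      using cinner_add_right[of y w p] by (simp add: w_def)
    have "cinner y z = 0" if "z \<in> N" for z
    proof (rule orthogonal_cclosed_span)
      show "z \<in> cclosed_span (range (\<lambda>u. word_op L u v))"
        using that by (simp add: N_def cyclic_space_def)
      fix s assume "s \<in> range (\<lambda>u. word_op L u v)"
      then obtain u where u: "s = word_op L u v" by blast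
      show "cinner y s = 0"
      proof (cases u)
        case Nil
        then show ?thesis using u \<open>cinner y v = 0\<close> by simp
      next
        case (Cons k u')
        then have "s \<in> M"
            unfolding M_def using u by (intro cclosed_span_superset CollectI exI[of _ u]) simp
        then show ?thesis using q(2) by (simp add: y_def)
      qed
    qed
    from this[OF yN] have "x = q" by (simp add: y_def cinner_self)
    with q(1) show ?thesis by simp
  qed
  have Ls_M: "Ls k x \<in> N" if "x \<in> M" for k x
  proof -
    have "M \<subseteq> {x. Ls k x \<in> N}" unfolding M_def
    proof (rule cclosed_span_minimal)
      have "Ls k (word_op L u v) \<in> N" if "u \<noteq> []" for u
        using that complex_vector.subspace_0[OF csN]
        by (cases u) (auto simp: Ls_L N_def word_in_cyclic_space)
      then show "{word_op L u v |u. u \<noteq> []} \<subseteq> {x. Ls k x \<in> N}" by blast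
    qed (auto intro: csubspace_vimage closed_vimage_blinfun Ls_cbounded csN clN)
    then show ?thesis using that by blast
  qed
  have Q_Ls: "Q (Ls k x)" if "Q x" for k x
  proof -
    have "cinner (Ls k x) (word_op L u w) = 0" for u
    proof -
      have "cinner (word_op L u w) (Ls k x) = cinner (word_op L (k # u) w) x"
        by (simp add: adj)
      also have "\<dots> = 0" using that by (subst cinner_eq_0_commute) (simp only: Q_def)
      finally show ?thesis using cinner_eq_0_commute by blast
    qed
    then show ?thesis using Ls_M[OF Q_M[OF that]] by (simp add: Q_def)
  qed
  have Q_0: "x = 0" if "Q x" for x
  proof (rule pure)
    fix u
    have "Q (word_op Ls u x)" by (induction u) (use that Q_Ls in auto)
    then have "word_op Ls u x \<in> M" by (rule Q_M)
    moreover have "M \<subseteq> {x. E x \<in> {0}}" unfolding M_def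
    proof (rule cclosed_span_minimal)
      have "E (word_op L u v) = 0" if "u \<noteq> []" for u
        using that by (cases u) (auto simp: E_L)
      then show "{word_op L u v |u. u \<noteq> []} \<subseteq> {x. E x \<in> {0}}" by blast
    qed (rule csubspace_vimage closed_vimage_blinfun E_cbounded complex_vector.subspace_single_0 closed_singleton)+
    ultimately show "E (word_op Ls u x) = 0" by blast
  qed
  obtain q where q: "q \<in> cyclic_space L w" "\<And>x. x \<in> cyclic_space L w \<Longrightarrow> cinner (v - q) x = 0"
    using projection_exists[OF csubspace_cyclic_space closed_cyclic_space] by metis
  have "cyclic_space L w \<subseteq> N"
    using csN clN wN L_N MN by (intro cyclic_space_minimal) auto
  then have "v - q \<in> N"
    using q(1) csN cyclic_space_self[of v L] by (intro complex_vector.subspace_diff) (auto simp: N_def)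
  then have "Q (v - q)" using q(2) by (simp add: Q_def word_in_cyclic_space)
  then have "v = q" using Q_0 by fastforce
  with q(1) wN orth that show thesis by (simp add: N_def)
qed

end

lemma norm_sum_orthogonal:
  assumes "finite U" "\<And>u u'. u \<noteq> u' \<Longrightarrow> cinner (b u) (b u') = 0" "\<And>u. norm (b u) = K"
  shows "norm (\<Sum>u\<in>U. c u *\<^sub>C b u) = K * sqrt (\<Sum>u\<in>U. (cmod (c u))\<^sup>2)"
proof -
  have "K \<ge> 0" using assms(3) norm_ge_zero by metis
  have "(norm (\<Sum>u\<in>U. c u *\<^sub>C b u))\<^sup>2 = K\<^sup>2 * (\<Sum>u\<in>U. (cmod (c u))\<^sup>2)"
    using assms(1)
  proof (induction U rule: finite_induct)
    case (insert u U)
    have "cinner (b u) (b v) = 0" if "v \<in> U" for v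
      using insert.hyps assms(2)[of u v] that by auto
    then have "cinner (c u *\<^sub>C b u) (\<Sum>v\<in>U. c v *\<^sub>C b v) = 0"
      by (simp add: cinner.sum_right cinner_scaleC_left cinner_scaleC_right)
    then show ?case
      using insert by (simp add: norm_add_Pythagorean norm_scaleC assms(3) power_mult_distrib distrib_left)
  qed simp
  then have "norm (\<Sum>u\<in>U. c u *\<^sub>C b u) = sqrt (K\<^sup>2 * (\<Sum>u\<in>U. (cmod (c u))\<^sup>2))"
    by (metis norm_ge_zero real_sqrt_unique)
  then show ?thesis using \<open>K \<ge> 0\<close> by (simp add: real_sqrt_mult)
qed

section \<open>The full Fock space\<close>

type_synonym 'd fock = "('d list, complex) ell2"

lemma annih_sum_le:
  "finite F \<Longrightarrow> (\<Sum>w\<in>F. (norm (coord f (k # w)))\<^sup>2) \<le> (norm (f :: 'd fock))\<^sup>2"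
  using ell2_finite_sum_le[of "(#) k ` F" f] by (simp add: sum.reindex)

lift_definition annih_fun :: "'d \<Rightarrow> 'd fock \<Rightarrow> 'd fock" is "\<lambda>k f w. f (k # w)"
proof -
  fix k and f :: "'d list \<Rightarrow> complex" assume "sq_summable f"
  show "sq_summable (\<lambda>w. f (k # w))"
    by (rule sq_summableI, rule annih_sum_le[of _ "Abs_ell2 f", unfolded coord_Abs_ell2[OF \<open>sq_summable f\<close>]])
qed

lift_definition annih :: "'d \<Rightarrow> 'd fock \<Rightarrow>\<^sub>L 'd fock" is annih_fun
proof (rule bounded_linear_intro[where K = 1])
  fix k and f g :: "'d fock" and r :: real
  show "annih_fun k (f + g) = annih_fun k f + annih_fun k g" "annih_fun k (r *\<^sub>R f) = r *\<^sub>R annih_fun k f"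
    by (auto intro!: ell2_eqI simp: annih_fun.rep_eq coord_add coord_scaleR)
  have "norm (annih_fun k f) \<le> norm f"
    by (rule norm_ell2_leI) (simp_all only: annih_fun.rep_eq annih_sum_le norm_ge_zero)
  then show "norm (annih_fun k f) \<le> norm f * 1" by simp
qed

lemma coord_annih: "coord (annih k f) w = coord f (k # w)"
  by (simp add: annih.rep_eq annih_fun.rep_eq)

lemma annih_cbounded: "annih k \<in> cbounded"
  by (intro cboundedI ell2_eqI) (simp add: coord_annih coord_scaleC)

text \<open>As an adjoint it is bounded at once; its coordinates are recovered by pairing with the
  unit vectors \<open>single w 1\<close>.\<close>

definition create :: "'d \<Rightarrow> 'd fock \<Rightarrow>\<^sub>L 'd fock" where
  "create k = hadjoint (annih k)"

lemma create_cbounded: "create k \<in> cbounded"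
  by (simp add: create_def hadjoint_cbounded annih_cbounded)

lemma create_adjoint: "cinner (create k f) g = cinner f (annih k g)"
  by (simp add: create_def hadjoint' annih_cbounded)

lemma coord_create:
  "coord (create k f) w = (case w of [] \<Rightarrow> 0 | j # u \<Rightarrow> if j = k then coord f u else 0)"
proof -
  have "coord (create k f) w = cinner (create k f) (single w 1)"
    by (simp add: cinner_single cinner_complex_def)
  also have "\<dots> = cinner f (annih k (single w 1))"
    by (rule create_adjoint)
  also have "annih k (single w 1) = (case w of [] \<Rightarrow> 0 | j # u \<Rightarrow> if j = k then single u 1 else 0)"
    by (rule ell2_eqI) (auto simp: coord_annih single.rep_eq zero_ell2.rep_eq split: list.split)
  finally show ?thesis
    by (auto simp: cinner_single cinner_complex_def cinner.zero_right split: list.split)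
qed

lemma annih_create: "annih j (create k f) = (if j = k then f else 0)"
  by (rule ell2_eqI) (simp add: coord_annih coord_create zero_ell2.rep_eq)

lemma coord_word_annih: "coord (word_op annih u f) w = coord f (rev u @ w)"
  by (induction u arbitrary: w) (auto simp: coord_annih)

lemma pure_row_isometry_fock:
  "pure_row_isometry (\<lambda>k. amp (create k) :: ('i, 'd::finite fock) ell2 \<Rightarrow>\<^sub>L ('i, 'd fock) ell2)
    (\<lambda>k. amp (annih k)) (amp (proj []))"
proof
  fix k j :: 'd and x y :: "('i, 'd fock) ell2"
  show "amp (create k) \<in> cbounded" "amp (annih k) \<in> cbounded"
    by (simp_all add: amp_cbounded create_cbounded annih_cbounded)
  show "amp (proj []) \<in> cbounded"
    by (simp add: amp_cbounded proj_cbounded)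
  show "cinner (amp (create k) x) y = cinner x (amp (annih k) y)"
    by (rule amp_adjoint) (rule create_adjoint)
  show "amp (annih j) (amp (create k) x) = (if j = k then x else 0)"
    by (rule ell2_eqI) (simp add: annih_create zero_ell2.rep_eq)
  show "amp (proj []) (amp (create k) x) = 0"
    by (rule ell2_eqI) (simp add: proj.rep_eq coord_create zero_ell2.rep_eq)
next
  fix x :: "('i, 'd fock) ell2"
  assume x: "\<And>u. amp (proj []) (word_op (\<lambda>k. amp (annih k)) u x) = 0"
  have "coord (coord x i) u = 0" for i u
    using arg_cong[OF x[of "rev u"], of "\<lambda>f. coord f i"]
    by (simp add: word_op_amp proj.rep_eq coord_word_annih zero_ell2.rep_eq)
  then show "x = 0"
    by (intro ell2_eqI) (simp add: zero_ell2.rep_eq)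
qed

interpretation fock: pure_row_isometry
  "\<lambda>k. amp (create k) :: ('i, 'd::finite fock) ell2 \<Rightarrow>\<^sub>L ('i, 'd fock) ell2"
  "\<lambda>k. amp (annih k)" "amp (proj [])"
  by (rule pure_row_isometry_fock)

subsection \<open>Symmetrization\<close>

text \<open>The fibre has 1 / \<open>da_weight \<alpha>\<close> words, so the weight cancels the
  factor that Cauchy-Schwarz costs. This makes symmetrization a contraction.\<close>

lemma fibre_Cauchy_Schwarz:
  "da_weight \<alpha> * (cmod (\<Sum>u | word_content u = \<alpha>. c u))\<^sup>2 \<le> (\<Sum>u | word_content u = \<alpha>. (cmod (c u))\<^sup>2)"
proof -
  let ?W = "{u. word_content u = \<alpha>}"
  have "(cmod (\<Sum>u\<in>?W. c u))\<^sup>2 \<le> (\<Sum>u\<in>?W. cmod (c u))\<^sup>2"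
    by (intro power_mono norm_sum) simp
  also have "\<dots> \<le> (\<Sum>u\<in>?W. (cmod (c u))\<^sup>2) * card ?W"
    by (rule sum_squared_le_sum_of_squares)
  finally show ?thesis
    using da_weight_pos[of \<alpha>] by (simp add: content_fibre(2) field_simps)
qed

lemma symm_sum_le:
  assumes "finite A"
  shows "(\<Sum>\<alpha>\<in>A. da_weight \<alpha> * (cmod (\<Sum>u | word_content u = \<alpha>. coord f u))\<^sup>2) \<le> (norm (f :: 'd::finite fock))\<^sup>2"
proof -
  have "(\<Sum>\<alpha>\<in>A. da_weight \<alpha> * (cmod (\<Sum>u | word_content u = \<alpha>. coord f u))\<^sup>2)
      \<le> (\<Sum>\<alpha>\<in>A. \<Sum>u | word_content u = \<alpha>. (cmod (coord f u))\<^sup>2)"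
    by (intro sum_mono fibre_Cauchy_Schwarz)
  also have "\<dots> = (\<Sum>u | word_content u \<in> A. (cmod (coord f u))\<^sup>2)"
    using assms by (rule sum_words_content)
  also have "\<dots> \<le> (norm f)\<^sup>2"
    using assms by (intro ell2_finite_sum_le sum_words_content(2))
  finally show ?thesis .
qed

text \<open>Lets the variables commute: the unit vector of a word goes to the monomial of its
  content. Up to identification this is the projection of Fock space onto its symmetric
  part.\<close>

lift_definition symm_fun :: "'d::finite fock \<Rightarrow> 'd drury_arveson"
  is "\<lambda>f \<alpha>. \<Sum>u | word_content u = \<alpha>. f u"
proof -
  fix f :: "'d list \<Rightarrow> complex" assume "sq_summable f"
  show "da_summable (\<lambda>\<alpha>. \<Sum>u | word_content u = \<alpha>. f u)"
    by (rule da_summableI, rule symm_sum_le[of _ "Abs_ell2 f", unfolded coord_Abs_ell2[OF \<open>sq_summable f\<close>]])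
qed

lift_definition symm :: "'d::finite fock \<Rightarrow>\<^sub>L 'd drury_arveson" is symm_fun
proof (rule bounded_linear_intro[where K = 1])
  fix f g :: "'d fock" and r :: real
  show "symm_fun (f + g) = symm_fun f + symm_fun g" "symm_fun (r *\<^sub>R f) = r *\<^sub>R symm_fun f"
    by (auto intro!: da_eqI simp: symm_fun.rep_eq coeff_add coeff_scaleR coord_add coord_scaleR
        sum.distrib sum_distrib_left scaleR_conv_of_real)
  have "norm (symm_fun f) \<le> norm f"
    by (rule norm_da_leI) (simp_all only: symm_fun.rep_eq symm_sum_le norm_ge_zero)
  then show "norm (symm_fun f) \<le> norm f * 1" by simp
qed

lemma coeff_symm: "coeff_da (symm f) \<alpha> = (\<Sum>u | word_content u = \<alpha>. coord f u)"
  by (simp add: symm.rep_eq symm_fun.rep_eq)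

lemma symm_cbounded: "symm \<in> cbounded"
  by (intro cboundedI da_eqI)
    (simp add: coeff_symm coord_scaleC coeff_scaleC sum_distrib_left scaleC_complex_def)

lemma norm_symm_le: "norm (symm f) \<le> norm f"
  by (rule norm_da_leI) (simp_all only: coeff_symm symm_sum_le norm_ge_zero)

lemma symm_create: "symm o\<^sub>L create k = shift_op k o\<^sub>L symm"
proof (intro blinfun_eqI da_eqI)
  fix f :: "'a fock" and \<alpha> :: "'a \<Rightarrow> nat"
  \<comment> \<open>Only words beginning with \<open>k\<close> contribute, since
    \<open>create k f\<close> vanishes on all others.\<close>
  have "(\<Sum>u | word_content u = \<alpha>. coord (create k f) u)
      = (\<Sum>u \<in> (#) k ` {v. incr k (word_content v) = \<alpha>}. coord (create k f) u)"
    by (intro sum.mono_neutral_right content_fibre)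
       (auto simp: coord_create image_iff split: list.split)
  also have "\<dots> = (\<Sum>v | incr k (word_content v) = \<alpha>. coord f v)"
    by (simp add: sum.reindex coord_create)
  also have "\<dots> = coeff_da (shift_op k (symm f)) \<alpha>"
  proof (cases "\<alpha> k = 0")
    case True
    then have "{v. incr k (word_content v) = \<alpha>} = {}" by (auto simp: incr_def)
    then show ?thesis using True by (simp add: coeff_shift_op)
  next
    case False
    have "incr k (word_content v) = \<alpha> \<longleftrightarrow> word_content v = \<alpha>(k := \<alpha> k - 1)" for v
      using incr_dec[of \<alpha> k, OF False] dec_incr[of k "word_content v"] by auto
    then show ?thesis using False by (simp add: coeff_shift_op coeff_symm)
  qed
  finally show "coeff_da ((symm o\<^sub>L create k) f) \<alpha> = coeff_da ((shift_op k o\<^sub>L symm) f) \<alpha>"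
    by (simp add: coeff_symm)
qed

lemma symm_lift:
  fixes g :: "'d::finite drury_arveson"
  obtains f where "symm f = g" "norm f \<le> norm g"
proof -
  \<comment> \<open>The preimage that is constant on fibres. Sharing each coefficient equally among
    the 1 / \<open>da_weight\<close> words of its fibre keeps the norm from growing.\<close>
  define c where "c u = of_real (da_weight (word_content u)) * coeff_da g (word_content u)" for u
  have bound: "(\<Sum>u\<in>U. (norm (c u))\<^sup>2) \<le> (norm g)\<^sup>2" if "finite U" for U
  proof -
    let ?A = "word_content ` U"
    have "(\<Sum>u\<in>U. (norm (c u))\<^sup>2) \<le> (\<Sum>u | word_content u \<in> ?A. (norm (c u))\<^sup>2)"
      using that by (intro sum_mono2 sum_words_content(2)) auto
    also have "\<dots> = (\<Sum>\<alpha>\<in>?A. \<Sum>u | word_content u = \<alpha>. (norm (c u))\<^sup>2)"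
      using that by (intro sum_words_content(1)[symmetric]) simp
    also have "\<dots> = (\<Sum>\<alpha>\<in>?A. (da_weight \<alpha> * cmod (coeff_da g \<alpha>))\<^sup>2 / da_weight \<alpha>)"
    proof (rule sum.cong[OF refl])
      fix \<alpha>
      have "(\<Sum>u | word_content u = \<alpha>. (norm (c u))\<^sup>2) = (\<Sum>u | word_content u = \<alpha>.
          (\<lambda>\<beta>. (da_weight \<beta> * cmod (coeff_da g \<beta>))\<^sup>2) (word_content u))"
        by (simp add: c_def norm_mult less_imp_le[OF da_weight_pos])
      also have "\<dots> = (da_weight \<alpha> * cmod (coeff_da g \<alpha>))\<^sup>2 / da_weight \<alpha>"
        by (rule sum_content_fibre_real)
      finally show "(\<Sum>u | word_content u = \<alpha>. (norm (c u))\<^sup>2) = (da_weight \<alpha> * cmod (coeff_da g \<alpha>))\<^sup>2 / da_weight \<alpha>" .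
    qed
    also have "\<dots> = (\<Sum>\<alpha>\<in>?A. da_weight \<alpha> * (cmod (coeff_da g \<alpha>))\<^sup>2)"
      using da_weight_pos by (intro sum.cong) (auto simp: power_mult_distrib power2_eq_square)
    also have "\<dots> \<le> (norm g)\<^sup>2"
      using that by (intro da_sum_le_norm) simp
    finally show ?thesis .
  qed
  then have "sq_summable c" by (rule sq_summableI)
  define f where "f = Abs_ell2 c"
  have f: "coord f = c" using \<open>sq_summable c\<close> by (simp add: f_def coord_Abs_ell2)
  have "norm f \<le> norm g"
    by (rule norm_ell2_leI) (simp_all only: f bound norm_ge_zero)
  moreover have "symm f = g"
  proof (rule da_eqI)
    fix \<alpha>
    have "coeff_da (symm f) \<alpha> = of_real (da_weight \<alpha>) * coeff_da g \<alpha> / of_real (da_weight \<alpha>)"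
      unfolding coeff_symm f c_def
      by (rule sum_content_fibre[where G = "\<lambda>\<beta>. of_real (da_weight \<beta>) * coeff_da g \<beta>"])
    then show "coeff_da (symm f) \<alpha> = coeff_da g \<alpha>"
      using da_weight_pos[of \<alpha>] by simp
  qed
  ultimately show thesis using that by blast
qed

text \<open>The norm control in \<open>symm_lift\<close> enters here: the coordinatewise lifts have
  to be square summable again.\<close>

lemma amp_symm_surj:
  fixes F :: "('i, 'd::finite drury_arveson) ell2"
  obtains G where "amp symm G = F"
proof -
  have "\<exists>f. symm f = coord F i \<and> norm f \<le> norm (coord F i)" for i
    using symm_lift by metis
  then obtain g where g: "\<And>i. symm (g i) = coord F i" "\<And>i. norm (g i) \<le> 1 * norm (coord F i)"
    by (metis mult_1)
  have "sq_summable g"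
    using coord_sq_summable g(2) by (rule sq_summable_bound)
  then have "amp symm (Abs_ell2 g) = F"
    by (intro ell2_eqI) (simp add: coord_Abs_ell2 g)
  then show thesis by (rule that)
qed

section \<open>Invariant subspaces generated by multipliers\<close>

lemma word_op_content:
  assumes comm: "\<And>i j. S i o\<^sub>L S j = S j o\<^sub>L S i" and "word_content u = word_content v"
  shows "word_op S u = word_op S v"
proof -
  have "mset u = mset v"
    using assms(2) by (simp add: word_content_def multiset_eq_iff)
  then show ?thesis
  proof (induction u arbitrary: v)
    case (Cons k u)
    then have "k \<in> set v" by (metis list.set_intros(1) mset_eq_setD)
    then obtain v1 v2 where v: "v = v1 @ k # v2" by (meson split_list)
    then have "word_op S u = word_op S (v1 @ v2)" using Cons by simp
    moreover have "S k o\<^sub>L word_op S v1 = word_op S v1 o\<^sub>L S k"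
      by (rule word_op_commute) (rule comm)
    ultimately show ?case
      by (simp add: v word_op_append flip: blinfun_compose_assoc)
  qed simp
qed

text \<open>Square-summable coefficients against the orbit of \<open>w\<close> define the adjoint of the operator sought.\<close>

lemma multiplier_extension:
  fixes S :: "'d::finite \<Rightarrow> 'v::chilbert_space \<Rightarrow>\<^sub>L 'v"
  assumes S: "\<And>k. S k \<in> cbounded" and comm: "\<And>i j. S i o\<^sub>L S j = S j o\<^sub>L S i"
    and "K \<ge> 0"
    and bound: "\<And>U c. finite U \<Longrightarrow> norm (\<Sum>u\<in>U. c u *\<^sub>C word_op S u w) \<le> K * sqrt (\<Sum>u\<in>U. (cmod (c u))\<^sup>2)"
  obtains C where "C \<in> cbounded" "C da_one = w" "\<And>k. C o\<^sub>L shift_op k = S k o\<^sub>L C"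
proof -
  let ?c = "\<lambda>x u. cinner x (word_op S u w)"
  have coeff_bound: "(\<Sum>u\<in>U. (norm (?c x u))\<^sup>2) \<le> (K * norm x)\<^sup>2" if "finite U" for U x
  proof -
    \<comment> \<open>Duality: pairing \<open>x\<close> with the combination weighted by its own
      coefficients gives s on one side and at most K ||x|| sqrt s on the other.\<close>
    define s where "s = (\<Sum>u\<in>U. (norm (?c x u))\<^sup>2)"
    have "s \<ge> 0" by (simp add: s_def sum_nonneg)
    have "complex_of_real s = cinner x (\<Sum>u\<in>U. ?c x u *\<^sub>C word_op S u w)"
      by (simp add: s_def cinner.sum_right cinner_scaleC_right complex_norm_square mult.commute flip: of_real_power)
    then have "s = cmod (cinner x (\<Sum>u\<in>U. ?c x u *\<^sub>C word_op S u w))"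
      using \<open>s \<ge> 0\<close> by (metis abs_of_nonneg norm_of_real)
    also have "\<dots> \<le> norm x * norm (\<Sum>u\<in>U. ?c x u *\<^sub>C word_op S u w)"
      by (rule cinner_Cauchy_Schwarz)
    also have "\<dots> \<le> norm x * (K * sqrt s)"
      unfolding s_def by (intro mult_left_mono bound that) simp
    finally have "sqrt s * sqrt s \<le> K * norm x * sqrt s"
      using \<open>s \<ge> 0\<close> by (simp add: mult_ac)
    then have "sqrt s \<le> K * norm x"
    proof (cases "s = 0")
      case False
      with \<open>s \<ge> 0\<close> \<open>sqrt s * sqrt s \<le> K * norm x * sqrt s\<close> show ?thesis
        by (intro mult_right_le_imp_le[of "sqrt s" "sqrt s"]) simp_all
    qed (use \<open>K \<ge> 0\<close> in simp)
    then show ?thesis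
      using power_mono[of "sqrt s" "K * norm x" 2] \<open>s \<ge> 0\<close> by (simp flip: s_def)
  qed
  have sq: "sq_summable (?c x)" for x
    using coeff_bound by (rule sq_summableI)
  define D0 where "D0 x = Abs_ell2 (?c x)" for x
  have coord_D0: "coord (D0 x) u = ?c x u" for x u
    by (simp add: D0_def coord_Abs_ell2 sq)
  have bl: "bounded_linear D0"
  proof (rule bounded_linear_intro[where K = K])
    show "norm (D0 x) \<le> norm x * K" for x
      using coeff_bound \<open>K \<ge> 0\<close> by (intro norm_ell2_leI) (simp_all add: coord_D0 mult.commute)
  qed (auto intro!: ell2_eqI simp: coord_D0 coord_add coord_scaleR cinner_add_left cinner.scaleR_left)
  define D where "D = symm o\<^sub>L Blinfun D0"
  have D: "D x = symm (D0 x)" for x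
    by (simp add: D_def bounded_linear_Blinfun_apply[OF bl])
  have "D0 (a *\<^sub>C x) = a *\<^sub>C D0 x" for a x
    by (rule ell2_eqI) (simp add: coord_D0 coord_scaleC cinner_scaleC_left scaleC_complex_def)
  then have D_cb: "D \<in> cbounded"
    by (intro cboundedI) (simp add: D cbounded_scaleC[OF symm_cbounded])
  define C where "C = hadjoint D"
  have C_cb: "C \<in> cbounded" by (simp add: C_def hadjoint_cbounded D_cb)
  \<comment> \<open>As the \<open>S k\<close> commute, the orbit coefficients of \<open>x\<close>
    depend only on the content of the word. Summing over a fibre then multiplies by 1 /
    \<open>da_weight\<close>, which the weight in \<open>cinner_mono\<close> cancels.\<close>
  have C_mono: "C (da_mono (word_content v)) = word_op S v w" for v
  proof (rule cinner_ext)
    fix x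
    have "cinner x (C (da_mono (word_content v))) = cinner x (word_op S v w)"
    proof -
      let ?G = "\<lambda>\<beta>. ?c x (word_of \<beta>)"
      have G: "?c x u = ?G (word_content u)" for u
        using word_op_content[OF comm, of u "word_of (word_content u)"] by simp
      have "cinner x (C (da_mono (word_content v))) = cinner (D x) (da_mono (word_content v))"
        by (simp add: C_def hadjoint D_cb)
      also have "\<dots> = of_real (da_weight (word_content v)) * (\<Sum>u | word_content u = word_content v. ?c x u)"
        by (simp add: cinner_mono D coeff_symm coord_D0)
      also have "(\<Sum>u | word_content u = word_content v. ?c x u)
          = ?G (word_content v) / of_real (da_weight (word_content v))"
        unfolding sum_content_fibre[of ?G, symmetric] by (intro sum.cong refl) (rule G)
      finally show ?thesis
        using da_weight_pos[of "word_content v"] G[of v] by simp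
    qed
    then show "cinner (C (da_mono (word_content v))) x = cinner (word_op S v w) x"
      by (metis cinner_commute)
  qed
  have "C o\<^sub>L shift_op k = S k o\<^sub>L C" for k
  proof -
    have "cyclic_space shift_op da_one \<subseteq> {f. (C o\<^sub>L shift_op k) f = (S k o\<^sub>L C) f}"
      unfolding cyclic_space_def
    proof (rule cclosed_span_minimal)
      have "(C o\<^sub>L shift_op k) (word_op shift_op u da_one) = (S k o\<^sub>L C) (word_op shift_op u da_one)" for u
        using C_mono[of "k # u"] C_mono[of u] by (simp add: word_shift_one shift_op_mono)
      then show "range (\<lambda>u. word_op shift_op u da_one) \<subseteq> {f. (C o\<^sub>L shift_op k) f = (S k o\<^sub>L C) f}" by blast
    qed (intro csubspace_equalizer closed_equalizer cbounded_compose C_cb S shift_op_cbounded)+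
    then show ?thesis using cyclic_one by (intro blinfun_eqI) blast
  qed
  moreover have "C da_one = w" using C_mono[of "[]"] by simp
  ultimately show thesis using that C_cb by blast
qed

text \<open>Lift \<open>F\<close> to the Fock space, where the generated subspace has a wandering vector, and symmetrize.\<close>

theorem cyclic_space_multiplier_generator:
  fixes F :: "('i, 'd::finite drury_arveson) ell2"
  obtains C where "C \<in> cbounded" "\<And>k. C o\<^sub>L shift_op k = amp (shift_op k) o\<^sub>L C"
    "C da_one \<in> cyclic_space (\<lambda>k. amp (shift_op k)) F" "F \<in> cyclic_space (\<lambda>k. amp (shift_op k)) (C da_one)"
proof -
  let ?L = "\<lambda>k. amp (create k) :: ('i, 'd fock) ell2 \<Rightarrow>\<^sub>L _"
  let ?S = "\<lambda>k. amp (shift_op k) :: ('i, 'd drury_arveson) ell2 \<Rightarrow>\<^sub>L _"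
  let ?q = "amp symm :: ('i, 'd fock) ell2 \<Rightarrow>\<^sub>L _"
  obtain G where G: "?q G = F" using amp_symm_surj by blast
  obtain w where w: "w \<in> cyclic_space ?L G" "G \<in> cyclic_space ?L w"
    "\<And>u u'. u \<noteq> u' \<Longrightarrow> cinner (word_op ?L u w) (word_op ?L u' w) = 0"
    using fock.wandering_vector[of G] by blast
  have q_cb: "?q \<in> cbounded" by (simp add: amp_cbounded symm_cbounded)
  have q_L: "?q o\<^sub>L ?L k = ?S k o\<^sub>L ?q" for k
    by (simp add: symm_create flip: amp_compose)
  have q_norm: "norm (?q x) \<le> norm x" for x
    by (rule norm_amp_le[of symm 1, simplified]) (rule norm_symm_le)
  \<comment> \<open>Symmetrization is a contraction and carries the orthogonal orbit of
    \<open>w\<close> to the orbit of its image.\<close>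
  have bound: "norm (\<Sum>u\<in>U. c u *\<^sub>C word_op ?S u (?q w)) \<le> norm w * sqrt (\<Sum>u\<in>U. (cmod (c u))\<^sup>2)"
    if "finite U" for U c
  proof -
    have "word_op ?S u (?q w) = ?q (word_op ?L u w)" for u
      using blinfun_compose_eqD[OF word_op_commute[of ?q ?L ?S u, OF q_L], of w] by simp
    then have "(\<Sum>u\<in>U. c u *\<^sub>C word_op ?S u (?q w)) = ?q (\<Sum>u\<in>U. c u *\<^sub>C word_op ?L u w)"
      by (simp add: blinfun.sum_right cbounded_scaleC[OF q_cb])
    then have "norm (\<Sum>u\<in>U. c u *\<^sub>C word_op ?S u (?q w)) \<le> norm (\<Sum>u\<in>U. c u *\<^sub>C word_op ?L u w)"
      by (simp only: q_norm)
    also have "\<dots> = norm w * sqrt (\<Sum>u\<in>U. (cmod (c u))\<^sup>2)"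
      by (intro norm_sum_orthogonal that w(3) fock.norm_word)
    finally show ?thesis .
  qed
  obtain C where C: "C \<in> cbounded" "C da_one = ?q w" "\<And>k. C o\<^sub>L shift_op k = ?S k o\<^sub>L C"
  proof (rule multiplier_extension[of ?S "norm w" "?q w"])
    show "?S k \<in> cbounded" for k by (simp add: amp_cbounded shift_op_cbounded)
    show "?S i o\<^sub>L ?S j = ?S j o\<^sub>L ?S i" for i j
      by (simp add: shift_op_commute flip: amp_compose)
  qed (use bound in auto)
  have "C da_one \<in> cyclic_space ?S F"
    unfolding C(2) G[symmetric] using q_cb q_L w(1) by (rule cyclic_space_image)
  moreover have "F \<in> cyclic_space ?S (C da_one)"
    unfolding C(2) G[symmetric] using q_cb q_L w(2) by (rule cyclic_space_image)
  ultimately show thesis using that C by blast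
qed

text \<open>Each component \<open>proj i o\<^sub>L C\<close> commutes with the shifts, so it is
  itself a multiplier, and multipliers commute with one another.\<close>

lemma amp_multiplier_commute:
  assumes "C \<in> cbounded" "\<And>k. C o\<^sub>L shift_op k = amp (shift_op k) o\<^sub>L C" "A \<in> multiplier_algebra"
  shows "amp A o\<^sub>L C = C o\<^sub>L A"
proof (intro blinfun_eqI ell2_eqI)
  fix f i
  have "C (shift_op k g) = amp (shift_op k) (C g)" for k g
    using assms(2) by (rule blinfun_compose_eqD)
  then have "(proj i o\<^sub>L C) o\<^sub>L shift_op k = shift_op k o\<^sub>L (proj i o\<^sub>L C)" for k
    by (intro blinfun_eqI) (simp add: proj.rep_eq)
  then have "proj i o\<^sub>L C \<in> multiplier_algebra"
    by (simp add: multiplier_algebra_eq cbounded_compose proj_cbounded assms(1))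
  from blinfun_compose_eqD[OF multiplier_algebra_comm[OF assms(3) this], of f]
  show "coord ((amp A o\<^sub>L C) f) i = coord ((C o\<^sub>L A) f) i"
    by (simp add: proj.rep_eq)
qed

text \<open>The range of \<open>C\<close> lies in the subspace generated by \<open>F\<close> and is
  mapped into itself by \<open>amp A\<close>, which passes through \<open>C\<close>. The orbit of
  \<open>C da_one\<close> lies in that range and generates \<open>F\<close>.\<close>

lemma multiplier_cyclic_space:
  assumes "A \<in> multiplier_algebra"
  shows "amp A F \<in> cyclic_space (\<lambda>k. amp (shift_op k)) F"
proof -
  let ?S = "\<lambda>k. amp (shift_op k)"
  obtain C where C: "C \<in> cbounded" "\<And>k. C o\<^sub>L shift_op k = ?S k o\<^sub>L C"
    "C da_one \<in> cyclic_space ?S F" "F \<in> cyclic_space ?S (C da_one)"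
    using cyclic_space_multiplier_generator by blast
  have S_cb: "?S k \<in> cbounded" for k by (simp add: amp_cbounded shift_op_cbounded)
  have sub: "cyclic_space ?S (C da_one) \<subseteq> cyclic_space ?S F"
    using C(3) by (intro cyclic_space_minimal csubspace_cyclic_space closed_cyclic_space
        cyclic_space_invariant S_cb)
  have range_C: "C f \<in> cyclic_space ?S F" for f
    using cyclic_space_image[of C shift_op ?S f da_one] C(1,2) cyclic_one sub by blast
  have "cyclic_space ?S (C da_one) \<subseteq> {x. amp A x \<in> cyclic_space ?S F}"
    unfolding cyclic_space_def[of ?S "C da_one"]
  proof (rule cclosed_span_minimal)
    have "amp A (word_op ?S u (C da_one)) \<in> cyclic_space ?S F" for u
    proof -
      have "word_op ?S u (C da_one) = C (word_op shift_op u da_one)"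
        using blinfun_compose_eqD[OF word_op_commute[of C shift_op ?S u, OF C(2)], of da_one] by simp
      moreover have "amp A (C f) = C (A f)" for f
        by (rule blinfun_compose_eqD[OF amp_multiplier_commute[OF C(1,2) assms]])
      ultimately show ?thesis using range_C by simp
    qed
    then show "range (\<lambda>u. word_op ?S u (C da_one)) \<subseteq> {x. amp A x \<in> cyclic_space ?S F}" by blast
  qed (auto intro!: csubspace_vimage closed_vimage_blinfun amp_cbounded multiplier_cbounded assms
      csubspace_cyclic_space closed_cyclic_space)
  with C(4) show ?thesis by blast
qed

section \<open>Cholesky decomposition of a positive form\<close>

locale pos_form =
  fixes q :: "'h::chilbert_space \<Rightarrow> 'h \<Rightarrow> complex"
  assumes add_left: "q (x + y) z = q x z + q y z"
    and scale_left: "q (c *\<^sub>C x) z = c * q x z"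
    and herm: "q x y = cnj (q y x)"
    and nonneg: "Re (q x x) \<ge> 0"
begin

lemma add_right: "q z (x + y) = q z x + q z y"
  using herm[of z "x + y"] herm[of z x] herm[of z y] by (simp add: add_left)

lemma scale_right: "q z (c *\<^sub>C x) = cnj c * q z x"
  using herm[of z "c *\<^sub>C x"] herm[of z x] by (simp add: scale_left)

lemma real_self: "q x x = of_real (Re (q x x))"
  using herm[of x x] by (metis Reals_cnj_iff complex_is_Real_iff of_real_Re)

lemma quadratic:
  "q (x + c *\<^sub>C y) (x + c *\<^sub>C y) = q x x + cnj c * q x y + c * q y x + c * cnj c * q y y"
  by (simp add: add_left add_right scale_left scale_right algebra_simps)

lemma parallelogram_le: "Re (q (x + y) (x + y)) \<le> 2 * Re (q x x) + 2 * Re (q y y)"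
proof -
  have "0 \<le> Re (q (x + (-1) *\<^sub>C y) (x + (-1) *\<^sub>C y))" by (rule nonneg)
  also have "\<dots> = Re (q x x) - Re (q x y) - Re (q y x) + Re (q y y)"
    unfolding quadratic by simp
  finally show ?thesis by (simp add: add_left add_right)
qed

text \<open>Subtracting a rank-one form makes \<open>g\<close> a null vector (division by zero covers the case that
  it is one already).\<close>

definition deflate :: "'h \<Rightarrow> 'h \<Rightarrow> 'h \<Rightarrow> complex" where
  "deflate g x y = q x y - q x g * q g y / q g g"

lemma deflate_self:
  "deflate g x x = q x x - of_real ((cmod (q x g))\<^sup>2 / Re (q g g))"
proof -
  have "q x g * q g x = of_real ((cmod (q x g))\<^sup>2)"
    using herm[of g x] by (simp flip: complex_norm_square)
  then show ?thesis using real_self[of g] by (metis deflate_def of_real_divide)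
qed

lemma deflate_pos_form: "pos_form (deflate g)"
proof
  fix x y z c
  show "deflate g (x + y) z = deflate g x z + deflate g y z"
    by (simp add: deflate_def add_left add_divide_distrib ring_distribs)
  show "deflate g (c *\<^sub>C x) z = c * deflate g x z"
    by (simp add: deflate_def scale_left right_diff_distrib)
  have "cnj (q g g) = q g g" by (rule herm[symmetric])
  then show "deflate g x y = cnj (deflate g y x)"
    using herm[of x y] herm[of x g] herm[of g y] by (simp add: deflate_def mult.commute)
  define a where "a = Re (q g g)"
  \<comment> \<open>Completing the square: k minimizes the form at x - k g, and its value there is
    the deflated form. If a = 0, division by zero makes k = 0 and the equality persists.\<close>
  define k where "k = q x g / of_real a"
  have a: "q g g = of_real a" using real_self[of g] by (simp add: a_def)
  have "0 \<le> Re (q (x + (- k) *\<^sub>C g) (x + (- k) *\<^sub>C g))" by (rule nonneg)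
  also have "q (x + (- k) *\<^sub>C g) (x + (- k) *\<^sub>C g)
      = q x x - cnj k * q x g - k * q g x + k * cnj k * q g g"
    unfolding quadratic by simp
  also have "\<dots> = deflate g x x"
  proof (cases "a = 0")
    case True
    then show ?thesis by (simp add: k_def deflate_def a)
  next
    case False
    have gx: "q g x = cnj (q x g)" by (rule herm)
    show ?thesis using False by (simp add: k_def deflate_def a gx field_simps)
  qed
  finally show "0 \<le> Re (deflate g x x)" .
qed

end

text \<open>Applied to the defect form, this replaces the square root of the defect operator and an
  orthonormal basis of its range.\<close>

theorem Cholesky:
  fixes q :: "'h::chilbert_space \<Rightarrow> 'h \<Rightarrow> complex" and g :: "nat \<Rightarrow> 'h"
  assumes "pos_form q" and bound: "\<And>x. Re (q x x) \<le> (norm x)\<^sup>2"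
    and dense: "cclosed_span (range g) = UNIV"
  obtains e :: "nat \<Rightarrow> 'h \<Rightarrow> complex"
  where "\<And>n x y. e n (x + y) = e n x + e n y" "\<And>n c x. e n (c *\<^sub>C x) = c * e n x"
    "\<And>x. (\<lambda>n. (cmod (e n x))\<^sup>2) sums Re (q x x)"
proof -
  define Q where "Q = rec_nat q (\<lambda>n p. pos_form.deflate p (g n))"
  have Q_0: "Q 0 = q" and Q_Suc: "Q (Suc n) = pos_form.deflate (Q n) (g n)" for n
    by (simp_all add: Q_def)
  have pf: "pos_form (Q n)" for n
    by (induction n) (simp_all add: Q_0 Q_Suc assms(1) pos_form.deflate_pos_form)
  \<comment> \<open>The functional whose squared modulus is the rank-one form removed at step n. If
    \<open>g n\<close> is already null, both are 0 because division by zero gives 0.\<close>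
  define e where "e n x = Q n x (g n) / of_real (sqrt (Re (Q n (g n) (g n))))" for n x
  have step: "Re (Q (Suc n) x x) = Re (Q n x x) - (cmod (e n x))\<^sup>2" for n x
    using pos_form.nonneg[OF pf, of n "g n"]
    by (simp add: Q_Suc pos_form.deflate_self[OF pf] e_def norm_divide power_divide)
  have anti: "Re (Q m x x) \<le> Re (Q n x x)" if "n \<le> m" for m n x
    using that by (induction m rule: dec_induct) (auto simp: step intro: order_trans[rotated])
  have null: "Re (Q m (g n) (g n)) = 0" if "m > n" for m n
  proof -
    have "Re (Q (Suc n) (g n) (g n)) = 0"
    proof -
      have "Q n (g n) (g n) = of_real (Re (Q n (g n) (g n)))" by (rule pos_form.real_self[OF pf])
      then show ?thesis
        by (simp add: Q_Suc pos_form.deflate_def[OF pf])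
    qed
    then show ?thesis
      using anti[of "Suc n" m "g n"] that pos_form.nonneg[OF pf, of m "g n"] by simp
  qed
  \<comment> \<open>Vectors on which the forms eventually vanish. The parallelogram inequality makes
    them a subspace; it contains every \<open>g n\<close> and is therefore dense.\<close>
  define Z where "Z = {x. \<exists>N. \<forall>m\<ge>N. Re (Q m x x) = 0}"
  have "csubspace Z"
  proof (rule complex_vector.subspaceI)
    have "Q m 0 0 = 0" for m using pos_form.scale_left[OF pf, of m 0 0 0] by simp
    then show "0 \<in> Z" by (simp add: Z_def)
    show "c *\<^sub>C x \<in> Z" if "x \<in> Z" for c x
    proof -
      have "Re (Q m (c *\<^sub>C x) (c *\<^sub>C x)) = (cmod c)\<^sup>2 * Re (Q m x x)" for m
      proof -
        have "Q m (c *\<^sub>C x) (c *\<^sub>C x) = (c * cnj c) * Q m x x"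
          by (simp add: pos_form.scale_left[OF pf] pos_form.scale_right[OF pf])
        also have "c * cnj c = of_real ((cmod c)\<^sup>2)" by (simp flip: complex_norm_square)
        finally show ?thesis by simp
      qed
      then show ?thesis using that by (auto simp: Z_def)
    qed
    show "x + y \<in> Z" if "x \<in> Z" "y \<in> Z" for x y
    proof -
      obtain M N where "\<And>m. m \<ge> M \<Longrightarrow> Re (Q m x x) = 0" "\<And>m. m \<ge> N \<Longrightarrow> Re (Q m y y) = 0"
        using \<open>x \<in> Z\<close> \<open>y \<in> Z\<close> by (auto simp: Z_def)
      then have "Re (Q m (x + y) (x + y)) = 0" if "m \<ge> max M N" for m
        using pos_form.parallelogram_le[OF pf, of m x y] pos_form.nonneg[OF pf, of m "x + y"] that
        by simp
      then show ?thesis unfolding Z_def by blast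
    qed
  qed
  moreover have "g n \<in> Z" for n
    unfolding Z_def using null by (intro CollectI exI[of _ "Suc n"]) simp
  then have "range g \<subseteq> Z" by blast
  ultimately have "cspan (range g) \<subseteq> Z" by (rule complex_vector.span_minimal[rotated])
  then have closure_Z: "closure Z = UNIV"
    using dense closure_mono by blast
  \<comment> \<open>The forms decrease and stay below the squared norm, so eventual vanishing on a
    dense set becomes convergence to 0 everywhere.\<close>
  have lim: "(\<lambda>m. Re (Q m x x)) \<longlonglongrightarrow> 0" for x
  proof (rule LIMSEQ_I)
    fix r :: real assume "r > 0"
    then have "sqrt (r / 2) > 0" by simp
    moreover have "x \<in> closure Z" by (simp add: closure_Z)
    ultimately obtain y where y: "y \<in> Z" "dist y x < sqrt (r / 2)"
      unfolding closure_approachable by blast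
    obtain N where N: "\<And>m. m \<ge> N \<Longrightarrow> Re (Q m y y) = 0" using y(1) by (auto simp: Z_def)
    have "norm (Re (Q m x x) - 0) < r" if "m \<ge> N" for m
    proof -
      have "Re (Q m x x) \<le> 2 * Re (Q m (x - y) (x - y)) + 2 * Re (Q m y y)"
        using pos_form.parallelogram_le[OF pf, of m "x - y" y] by simp
      also have "\<dots> \<le> 2 * (norm (x - y))\<^sup>2"
        using N[OF that] anti[of 0 m "x - y"] bound[of "x - y"] by (simp add: Q_0)
      also have "\<dots> < 2 * (sqrt (r / 2))\<^sup>2"
        using y(2) by (intro mult_strict_left_mono power_strict_mono) (auto simp: dist_norm norm_minus_commute)
      finally show ?thesis using pos_form.nonneg[OF pf, of m x] \<open>r > 0\<close> by simp
    qed
    then show "\<exists>N. \<forall>m\<ge>N. norm (Re (Q m x x) - 0) < r" by blast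
  qed
  have "e n (x + y) = e n x + e n y" for n x y
    by (simp add: e_def pos_form.add_left[OF pf] add_divide_distrib)
  moreover have "e n (c *\<^sub>C x) = c * e n x" for n c x
    by (simp add: e_def pos_form.scale_left[OF pf])
  moreover have "(\<lambda>n. (cmod (e n x))\<^sup>2) sums Re (q x x)" for x
    using telescope_sums'[OF lim, of x] by (simp add: step Q_0)
  ultimately show thesis using that by blast
qed

lemma blinfun_compose_id: "A o\<^sub>L id_blinfun = A"
  by (rule blinfun_eqI) simp

section \<open>The Poisson kernel of a pure commuting row contraction\<close>

text \<open>Nonnegativity supplies the summability over the whole set that
  \<open>has_sum_fibres\<close> starts from.\<close>

lemma has_sum_fibresI:
  fixes f :: "'a \<Rightarrow> real"
  assumes "\<And>x. f x \<ge> 0" "\<And>a. (f has_sum g a) {x. p x = a}" "(g has_sum S) UNIV"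
  shows "(f has_sum S) UNIV"
proof -
  let ?h = "\<lambda>x. (p x, x)"
  have eq: "?h ` UNIV = Sigma UNIV (\<lambda>a. {x. p x = a})" by auto
  have "(f \<circ> snd) summable_on Sigma UNIV (\<lambda>a. {x. p x = a})"
    using assms by (intro summable_on_SigmaI[where g = g]) (auto simp: summable_on_def)
  then have "(f \<circ> snd has_sum S) (Sigma UNIV (\<lambda>a. {x. p x = a}))"
    using assms by (intro has_sum_SigmaI[where g = g]) auto
  then have "(f \<circ> snd has_sum S) (?h ` UNIV)" by (simp only: eq)
  then show ?thesis by (subst (asm) has_sum_reindex) (auto simp: inj_on_def o_def)
qed

lemma countable_words: "countable (UNIV :: 'd::finite list set)"
  using countable_lists[OF countable_finite[OF finite[of "UNIV :: 'd set"]]] by simp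

lemma coeff_hadjoint_shift:
  "coeff_da (hadjoint (shift_op k) g) \<alpha> = of_real (da_weight (incr k \<alpha>)) * coeff_da g (incr k \<alpha>) / of_real (da_weight \<alpha>)"
proof -
  have "of_real (da_weight \<alpha>) * coeff_da (hadjoint (shift_op k) g) \<alpha>
      = of_real (da_weight (incr k \<alpha>)) * coeff_da g (incr k \<alpha>)"
    by (simp add: hadjoint' shift_op_cbounded shift_op_mono flip: cinner_mono)
  then show ?thesis using da_weight_pos[of \<alpha>] by (simp add: field_simps)
qed

text \<open>\<open>K\<close> is the isometric Poisson kernel and \<open>X\<close> its adjoint, a
  coisometry. Once it is constructed, the argument sees \<open>T\<close> only through these
  properties and a cyclic vector.\<close>

locale poisson_model =
  fixes T :: "'d::finite \<Rightarrow> 'h::chilbert_space \<Rightarrow>\<^sub>L 'h"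
    and X :: "(nat, 'd drury_arveson) ell2 \<Rightarrow>\<^sub>L 'h" and K :: "'h \<Rightarrow>\<^sub>L (nat, 'd drury_arveson) ell2"
  assumes T_cbounded: "T k \<in> cbounded"
    and X_cbounded: "X \<in> cbounded" and K_cbounded: "K \<in> cbounded" and X_K: "X o\<^sub>L K = id_blinfun"
    and X_shift: "X o\<^sub>L amp (shift_op k) = T k o\<^sub>L X"
    and norm_X: "norm (X f) \<le> norm f" and norm_K: "norm (K x) = norm x"
    and X_adj: "cinner (X f) y = cinner f (K y)"

locale cyclic_row_contraction =
  fixes T :: "'d::finite \<Rightarrow> 'h::chilbert_space \<Rightarrow>\<^sub>L 'h" and \<xi> :: 'h
  assumes row: "row_contraction T" and comm: "commuting_tuple T" and pure: "pure_tuple T"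
    and cyclic: "cyclic_vector T \<xi>"
begin

lemma T_cbounded: "T k \<in> cbounded"
  using row by (simp add: row_contraction_def)

lemma T_commute: "T i o\<^sub>L T j = T j o\<^sub>L T i"
  using comm by (simp add: commuting_tuple_def)

lemma word_cbounded: "word_op T u \<in> cbounded"
  by (simp add: word_op_cbounded T_cbounded)

definition defect :: "'h \<Rightarrow> 'h \<Rightarrow> complex" where
  "defect x y = cinner x y - (\<Sum>k\<in>UNIV. cinner (hadjoint (T k) x) (hadjoint (T k) y))"

lemma defect_self: "defect x x = of_real ((norm x)\<^sup>2 - (\<Sum>k\<in>UNIV. (norm (hadjoint (T k) x))\<^sup>2))"
  by (simp add: defect_def cinner_self)

lemma pos_form_defect: "pos_form defect"
proof
  fix x y z :: 'h and c :: complex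
  show "defect (x + y) z = defect x z + defect y z"
    by (simp add: defect_def cinner_add_left blinfun.add_right sum.distrib)
  show "defect (c *\<^sub>C x) z = c * defect x z"
    by (simp add: defect_def cinner_scaleC_left cbounded_scaleC hadjoint_cbounded T_cbounded
        right_diff_distrib sum_distrib_left)
  have "cnj (cinner y x) = cinner x y" for x y :: 'h by (simp flip: cinner_commute)
  then show "defect x y = cnj (defect y x)" by (simp add: defect_def)
  have "defect x x = cinner ((id_blinfun - (\<Sum>k\<in>UNIV. T k o\<^sub>L hadjoint (T k))) x) x"
    by (simp add: defect_def blinfun.diff_left blinfun.sum_left cinner.diff_left cinner.sum_left
        hadjoint T_cbounded)
  also have "\<dots> \<in> \<real>\<^sub>\<ge>\<^sub>0"
    using row by (auto simp: row_contraction_def positive_op_def)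
  finally show "0 \<le> Re (defect x x)" by (simp add: complex_nonneg_Reals_iff)
qed

text \<open>The quadratic form of the m-th iterate, applied to the identity, of the map A -> sum_k
  T_k A T_k^*. Purity says that it tends to 0.\<close>

definition level :: "'h \<Rightarrow> nat \<Rightarrow> real" where
  "level x m = (\<Sum>u | length u = m. (norm (hadjoint (word_op T u) x))\<^sup>2)"

lemma sum_defect_level:
  "(\<Sum>u | length u = m. Re (defect (hadjoint (word_op T u) x) (hadjoint (word_op T u) x)))
    = level x m - level x (Suc m)"
proof -
  \<comment> \<open>The adjoint reverses products and so puts \<open>k\<close> at the end of the
    word; commutativity moves it to the front, where \<open>sum_words_Suc\<close> splits off a
    letter.\<close>
  have *: "hadjoint (T k) (hadjoint (word_op T u) x) = hadjoint (word_op T (k # u)) x" for k u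
  proof -
    have "word_op T (u @ [k]) = word_op T (k # u)"
      by (rule word_op_content[OF T_commute]) (simp only: content_append_single content_Cons)
    moreover have "hadjoint (word_op T (u @ [k])) = hadjoint (T k) o\<^sub>L hadjoint (word_op T u)"
      using hadjoint_compose[OF word_cbounded[of u] T_cbounded[of k]]
      by (simp add: word_op_append blinfun_compose_id)
    ultimately show ?thesis by simp
  qed
  have "(\<Sum>u | length u = m. Re (defect (hadjoint (word_op T u) x) (hadjoint (word_op T u) x)))
      = level x m - (\<Sum>u | length u = m. \<Sum>k\<in>UNIV. (norm (hadjoint (word_op T (k # u)) x))\<^sup>2)"
    by (simp only: defect_self Re_complex_of_real * sum_subtractf level_def)
  then show ?thesis
    by (simp only: level_def sum_words_Suc sum.swap[of _ UNIV])
qed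

text \<open>The levels telescope from \<open>level x 0\<close>, the squared norm, down to the limit
  0 given by purity. This identity makes the Poisson kernel isometric.\<close>

lemma has_sum_defect:
  "((\<lambda>u. Re (defect (hadjoint (word_op T u) x) (hadjoint (word_op T u) x))) has_sum (norm x)\<^sup>2) UNIV"
proof (rule has_sum_fibresI[where p = length])
  let ?g = "\<lambda>m. level x m - level x (Suc m)"
  have nonneg: "0 \<le> Re (defect y y)" for y
    by (rule pos_form.nonneg[OF pos_form_defect])
  then show "0 \<le> Re (defect (hadjoint (word_op T u) x) (hadjoint (word_op T u) x))" for u .
  show "((\<lambda>u. Re (defect (hadjoint (word_op T u) x) (hadjoint (word_op T u) x))) has_sum ?g m) {u. length u = m}" for m
    by (rule has_sum_finiteI[OF finite_words]) (rule sum_defect_level[symmetric])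
  have "level x \<longlonglongrightarrow> 0"
    using pure unfolding pure_tuple_def level_def[abs_def] by blast
  from telescope_sums'[OF this] have "?g sums (norm x)\<^sup>2"
    by (simp add: level_def hadjoint_id)
  moreover have "?g m \<ge> 0" for m
    unfolding sum_defect_level[symmetric] by (intro sum_nonneg nonneg)
  ultimately show "(?g has_sum (norm x)\<^sup>2) UNIV"
    by (rule sums_nonneg_imp_has_sum)
qed

theorem poisson:
  obtains X K where "poisson_model T X K"
proof -
  \<comment> \<open>A cyclic vector makes the space separable: its countable orbit, enumerated by
    the naturals, has dense span and can be fed to \<open>Cholesky\<close>.\<close>
  define g where "g n = word_op T (from_nat_into UNIV n) \<xi>" for n
  have "range g = (\<lambda>u. word_op T u \<xi>) ` range (from_nat_into UNIV)"
    by (simp only: g_def[abs_def] image_image)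
  also have "range (from_nat_into UNIV) = (UNIV :: 'd list set)"
    by (rule range_from_nat_into[OF UNIV_not_empty countable_words])
  finally have "range g = range (\<lambda>u. word_op T u \<xi>)" .
  then have dense: "cclosed_span (range g) = UNIV"
    using cyclic by (simp add: cyclic_vector_def)
  have bound: "Re (defect x x) \<le> (norm x)\<^sup>2" for x
    unfolding defect_self Re_complex_of_real by (simp add: sum_nonneg)
  obtain e :: "nat \<Rightarrow> 'h \<Rightarrow> complex" where e: "\<And>n x y. e n (x + y) = e n x + e n y"
    "\<And>n c x. e n (c *\<^sub>C x) = c * e n x" "\<And>x. (\<lambda>n. (cmod (e n x))\<^sup>2) sums Re (defect x x)"
    by (rule Cholesky[OF pos_form_defect bound dense], rule that)
  \<comment> \<open>\<open>e n\<close> stands in for the n-th coordinate of the square root of the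
    defect operator, so these are the components of the Poisson kernel, indexed by words.\<close>
  define a where "a n u x = e n (hadjoint (word_op T u) x)" for n u x
  have a_content: "a n u x = a n v x" if "word_content u = word_content v" for n u v x
    using word_op_content[OF T_commute that] by (simp add: a_def)
  have a_add: "a n u (x + y) = a n u x + a n u y" for n u x y
    by (simp add: a_def blinfun.add_right e)
  have a_scale: "a n u (c *\<^sub>C x) = c * a n u x" for n u x c
    by (simp add: a_def cbounded_scaleC hadjoint_cbounded word_cbounded e)
  have "((\<lambda>(u, n). (cmod (a n u x))\<^sup>2) has_sum (norm x)\<^sup>2) (UNIV \<times> UNIV)" for x
  proof -
    have inner: "((\<lambda>n. (cmod (a n u x))\<^sup>2) has_sum
        Re (defect (hadjoint (word_op T u) x) (hadjoint (word_op T u) x))) UNIV" for u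
      unfolding a_def by (intro sums_nonneg_imp_has_sum e) simp
    have "(\<lambda>(u, n). (cmod (a n u x))\<^sup>2) summable_on (UNIV \<times> UNIV)"
      by (rule summable_on_SigmaI[OF _ has_sum_imp_summable[OF has_sum_defect]]) (use inner in auto)
    then show ?thesis
      by (intro has_sum_SigmaI[OF _ has_sum_defect]) (use inner in auto)
  qed
  then have a_sum: "((\<lambda>(n, u). (cmod (a n u x))\<^sup>2) has_sum (norm x)\<^sup>2) (UNIV \<times> UNIV)" for x
    by (subst has_sum_swap) (simp add: case_prod_unfold)
  \<comment> \<open>Division by the weight accounts for the 1 / \<open>da_weight \<alpha>\<close>
    words of content \<alpha>: the weighted square of this coefficient is the sum of |a|^2 over all
    of them.\<close>
  define c where "c n x \<alpha> = a n (word_of \<alpha>) x / of_real (da_weight \<alpha>)" for n x \<alpha>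
  define s where "s n x = (\<Sum>\<^sub>\<infinity>u. (cmod (a n u x))\<^sup>2)" for n x
  have s: "((\<lambda>u. (cmod (a n u x))\<^sup>2) has_sum s n x) UNIV" for n x
  proof -
    have "(\<lambda>u. (cmod (a n u x))\<^sup>2) summable_on UNIV"
      using summable_on_SigmaD1[of "\<lambda>n u. (cmod (a n u x))\<^sup>2" UNIV "\<lambda>_. UNIV" n]
        has_sum_imp_summable[OF a_sum, of x] by simp
    then show ?thesis by (simp add: s_def)
  qed
  have s_sum: "((\<lambda>n. s n x) has_sum (norm x)\<^sup>2) UNIV" for x
    by (rule has_sum_SigmaD[OF a_sum]) (simp add: s)
  have c_sum: "((\<lambda>\<alpha>. da_weight \<alpha> * (cmod (c n x \<alpha>))\<^sup>2) has_sum s n x) UNIV" for n x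
  proof -
    have "da_weight \<alpha> * (cmod (c n x \<alpha>))\<^sup>2 = (\<Sum>\<^sub>\<infinity>u\<in>{u\<in>UNIV. word_content u = \<alpha>}. (cmod (a n u x))\<^sup>2)" for \<alpha>
    proof -
      have word_of: "a n u x = a n (word_of (word_content u)) x" for u
        by (rule a_content) simp
      have "(\<Sum>\<^sub>\<infinity>u\<in>{u\<in>UNIV. word_content u = \<alpha>}. (cmod (a n u x))\<^sup>2)
          = (\<Sum>u | word_content u = \<alpha>. (cmod (a n u x))\<^sup>2)"
        by (simp add: content_fibre(1))
      also have "\<dots> = (\<Sum>u | word_content u = \<alpha>. (cmod (a n (word_of (word_content u)) x))\<^sup>2)"
        by (subst word_of) (rule refl)
      also have "\<dots> = (cmod (a n (word_of \<alpha>) x))\<^sup>2 / da_weight \<alpha>"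
        by (rule sum_content_fibre_real)
      finally show ?thesis
        using da_weight_pos[of \<alpha>] by (simp add: c_def norm_divide power_divide power2_eq_square)
    qed
    then show ?thesis using has_sum_fibres[OF s[of n x], where p = word_content] by simp
  qed
  define k where "k n x = Abs_drury_arveson (c n x)" for n x
  have "da_summable (c n x)" for n x
    unfolding da_summable_def by (rule has_sum_imp_summable[OF c_sum])
  then have coeff_k: "coeff_da (k n x) = c n x" for n x
    by (simp add: k_def coeff_Abs)
  have norm_k: "(norm (k n x))\<^sup>2 = s n x" for n x
    using norm_da_sq[of "k n x"] unfolding coeff_k by (rule has_sum_unique[OF _ c_sum])
  have "sq_summable (\<lambda>n. k n x)" for x
    unfolding sq_summable_def norm_k by (rule has_sum_imp_summable[OF s_sum])
  define K0 where "K0 x = Abs_ell2 (\<lambda>n. k n x)" for x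
  have coord_K0: "coord (K0 x) n = k n x" for n x
    by (simp add: K0_def coord_Abs_ell2 \<open>sq_summable (\<lambda>n. k n x)\<close>)
  have norm_K0: "norm (K0 x) = norm x" for x
  proof -
    have "(norm (K0 x))\<^sup>2 = (norm x)\<^sup>2"
      using has_sum_norm_ell2[of "K0 x"] unfolding coord_K0 norm_k by (rule has_sum_unique[OF _ s_sum])
    then show ?thesis by (simp only: power2_eq_iff_nonneg norm_ge_zero)
  qed
  have K0_add: "K0 (x + y) = K0 x + K0 y" for x y
    by (intro ell2_eqI da_eqI)
      (simp add: coord_K0 coord_add coeff_add coeff_k c_def a_add add_divide_distrib)
  have K0_scale: "K0 (r *\<^sub>C x) = r *\<^sub>C K0 x" for r x
    by (intro ell2_eqI da_eqI) (simp add: coord_K0 coord_scaleC coeff_scaleC coeff_k c_def a_scale)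
  have bl: "bounded_linear K0"
    by (rule bounded_linear_intro[where K = 1]) (auto simp: K0_add norm_K0 K0_scale simp flip: scaleC_of_real)
  define K where "K = Blinfun K0"
  have K: "blinfun_apply K = K0" by (simp add: K_def bounded_linear_Blinfun_apply[OF bl])
  have K_cb: "K \<in> cbounded" by (intro cboundedI) (simp add: K K0_scale)
  define X where "X = hadjoint K"
  have X_cb: "X \<in> cbounded" by (simp add: X_def hadjoint_cbounded K_cb)
  have X_K: "cinner (X f) y = cinner f (K y)" for f y
    by (simp add: X_def hadjoint' K_cb)
  have norm_X: "norm (X f) \<le> norm f" for f
    using norm_hadjoint_le[OF K_cb, of 1 f] by (simp add: X_def K norm_K0)
  have XK_id: "X o\<^sub>L K = id_blinfun"
  proof (rule blinfun_eqI)
    fix x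
    have "inner (X (K x)) x = (norm x)\<^sup>2"
      by (simp add: X_K cinner_self K norm_K0 flip: Re_cinner)
    \<comment> \<open>Expanding the square, the cross term is known because \<open>K\<close> is
      isometric, and contractivity of \<open>X\<close> leaves nothing.\<close>
    then have "(norm (X (K x) - x))\<^sup>2 = (norm (X (K x)))\<^sup>2 - (norm x)\<^sup>2"
      unfolding power2_norm_eq_inner by (simp add: inner_diff_left inner_diff_right inner_commute)
    also have "\<dots> \<le> 0"
      using power_mono[OF norm_X[of "K x"] norm_ge_zero, of 2] by (simp add: K norm_K0)
    finally show "(X o\<^sub>L K) x = id_blinfun x" by simp
  qed
  have X_shift: "X o\<^sub>L amp (shift_op j) = T j o\<^sub>L X" for j
  proof (rule blinfun_eqI, rule cinner_ext)
    fix f y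
    \<comment> \<open>The claim in adjoint form: \<open>K\<close> intertwines T_j^* with the
      ampliated backward shift. The weights from \<open>coeff_hadjoint_shift\<close> and from
      \<open>c\<close> cancel.\<close>
    have "amp (hadjoint (shift_op j)) (K y) = K (hadjoint (T j) y)"
    proof (intro ell2_eqI da_eqI)
      fix n \<alpha>
      have "a n (word_of (incr j \<alpha>)) y = a n (j # word_of \<alpha>) y"
        by (rule a_content) simp
      also have "\<dots> = a n (word_of \<alpha>) (hadjoint (T j) y)"
        by (simp add: a_def hadjoint_compose T_cbounded word_cbounded)
      finally have "c n y (incr j \<alpha>) * of_real (da_weight (incr j \<alpha>)) = a n (word_of \<alpha>) (hadjoint (T j) y)"
        using da_weight_pos[of "incr j \<alpha>"] by (simp add: c_def)
      then show "coeff_da (coord (amp (hadjoint (shift_op j)) (K y)) n) \<alpha>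
          = coeff_da (coord (K (hadjoint (T j) y)) n) \<alpha>"
        unfolding coord_amp K coord_K0 coeff_hadjoint_shift coeff_k
        by (simp only: c_def[of n "hadjoint (T j) y"] mult.commute)
    qed
    moreover have "cinner (amp (shift_op j) f) (K y) = cinner f (amp (hadjoint (shift_op j)) (K y))"
      by (rule amp_adjoint) (rule hadjoint[OF shift_op_cbounded])
    ultimately show "cinner ((X o\<^sub>L amp (shift_op j)) f) y = cinner ((T j o\<^sub>L X) f) y"
      by (simp only: blinfun_apply_blinfun_compose X_K hadjoint[OF T_cbounded])
  qed
  have "norm (K x) = norm x" for x by (simp add: K norm_K0)
  from that poisson_model.intro[OF T_cbounded X_cb K_cb XK_id X_shift norm_X this X_K]
  show thesis .
qed

end

section \<open>Matrix norms and the weak-* topology\<close>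

text \<open>\<open>matrix_op_norm\<close> is a real supremum, so it bounds nothing until its set is
  known to be bounded above. A crude entrywise estimate settles that, and rescaling to the unit ball
  gives the second claim.\<close>

lemma matrix_op_norm_props:
  fixes A :: "nat \<Rightarrow> nat \<Rightarrow> 'a::chilbert_space \<Rightarrow>\<^sub>L 'a"
  shows matrix_op_norm_nonneg: "0 \<le> matrix_op_norm n A"
    and matrix_op_norm_bound:
      "(\<Sum>i<n. (norm (\<Sum>j<n. A i j (y j)))\<^sup>2) \<le> (matrix_op_norm n A)\<^sup>2 * (\<Sum>j<n. (norm (y j))\<^sup>2)"
proof -
  let ?U = "{x. (\<Sum>j<n. (norm (x j))\<^sup>2) \<le> 1} :: (nat \<Rightarrow> 'a) set"
  define g where "g x = (\<Sum>i<n. (norm (\<Sum>j<n. A i j (x j)))\<^sup>2)" for x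
  have g_nonneg: "g x \<ge> 0" for x by (simp add: g_def sum_nonneg)
  have bdd: "bdd_above ((\<lambda>x. sqrt (g x)) ` ?U)"
  proof (rule bdd_aboveI2)
    fix x :: "nat \<Rightarrow> 'a" assume x: "x \<in> ?U"
    have xj: "norm (x j) \<le> 1" if "j < n" for j
    proof -
      have "(norm (x j))\<^sup>2 \<le> (\<Sum>j<n. (norm (x j))\<^sup>2)"
        using that by (intro member_le_sum) auto
      then have "(norm (x j))\<^sup>2 \<le> 1\<^sup>2" using x by simp
      then show ?thesis by (rule power2_le_imp_le) simp
    qed
    have "norm (\<Sum>j<n. A i j (x j)) \<le> (\<Sum>j<n. norm (A i j))" for i
    proof (rule sum_norm_le)
      fix j assume "j \<in> {..<n}"
      then show "norm (A i j (x j)) \<le> norm (A i j)"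
        using norm_blinfun[of "A i j" "x j"] mult_left_mono[OF xj, of j "norm (A i j)"] by simp
    qed
    then show "sqrt (g x) \<le> sqrt (\<Sum>i<n. (\<Sum>j<n. norm (A i j))\<^sup>2)"
      unfolding g_def by (intro real_sqrt_le_mono sum_mono power_mono) auto
  qed
  have m: "matrix_op_norm n A = (SUP x\<in>?U. sqrt (g x))"
    by (simp add: matrix_op_norm_def g_def)
  have upper: "sqrt (g x) \<le> matrix_op_norm n A" if "x \<in> ?U" for x
    unfolding m by (rule cSUP_upper[OF that bdd])
  have "g (\<lambda>_. 0) = 0" by (simp add: g_def)
  with upper[of "\<lambda>_. 0"] show m0: "0 \<le> matrix_op_norm n A" by simp
  define s where "s = (\<Sum>j<n. (norm (y j))\<^sup>2)"
  have "g y \<le> (matrix_op_norm n A)\<^sup>2 * s"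
  proof (cases "s = 0")
    case True
    then have "\<forall>j<n. y j = 0"
      unfolding s_def by (subst (asm) sum_nonneg_eq_0_iff) auto
    then have "g y = 0" by (simp add: g_def)
    then show ?thesis using True by simp
  next
    case False
    then have "s > 0" unfolding s_def by (simp add: less_le sum_nonneg)
    define r where "r = inverse (sqrt s)"
    have r: "r\<^sup>2 * s = 1" using \<open>s > 0\<close> by (simp add: r_def power_inverse)
    have "(\<Sum>j<n. (norm (r *\<^sub>R y j))\<^sup>2) = r\<^sup>2 * s"
      by (simp add: s_def power_mult_distrib sum_distrib_left)
    then have "sqrt (g (\<lambda>j. r *\<^sub>R y j)) \<le> matrix_op_norm n A"
      using r by (intro upper) simp
    moreover have "g (\<lambda>j. r *\<^sub>R y j) = r\<^sup>2 * g y"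
      by (simp add: g_def blinfun.scaleR_right power_mult_distrib sum_distrib_left flip: scaleR_sum_right)
    ultimately have "r\<^sup>2 * g y \<le> (matrix_op_norm n A)\<^sup>2"
      using m0 by (simp add: sqrt_le_D)
    then have "(r\<^sup>2 * g y) * s \<le> (matrix_op_norm n A)\<^sup>2 * s"
      using \<open>s > 0\<close> by (intro mult_right_mono) auto
    moreover have "(r\<^sup>2 * g y) * s = g y * (r\<^sup>2 * s)" by (simp only: mult_ac)
    ultimately show ?thesis by (simp only: r mult_1_right)
  qed
  then show "(\<Sum>i<n. (norm (\<Sum>j<n. A i j (y j)))\<^sup>2) \<le> (matrix_op_norm n A)\<^sup>2 * (\<Sum>j<n. (norm (y j))\<^sup>2)"
    by (simp only: g_def s_def)
qed

lemma matrix_op_norm_leI: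
  fixes A :: "nat \<Rightarrow> nat \<Rightarrow> 'a::chilbert_space \<Rightarrow>\<^sub>L 'a"
  assumes "\<And>x. (\<Sum>j<n. (norm (x j))\<^sup>2) \<le> 1 \<Longrightarrow> (\<Sum>i<n. (norm (\<Sum>j<n. blinfun_apply (A i j) (x j)))\<^sup>2) \<le> m\<^sup>2"
    and "m \<ge> 0"
  shows "matrix_op_norm n A \<le> m"
  unfolding matrix_op_norm_def
proof (rule cSUP_least)
  show "{x. (\<Sum>j<n. (norm (x j :: 'a))\<^sup>2) \<le> 1} \<noteq> {}"
    by (auto intro!: exI[of _ "\<lambda>_. 0"])
  show "sqrt (\<Sum>i<n. (norm (\<Sum>j<n. A i j (x j)))\<^sup>2) \<le> m" if "x \<in> {x. (\<Sum>j<n. (norm (x j))\<^sup>2) \<le> 1}" for x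
    by (rule real_le_lsqrt[OF assms(2) assms(1)]) (use that in simp)
qed

lemma has_sum_sum:
  "finite I \<Longrightarrow> (\<And>i. i \<in> I \<Longrightarrow> (f i has_sum g i) A) \<Longrightarrow>
    ((\<lambda>x. \<Sum>i\<in>I. f i x) has_sum (\<Sum>i\<in>I. g i)) (A :: 'x set)"
  for f :: "'i \<Rightarrow> 'x \<Rightarrow> real"
  by (induction I rule: finite_induct) (auto intro: has_sum_add)

text \<open>An ampliated matrix acts on each coordinate of the direct sum separately, so the bound
  holds coordinatewise and can be summed.\<close>

lemma matrix_amp_bound:
  fixes f :: "nat \<Rightarrow> ('i, 'a::chilbert_space) ell2"
  shows "(\<Sum>i<n. (norm (\<Sum>j<n. amp (A i j) (f j)))\<^sup>2) \<le> (matrix_op_norm n A)\<^sup>2 * (\<Sum>j<n. (norm (f j))\<^sup>2)"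
proof (rule has_sum_mono)
  show "((\<lambda>e. \<Sum>i<n. (norm (coord (\<Sum>j<n. amp (A i j) (f j)) e))\<^sup>2) has_sum
      (\<Sum>i<n. (norm (\<Sum>j<n. amp (A i j) (f j)))\<^sup>2)) UNIV"
    by (intro has_sum_sum has_sum_norm_ell2) simp
  show "((\<lambda>e. (matrix_op_norm n A)\<^sup>2 * (\<Sum>j<n. (norm (coord (f j) e))\<^sup>2)) has_sum
      (matrix_op_norm n A)\<^sup>2 * (\<Sum>j<n. (norm (f j))\<^sup>2)) UNIV"
    by (intro has_sum_cmult_right has_sum_sum has_sum_norm_ell2) simp
  show "(\<Sum>i<n. (norm (coord (\<Sum>j<n. amp (A i j) (f j)) e))\<^sup>2)
      \<le> (matrix_op_norm n A)\<^sup>2 * (\<Sum>j<n. (norm (coord (f j) e))\<^sup>2)" for e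
    using matrix_op_norm_bound[where n = n and A = A and y = "\<lambda>j. coord (f j) e"] by (simp add: coord_sum)
qed

section \<open>Weak-* neighbourhoods and density of the polynomials\<close>

definition weak_star_basis :: "(nat \<Rightarrow> 'a::chilbert_space) \<Rightarrow> (nat \<Rightarrow> 'a) \<Rightarrow> complex set \<Rightarrow> ('a \<Rightarrow>\<^sub>L 'a) set" where
  "weak_star_basis \<xi> \<eta> U = {A \<in> cbounded. (\<Sum>n. cinner (blinfun_apply A (\<xi> n)) (\<eta> n)) \<in> U}"

definition sq_summable_seq :: "(nat \<Rightarrow> 'a::real_normed_vector) \<Rightarrow> bool" where
  "sq_summable_seq \<xi> \<longleftrightarrow> summable (\<lambda>n. (norm (\<xi> n))\<^sup>2)"

lemma sq_summable_seq_iff: "sq_summable_seq \<xi> \<longleftrightarrow> sq_summable \<xi>"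
  unfolding sq_summable_seq_def sq_summable_def by (subst summable_on_UNIV_nonneg_real_iff) auto

lemma weak_star_eq:
  "weak_star = topology_generated_by
    {weak_star_basis \<xi> \<eta> U | \<xi> \<eta> U. sq_summable_seq \<xi> \<and> sq_summable_seq \<eta> \<and> open U}"
  unfolding weak_star_def weak_star_basis_def sq_summable_seq_def ..

lemma openin_weak_star_basis:
  "sq_summable \<xi> \<Longrightarrow> sq_summable \<eta> \<Longrightarrow> open U \<Longrightarrow> openin weak_star (weak_star_basis \<xi> \<eta> U)"
  unfolding weak_star_eq by (rule topology_generated_by_Basis) (auto simp: sq_summable_seq_iff)

lemma topspace_weak_star: "topspace weak_star = (cbounded :: ('a::chilbert_space \<Rightarrow>\<^sub>L 'a) set)"
proof -
  have "weak_star_basis (\<lambda>_. 0) (\<lambda>_. 0) UNIV = (cbounded :: ('a \<Rightarrow>\<^sub>L 'a) set)"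
    by (auto simp: weak_star_basis_def)
  moreover have "sq_summable_seq (\<lambda>_. 0 :: 'a)" by (simp add: sq_summable_seq_def)
  ultimately have "cbounded \<in> {weak_star_basis \<xi> \<eta> U | \<xi> \<eta> U.
      sq_summable_seq \<xi> \<and> sq_summable_seq (\<eta> :: nat \<Rightarrow> 'a) \<and> open U}"
    by (metis (mono_tags, lifting) mem_Collect_eq open_UNIV)
  then have "cbounded \<subseteq> topspace (weak_star :: ('a \<Rightarrow>\<^sub>L 'a) topology)"
    unfolding weak_star_eq topology_generated_by_topspace by (rule Union_upper)
  moreover have "topspace (weak_star :: ('a \<Rightarrow>\<^sub>L 'a) topology) \<subseteq> cbounded"
    unfolding weak_star_eq topology_generated_by_topspace by (auto simp: weak_star_basis_def)
  ultimately show ?thesis by blast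
qed

text \<open>A weak-* functional is thus an ordinary matrix coefficient of the infinite
  ampliation.\<close>

lemma suminf_cinner_amp:
  "(\<Sum>n. cinner (blinfun_apply A (coord \<Xi> n)) (coord H n)) = cinner (amp A \<Xi>) H"
  using has_sum_imp_sums[OF has_sum_cinner_ell2[of "amp A \<Xi>" H]] by (simp add: sums_iff)

text \<open>Placing one vector at the even positions and the other at the odd ones lets a single
  vector control the intersection of two neighbourhoods.\<close>

lemma interleave:
  fixes \<Xi>1 \<Xi>2 :: "(nat, 'a::chilbert_space) ell2"
  obtains \<Xi> :: "(nat, 'a) ell2" where "\<And>A :: 'a \<Rightarrow>\<^sub>L 'a. norm (amp A \<Xi>1) \<le> norm (amp A \<Xi>)"
    "\<And>A :: 'a \<Rightarrow>\<^sub>L 'a. norm (amp A \<Xi>2) \<le> norm (amp A \<Xi>)"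
proof -
  define x where "x m = (if even m then coord \<Xi>1 (m div 2) else coord \<Xi>2 (m div 2))" for m
  have "(\<Sum>m\<in>F. (norm (x m))\<^sup>2) \<le> (norm \<Xi>1)\<^sup>2 + (norm \<Xi>2)\<^sup>2" if "finite F" for F
  proof -
    have inj: "inj_on (\<lambda>m. m div 2) {m\<in>F. even m}" "inj_on (\<lambda>m. m div 2) {m\<in>F. odd m}"
      by (auto intro!: inj_onI elim!: evenE oddE)
    have "(\<Sum>m\<in>F. (norm (x m))\<^sup>2) = (\<Sum>m\<in>{m\<in>F. even m} \<union> {m\<in>F. odd m}. (norm (x m))\<^sup>2)"
      by (rule sum.cong) auto
    also have "\<dots> = (\<Sum>m | m \<in> F \<and> even m. (norm (x m))\<^sup>2) + (\<Sum>m | m \<in> F \<and> odd m. (norm (x m))\<^sup>2)"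
      using that by (intro sum.union_disjoint) auto
    also have "(\<Sum>m | m \<in> F \<and> even m. (norm (x m))\<^sup>2) = (\<Sum>i\<in>(\<lambda>m. m div 2) ` {m\<in>F. even m}. (norm (coord \<Xi>1 i))\<^sup>2)"
      by (simp add: sum.reindex[OF inj(1)] x_def)
    also have "(\<Sum>m | m \<in> F \<and> odd m. (norm (x m))\<^sup>2) = (\<Sum>i\<in>(\<lambda>m. m div 2) ` {m\<in>F. odd m}. (norm (coord \<Xi>2 i))\<^sup>2)"
      by (simp add: sum.reindex[OF inj(2)] x_def)
    finally show ?thesis
      using that by (simp only:) (intro add_mono ell2_finite_sum_le, auto)
  qed
  then have "sq_summable x" by (rule sq_summableI)
  then have x: "coord (Abs_ell2 x) = x" by (rule coord_Abs_ell2)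
  have "norm (amp A \<Xi>1) \<le> norm (amp A (Abs_ell2 x))" for A :: "'a \<Rightarrow>\<^sub>L 'a"
  proof (rule norm_ell2_leI)
    fix F :: "nat set" assume "finite F"
    have "(\<Sum>i\<in>F. (norm (coord (amp A \<Xi>1) i))\<^sup>2)
        = (\<Sum>m\<in>(\<lambda>i. 2 * i) ` F. (norm (coord (amp A (Abs_ell2 x)) m))\<^sup>2)"
      by (simp add: sum.reindex inj_on_def x x_def)
    also have "\<dots> \<le> (norm (amp A (Abs_ell2 x)))\<^sup>2"
      using \<open>finite F\<close> by (intro ell2_finite_sum_le) simp
    finally show "(\<Sum>i\<in>F. (norm (coord (amp A \<Xi>1) i))\<^sup>2) \<le> (norm (amp A (Abs_ell2 x)))\<^sup>2" .
  qed simp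
  moreover have "norm (amp A \<Xi>2) \<le> norm (amp A (Abs_ell2 x))" for A :: "'a \<Rightarrow>\<^sub>L 'a"
  proof (rule norm_ell2_leI)
    fix F :: "nat set" assume "finite F"
    have "(\<Sum>i\<in>F. (norm (coord (amp A \<Xi>2) i))\<^sup>2)
        = (\<Sum>m\<in>(\<lambda>i. 2 * i + 1) ` F. (norm (coord (amp A (Abs_ell2 x)) m))\<^sup>2)"
      by (simp add: sum.reindex inj_on_def x x_def)
    also have "\<dots> \<le> (norm (amp A (Abs_ell2 x)))\<^sup>2"
      using \<open>finite F\<close> by (intro ell2_finite_sum_le) simp
    finally show "(\<Sum>i\<in>F. (norm (coord (amp A \<Xi>2) i))\<^sup>2) \<le> (norm (amp A (Abs_ell2 x)))\<^sup>2" .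
  qed simp
  ultimately show thesis by (rule that)
qed

text \<open>Weak-* open sets are open for the ultrastrong topology, and interleaving reduces its
  neighbourhoods to one vector. Norm estimates at one vector are what membership in a closed orbit
  supplies.\<close>

lemma weak_star_nbhd:
  fixes W :: "('a::chilbert_space \<Rightarrow>\<^sub>L 'a) set"
  assumes "openin weak_star W" "A \<in> W"
  obtains \<Xi> :: "(nat, 'a) ell2" and \<epsilon> where "\<epsilon> > 0"
    "\<And>B. B \<in> cbounded \<Longrightarrow> norm (amp (B - A) \<Xi>) < \<epsilon> \<Longrightarrow> B \<in> W"
proof -
  let ?P = "\<lambda>W A (\<Xi> :: (nat, 'a) ell2) \<epsilon>. \<epsilon> > 0 \<and> (\<forall>B\<in>cbounded. norm (amp (B - A) \<Xi>) < \<epsilon> \<longrightarrow> B \<in> W)"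
  have "generate_topology_on {weak_star_basis \<xi> \<eta> U | \<xi> \<eta> U.
      sq_summable_seq \<xi> \<and> sq_summable_seq (\<eta> :: nat \<Rightarrow> 'a) \<and> open U} W"
    using assms(1) by (simp add: weak_star_eq openin_topology_generated_by_iff)
  then have "\<exists>\<Xi> \<epsilon>. ?P W A \<Xi> \<epsilon>"
    using assms(2)
  proof (induction W)
    case Empty
    then show ?case by simp
  next
    case (Int a b)
    then obtain \<Xi>1 \<epsilon>1 \<Xi>2 \<epsilon>2 where P: "?P a A \<Xi>1 \<epsilon>1" "?P b A \<Xi>2 \<epsilon>2" by blast
    obtain \<Xi> :: "(nat, 'a) ell2" where \<Xi>: "\<And>A :: 'a \<Rightarrow>\<^sub>L 'a. norm (amp A \<Xi>1) \<le> norm (amp A \<Xi>)"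
      "\<And>A :: 'a \<Rightarrow>\<^sub>L 'a. norm (amp A \<Xi>2) \<le> norm (amp A \<Xi>)"
      by (rule interleave[of \<Xi>1 \<Xi>2], rule that)
    have "?P (a \<inter> b) A \<Xi> (min \<epsilon>1 \<epsilon>2)"
      using P le_less_trans[OF \<Xi>(1)] le_less_trans[OF \<Xi>(2)] by auto
    then show ?case by blast
  next
    case (UN K)
    then show ?case by blast
  next
    case (Basis s)
    then obtain \<xi> \<eta> U where s: "s = weak_star_basis \<xi> \<eta> U" "sq_summable \<xi>" "sq_summable \<eta>" "open U"
      by (auto simp: sq_summable_seq_iff)
    define \<Xi> where "\<Xi> = Abs_ell2 \<xi>"
    define H where "H = Abs_ell2 \<eta>"
    have sum_eq: "(\<Sum>n. cinner (blinfun_apply B (\<xi> n)) (\<eta> n)) = cinner (amp B \<Xi>) H" for B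
      using suminf_cinner_amp[of B \<Xi> H] s(2,3) by (simp add: \<Xi>_def H_def coord_Abs_ell2)
    have "cinner (amp A \<Xi>) H \<in> U"
      using Basis.prems by (simp add: s(1) weak_star_basis_def sum_eq)
    then obtain \<delta> where \<delta>: "\<delta> > 0" "\<And>z. dist z (cinner (amp A \<Xi>) H) < \<delta> \<Longrightarrow> z \<in> U"
      using s(4) open_dist by metis
    \<comment> \<open>Adding 1 to the denominator covers \<open>H = 0\<close>.\<close>
    have "?P s A \<Xi> (\<delta> / (norm H + 1))"
    proof (intro conjI ballI impI)
      show "\<delta> / (norm H + 1) > 0"
        using \<delta>(1) by (intro divide_pos_pos) (auto intro: add_nonneg_pos)
      fix B :: "'a \<Rightarrow>\<^sub>L 'a" assume B: "B \<in> cbounded" "norm (amp (B - A) \<Xi>) < \<delta> / (norm H + 1)"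
      have "amp B \<Xi> - amp A \<Xi> = amp (B - A) \<Xi>"
        by (rule ell2_eqI) (simp add: coord_minus blinfun.diff_left)
      then have "dist (cinner (amp B \<Xi>) H) (cinner (amp A \<Xi>) H) = cmod (cinner (amp (B - A) \<Xi>) H)"
        by (simp add: dist_norm flip: cinner.diff_left)
      also have "\<dots> \<le> norm (amp (B - A) \<Xi>) * norm H"
        by (rule cinner_Cauchy_Schwarz)
      also have "\<dots> \<le> norm (amp (B - A) \<Xi>) * (norm H + 1)"
        by (intro mult_left_mono) auto
      also have "\<dots> < \<delta>"
        using B(2) by (subst (asm) pos_less_divide_eq) (auto intro: add_nonneg_pos)
      finally show "B \<in> s"
        using B(1) \<delta>(2) by (simp add: s(1) weak_star_basis_def sum_eq)
    qed
    then show ?case by blast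
  qed
  then show thesis using that by blast
qed

text \<open>Weak-* density of the polynomials in the shift: a weak-* neighbourhood is controlled by a single
  vector \<open>\<Xi>\<close>, and \<open>amp A \<Xi>\<close> lies in the invariant subspace generated by \<open>\<Xi>\<close>.\<close>

lemma multiplier_weak_star_approx:
  fixes A :: "'d::finite drury_arveson \<Rightarrow>\<^sub>L 'd drury_arveson"
  assumes "openin weak_star W" "A \<in> W" "A \<in> multiplier_algebra"
    and Pol: "Pol \<subseteq> cbounded" "\<And>w. word_op shift_op w \<in> Pol"
      "\<And>B C. B \<in> Pol \<Longrightarrow> C \<in> Pol \<Longrightarrow> B + C \<in> Pol" "\<And>c B. B \<in> Pol \<Longrightarrow> scale_op c B \<in> Pol"
  shows "\<exists>B\<in>Pol. B \<in> W"
proof -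
  obtain \<Xi> :: "(nat, 'd drury_arveson) ell2" and \<epsilon> where \<epsilon>: "\<epsilon> > 0"
    "\<And>B. B \<in> cbounded \<Longrightarrow> norm (amp (B - A) \<Xi>) < \<epsilon> \<Longrightarrow> B \<in> W"
    using weak_star_nbhd[OF assms(1,2)] by metis
  let ?S = "\<lambda>k. amp (shift_op k) :: (nat, 'd drury_arveson) ell2 \<Rightarrow>\<^sub>L _"
  have "cspan (range (\<lambda>w. word_op ?S w \<Xi>)) \<subseteq> {amp B \<Xi> |B. B \<in> Pol}"
  proof (rule complex_vector.span_minimal)
    show "range (\<lambda>w. word_op ?S w \<Xi>) \<subseteq> {amp B \<Xi> |B. B \<in> Pol}"
      using Pol(2) by (auto simp: word_op_amp)
    show "csubspace {amp B \<Xi> |B. B \<in> Pol}"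
    proof (rule complex_vector.subspaceI)
      have "amp (scale_op 0 (word_op shift_op [])) \<Xi> = 0"
        by (rule ell2_eqI) (simp add: scale_op.rep_eq zero_ell2.rep_eq)
      then show "0 \<in> {amp B \<Xi> |B. B \<in> Pol}"
        using Pol(4)[OF Pol(2)] by (metis (mono_tags, lifting) mem_Collect_eq)
      show "x + y \<in> {amp B \<Xi> |B. B \<in> Pol}"
        if "x \<in> {amp B \<Xi> |B. B \<in> Pol}" "y \<in> {amp B \<Xi> |B. B \<in> Pol}" for x y
      proof -
        obtain B C where "x = amp B \<Xi>" "y = amp C \<Xi>" "B \<in> Pol" "C \<in> Pol" using \<open>x \<in> _\<close> \<open>y \<in> _\<close> by blast
        then have "x + y = amp (B + C) \<Xi>" "B + C \<in> Pol"
          by (simp_all add: amp_add blinfun.add_left Pol(3))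
        then show ?thesis by blast
      qed
      show "c *\<^sub>C x \<in> {amp B \<Xi> |B. B \<in> Pol}" if "x \<in> {amp B \<Xi> |B. B \<in> Pol}" for c x
      proof -
        obtain B where "x = amp B \<Xi>" "B \<in> Pol" using \<open>x \<in> _\<close> by blast
        then have "c *\<^sub>C x = amp (scale_op c B) \<Xi>" "scale_op c B \<in> Pol"
          by (simp_all add: amp_scale_op scale_op.rep_eq Pol(4))
        then show ?thesis by blast
      qed
    qed
  qed
  moreover have "amp A \<Xi> \<in> closure (cspan (range (\<lambda>w. word_op ?S w \<Xi>)))"
    using multiplier_cyclic_space[OF assms(3), of \<Xi>] by (simp add: cyclic_space_def)
  ultimately obtain B where B: "B \<in> Pol" "dist (amp B \<Xi>) (amp A \<Xi>) < \<epsilon>"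
    using \<epsilon>(1) unfolding closure_approachable by blast
  have "amp B \<Xi> - amp A \<Xi> = amp (B - A) \<Xi>"
    by (rule ell2_eqI) (simp add: coord_minus blinfun.diff_left)
  then have "B \<in> W" using B Pol(1) \<epsilon>(2) by (auto simp: dist_norm)
  with B(1) show ?thesis by blast
qed

section \<open>The functional calculus\<close>

lemma functional_calculus_word:
  assumes "is_functional_calculus T \<Psi>" shows "\<Psi> (word_op shift_op w) = word_op T w"
proof (induction w)
  case Nil
  then show ?case using assms by (simp add: is_functional_calculus_def)
next
  case (Cons k w)
  then show ?case
    using assms multiplier_algebra_shift[of k] multiplier_algebra_word[of w]
    by (simp add: is_functional_calculus_def shift_eq)
qed

lemma functional_calculus_preimage:
  assumes \<Psi>: "is_functional_calculus T \<Psi>" and "sq_summable \<xi>" "sq_summable \<eta>" "open U"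
  obtains W where "openin weak_star W"
    "\<And>A. A \<in> multiplier_algebra \<Longrightarrow> A \<in> W \<longleftrightarrow> \<Psi> A \<in> weak_star_basis \<xi> \<eta> U"
proof -
  have "continuous_map (subtopology weak_star multiplier_algebra) weak_star \<Psi>"
    using \<Psi> by (simp add: is_functional_calculus_def)
  from openin_continuous_map_preimage[OF this openin_weak_star_basis[OF assms(2-4)]]
  obtain W where W: "openin weak_star W"
    "{A \<in> topspace (subtopology weak_star multiplier_algebra). \<Psi> A \<in> weak_star_basis \<xi> \<eta> U} = W \<inter> multiplier_algebra"
    by (auto simp: openin_subtopology)
  moreover have "topspace (subtopology weak_star multiplier_algebra) = (multiplier_algebra :: ('a drury_arveson \<Rightarrow>\<^sub>L _) set)"
    using multiplier_cbounded by (auto simp: topspace_weak_star)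
  ultimately show thesis using that[of W] by auto
qed

lemma functional_calculus_unique:
  fixes T :: "'d::finite \<Rightarrow> 'h::chilbert_space \<Rightarrow>\<^sub>L 'h"
  assumes \<Psi>1: "is_functional_calculus T \<Psi>1" and \<Psi>2: "is_functional_calculus T \<Psi>2"
  shows "\<Psi>1 = \<Psi>2"
proof (rule ext)
  fix A :: "'d drury_arveson \<Rightarrow>\<^sub>L 'd drury_arveson"
  show "\<Psi>1 A = \<Psi>2 A"
  proof (cases "A \<in> multiplier_algebra")
    case False
    then show ?thesis
      using \<Psi>1 \<Psi>2 unfolding is_functional_calculus_def by (metis PiE_arb)
  next
    case A: True
    show ?thesis
    proof (rule ccontr)
      assume "\<Psi>1 A \<noteq> \<Psi>2 A"
      then obtain x where "\<Psi>1 A x \<noteq> \<Psi>2 A x" by (meson blinfun_eqI)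
      define d where "d = \<Psi>1 A x - \<Psi>2 A x"
      have "d \<noteq> 0" using \<open>\<Psi>1 A x \<noteq> \<Psi>2 A x\<close> by (simp add: d_def)
      \<comment> \<open>Half the distance ||d||^2 between the two values of the functional B -> <B
        x, d>, so the balls around them are disjoint.\<close>
      define \<delta> where "\<delta> = (norm d)\<^sup>2 / 2"
      have "\<delta> > 0" using \<open>d \<noteq> 0\<close> by (simp add: \<delta>_def)
      define \<xi> \<eta> where "\<xi> = coord (single (0::nat) x)" and "\<eta> = coord (single (0::nat) d)"
      have sq: "sq_summable \<xi>" "sq_summable \<eta>" by (simp_all add: \<xi>_def \<eta>_def coord_sq_summable)
      have basis: "B \<in> weak_star_basis \<xi> \<eta> U \<longleftrightarrow> B \<in> cbounded \<and> cinner (B x) d \<in> U" for B U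
        unfolding weak_star_basis_def \<xi>_def \<eta>_def suminf_cinner_amp cinner_single
        by (simp add: single.rep_eq)
      have cb: "\<Psi>1 B \<in> cbounded" "\<Psi>2 B \<in> cbounded" if "B \<in> multiplier_algebra" for B
        using \<Psi>1 \<Psi>2 that by (auto simp: is_functional_calculus_def)
      obtain W1 where W1: "openin weak_star W1" "\<And>B. B \<in> multiplier_algebra \<Longrightarrow>
          B \<in> W1 \<longleftrightarrow> \<Psi>1 B \<in> weak_star_basis \<xi> \<eta> (ball (cinner (\<Psi>1 A x) d) \<delta>)"
        using functional_calculus_preimage[OF \<Psi>1 sq open_ball] by blast
      obtain W2 where W2: "openin weak_star W2" "\<And>B. B \<in> multiplier_algebra \<Longrightarrow>
          B \<in> W2 \<longleftrightarrow> \<Psi>2 B \<in> weak_star_basis \<xi> \<eta> (ball (cinner (\<Psi>2 A x) d) \<delta>)"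
        using functional_calculus_preimage[OF \<Psi>2 sq open_ball] by blast
      \<comment> \<open>Operators on which both calculi agree: these include the words and are
        closed under linear combinations, so density produces one of them in both neighbourhoods of
        \<open>A\<close>.\<close>
      let ?Pol = "{B \<in> multiplier_algebra. \<Psi>1 B = \<Psi>2 B}"
      have "\<exists>B\<in>?Pol. B \<in> W1 \<inter> W2"
      proof (rule multiplier_weak_star_approx)
        show "openin weak_star (W1 \<inter> W2)" using W1(1) W2(1) by (rule openin_Int)
        show "A \<in> W1 \<inter> W2" using W1(2)[OF A] W2(2)[OF A] cb[OF A] \<open>\<delta> > 0\<close> by (simp add: basis)
        show "word_op shift_op w \<in> ?Pol" for w
          using functional_calculus_word[OF \<Psi>1] functional_calculus_word[OF \<Psi>2]
          by (simp add: multiplier_algebra_word)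
        show "B + C \<in> ?Pol" if "B \<in> ?Pol" "C \<in> ?Pol" for B C
          using that \<Psi>1 \<Psi>2 by (simp add: is_functional_calculus_def multiplier_algebra_add)
        show "scale_op c B \<in> ?Pol" if "B \<in> ?Pol" for c B
          using that \<Psi>1 \<Psi>2 by (simp add: is_functional_calculus_def multiplier_algebra_scale_op)
      qed (use A multiplier_cbounded in auto)
      then obtain B where B: "B \<in> multiplier_algebra" "\<Psi>1 B = \<Psi>2 B" "B \<in> W1" "B \<in> W2" by blast
      have "dist (cinner (\<Psi>1 A x) d) (cinner (\<Psi>2 A x) d) < \<delta> + \<delta>"
        using W1(2)[OF B(1)] W2(2)[OF B(1)] B
        by (intro dist_triangle_less_add[of _ "cinner (\<Psi>1 B x) d"]) (simp_all add: basis dist_commute)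
      moreover have "dist (cinner (\<Psi>1 A x) d) (cinner (\<Psi>2 A x) d) = (norm d)\<^sup>2"
        by (simp add: dist_norm cinner_self norm_power d_def flip: cinner.diff_left)
      ultimately show False by (simp add: \<delta>_def)
    qed
  qed
qed

section \<open>The calculus defined by the Poisson kernel\<close>

context poisson_model
begin

lemma X_K_apply [simp]: "X (K x) = x"
  using arg_cong[OF X_K, of "\<lambda>A. A x"] by simp

definition Phi :: "('d drury_arveson \<Rightarrow>\<^sub>L 'd drury_arveson) \<Rightarrow> 'h \<Rightarrow>\<^sub>L 'h" where
  "Phi A = X o\<^sub>L (amp A o\<^sub>L K)"

lemma Phi_apply: "Phi A x = X (amp A (K x))"
  by (simp add: Phi_def)

lemma Phi_cbounded: "A \<in> multiplier_algebra \<Longrightarrow> Phi A \<in> cbounded"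
  by (simp add: Phi_def cbounded_compose X_cbounded K_cbounded amp_cbounded multiplier_cbounded)

text \<open>The kernel is closed and shift-invariant, so it contains the cyclic space of
  \<open>f\<close>, and that contains \<open>amp A f\<close>.\<close>

lemma kernel_invariant:
  assumes "X f = 0" "A \<in> multiplier_algebra" shows "X (amp A f) = 0"
proof -
  have "cyclic_space (\<lambda>k. amp (shift_op k)) f \<subseteq> {g. X g \<in> {0}}"
  proof (rule cyclic_space_minimal)
    show "amp (shift_op k) g \<in> {g. X g \<in> {0}}" if "g \<in> {g. X g \<in> {0}}" for k g
      using blinfun_compose_eqD[OF X_shift, of k g] that by simp
  qed (auto intro!: csubspace_vimage[OF X_cbounded, of "{0}", simplified]
      closed_vimage_blinfun[of "{0}" X, simplified] simp: assms(1) complex_vector.subspace_single_0)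
  with multiplier_cyclic_space[OF assms(2), of f] show ?thesis by blast
qed

text \<open>\<open>f\<close> and \<open>K (X f)\<close> differ by an element of the kernel of
  \<open>X\<close>. Multiplicativity of \<open>Phi\<close> and its commutation with \<open>T\<close>
  both follow from this identity.\<close>

lemma Phi_X:
  assumes "A \<in> multiplier_algebra" shows "Phi A (X f) = X (amp A f)"
proof -
  have "X (f - K (X f)) = 0" by (simp add: blinfun.diff_right)
  from kernel_invariant[OF this assms] show ?thesis
    by (simp add: blinfun.diff_right Phi_apply)
qed

lemma Phi_T_commute:
  assumes "A \<in> multiplier_algebra" shows "Phi A (T k x) = T k (Phi A x)"
proof -
  have T_X: "T k (X f) = X (amp (shift_op k) f)" for f
    using blinfun_compose_eqD[OF X_shift] by simp
  have "amp A o\<^sub>L amp (shift_op k) = amp (shift_op k) o\<^sub>L amp A"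
    by (simp add: multiplier_commute_shift assms flip: amp_compose)
  from blinfun_compose_eqD[OF this, of "K x"]
  have "Phi A (T k (X (K x))) = T k (X (amp A (K x)))"
    by (simp only: T_X Phi_X[OF assms])
  then show ?thesis by (simp add: Phi_apply)
qed

lemma Phi_completely_contractive:
  "completely_contractive multiplier_algebra (restrict Phi multiplier_algebra)"
  unfolding completely_contractive_def
proof (intro allI impI matrix_op_norm_leI)
  fix n and A :: "nat \<Rightarrow> nat \<Rightarrow> 'd drury_arveson \<Rightarrow>\<^sub>L 'd drury_arveson" and x :: "nat \<Rightarrow> 'h"
  assume A: "\<forall>i<n. \<forall>j<n. A i j \<in> multiplier_algebra" and x: "(\<Sum>j<n. (norm (x j))\<^sup>2) \<le> 1"
  have "(\<Sum>i<n. (norm (\<Sum>j<n. restrict Phi multiplier_algebra (A i j) (x j)))\<^sup>2)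
      = (\<Sum>i<n. (norm (X (\<Sum>j<n. amp (A i j) (K (x j)))))\<^sup>2)"
    using A by (intro sum.cong refl arg_cong[where f = "\<lambda>v. (norm v)\<^sup>2"]) (simp add: Phi_apply blinfun.sum_right)
  also have "\<dots> \<le> (\<Sum>i<n. (norm (\<Sum>j<n. amp (A i j) (K (x j))))\<^sup>2)"
    by (intro sum_mono power_mono norm_X) simp
  also have "\<dots> \<le> (matrix_op_norm n A)\<^sup>2 * (\<Sum>j<n. (norm (K (x j)))\<^sup>2)"
    by (rule matrix_amp_bound)
  also have "\<dots> \<le> (matrix_op_norm n A)\<^sup>2 * 1"
    using x by (intro mult_left_mono) (simp_all add: norm_K)
  finally show "(\<Sum>i<n. (norm (\<Sum>j<n. restrict Phi multiplier_algebra (A i j) (x j)))\<^sup>2) \<le> (matrix_op_norm n A)\<^sup>2"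
    by simp
qed (rule matrix_op_norm_nonneg)

text \<open>Merges the sequence index and the number of the copy of H^2 into a pair. Weak-*
  functionals being indexed by naturals, \<open>prod_decode\<close> later enumerates the
  pairs.\<close>

definition flat :: "(nat \<Rightarrow> 'h) \<Rightarrow> nat \<times> nat \<Rightarrow> 'd drury_arveson" where
  "flat \<xi> p = coord (K (\<xi> (fst p))) (snd p)"

lemma flat_summable:
  assumes "sq_summable \<xi>" shows "sq_summable (flat \<xi>)"
proof -
  have "(\<lambda>p. (norm (flat \<xi> p))\<^sup>2) summable_on UNIV \<times> UNIV"
  proof (rule summable_on_SigmaI)
    show "((\<lambda>e. (norm (flat \<xi> (n, e)))\<^sup>2) has_sum (norm (\<xi> n))\<^sup>2) UNIV" for n
      using has_sum_norm_ell2[of "K (\<xi> n)"] by (simp add: flat_def norm_K)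
    show "(\<lambda>n. (norm (\<xi> n))\<^sup>2) summable_on UNIV"
      using assms by (simp add: sq_summable_def)
  qed simp
  then show ?thesis by (simp add: sq_summable_def)
qed

lemma sq_summable_decode: "sq_summable f \<Longrightarrow> sq_summable (\<lambda>m. f (prod_decode m))"
  unfolding sq_summable_def
  by (subst summable_on_reindex_bij_betw[OF bij_prod_decode, of "\<lambda>p. (norm (f p))\<^sup>2"])

text \<open>Both sides evaluate one sum over pairs: grouped by the sequence index on the left,
  enumerated by \<open>prod_decode\<close> on the right.\<close>

lemma suminf_Phi:
  assumes "sq_summable \<xi>" "sq_summable \<eta>"
  shows "(\<Sum>n. cinner (Phi A (\<xi> n)) (\<eta> n))
    = (\<Sum>m. cinner (A (flat \<xi> (prod_decode m))) (flat \<eta> (prod_decode m)))"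
proof -
  have "sq_summable (\<lambda>p. A (flat \<xi> p))"
    using flat_summable[OF assms(1)] norm_blinfun by (rule sq_summable_bound)
  then obtain S where S: "((\<lambda>p. cinner (A (flat \<xi> p)) (flat \<eta> p)) has_sum S) (UNIV \<times> UNIV)"
    using cinner_summable[OF _ flat_summable[OF assms(2)]] by (auto simp: summable_on_def)
  have 1: "((\<lambda>n. cinner (Phi A (\<xi> n)) (\<eta> n)) has_sum S) UNIV"
  proof (rule has_sum_SigmaD[OF S])
    show "((\<lambda>e. cinner (A (flat \<xi> (n, e))) (flat \<eta> (n, e))) has_sum cinner (Phi A (\<xi> n)) (\<eta> n)) UNIV" for n
      using has_sum_cinner_ell2[of "amp A (K (\<xi> n))" "K (\<eta> n)"] by (simp add: flat_def Phi_apply X_adj)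
  qed
  have 2: "((\<lambda>m. cinner (A (flat \<xi> (prod_decode m))) (flat \<eta> (prod_decode m))) has_sum S) UNIV"
    using S by (subst has_sum_reindex_bij_betw[OF bij_prod_decode, of "\<lambda>p. cinner (A (flat \<xi> p)) (flat \<eta> p)"]) simp
  show ?thesis
    unfolding sums_unique[OF has_sum_imp_sums[OF 1], symmetric]
      sums_unique[OF has_sum_imp_sums[OF 2], symmetric] ..
qed

text \<open>By \<open>suminf_Phi\<close>, the preimage of a subbasic set is the trace on the
  multiplier algebra of a subbasic set, given by the flattened sequences.\<close>

lemma Phi_weak_star_continuous:
  "continuous_map (subtopology weak_star multiplier_algebra) weak_star (restrict Phi multiplier_algebra)"
proof -
  let ?T = "subtopology weak_star (multiplier_algebra :: ('d drury_arveson \<Rightarrow>\<^sub>L 'd drury_arveson) set)"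
  have top: "topspace ?T = multiplier_algebra"
    using multiplier_cbounded by (auto simp: topspace_weak_star)
  have "continuous_map ?T (topology_generated_by
      {weak_star_basis \<xi> \<eta> U | \<xi> \<eta> U. sq_summable_seq \<xi> \<and> sq_summable_seq \<eta> \<and> open U})
      (restrict Phi multiplier_algebra)"
  proof (rule continuous_on_generated_topo)
    fix V assume "V \<in> {weak_star_basis \<xi> \<eta> U | \<xi> \<eta> U. sq_summable_seq \<xi> \<and> sq_summable_seq (\<eta> :: nat \<Rightarrow> 'h) \<and> open U}"
    then obtain \<xi> \<eta> U where V: "V = weak_star_basis \<xi> \<eta> U" "sq_summable \<xi>" "sq_summable \<eta>" "open U"
      by (auto simp: sq_summable_seq_iff)
    let ?W = "weak_star_basis (\<lambda>m. flat \<xi> (prod_decode m)) (\<lambda>m. flat \<eta> (prod_decode m)) U"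
    have "restrict Phi multiplier_algebra -` V \<inter> topspace ?T = ?W \<inter> multiplier_algebra"
      unfolding top using multiplier_cbounded
      by (auto simp: V(1) weak_star_basis_def suminf_Phi[OF V(2,3)] Phi_cbounded)
    moreover have "openin weak_star ?W"
      using V by (intro openin_weak_star_basis sq_summable_decode flat_summable)
    ultimately show "openin ?T (restrict Phi multiplier_algebra -` V \<inter> topspace ?T)"
      by (auto simp: openin_subtopology)
  next
    show "restrict Phi multiplier_algebra ` topspace ?T \<subseteq>
        \<Union> {weak_star_basis \<xi> \<eta> U | \<xi> \<eta> U. sq_summable_seq \<xi> \<and> sq_summable_seq \<eta> \<and> open U}"
      unfolding topology_generated_by_topspace[symmetric] weak_star_eq[symmetric] topspace_weak_star top
      by (auto simp: Phi_cbounded)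
  qed
  then show ?thesis by (simp only: weak_star_eq[where 'a = 'h])
qed

lemma is_functional_calculus_Phi: "is_functional_calculus T (restrict Phi multiplier_algebra)"
  unfolding is_functional_calculus_def
proof (intro conjI ballI allI)
  show "restrict Phi multiplier_algebra \<in> multiplier_algebra \<rightarrow>\<^sub>E cbounded"
    by (auto simp: Phi_cbounded)
  show "restrict Phi multiplier_algebra (A + B) = restrict Phi multiplier_algebra A + restrict Phi multiplier_algebra B"
    if "A \<in> multiplier_algebra" "B \<in> multiplier_algebra" for A B
    using that by (intro blinfun_eqI)
      (simp add: multiplier_algebra_add Phi_apply amp_add blinfun.add_left blinfun.add_right)
  show "restrict Phi multiplier_algebra (scale_op c A) = scale_op c (restrict Phi multiplier_algebra A)"
    if "A \<in> multiplier_algebra" for c A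
    using that by (intro blinfun_eqI)
      (simp add: multiplier_algebra_scale_op Phi_apply amp_scale_op scale_op.rep_eq cbounded_scaleC[OF X_cbounded])
  show "restrict Phi multiplier_algebra (A o\<^sub>L B) = restrict Phi multiplier_algebra A o\<^sub>L restrict Phi multiplier_algebra B"
    if "A \<in> multiplier_algebra" "B \<in> multiplier_algebra" for A B
    using that by (intro blinfun_eqI)
      (simp add: multiplier_algebra_compose Phi_apply[of "A o\<^sub>L B"] Phi_apply[of B] Phi_X amp_compose)
  show "restrict Phi multiplier_algebra id_blinfun = id_blinfun"
    by (intro blinfun_eqI) (simp add: multiplier_algebra_id Phi_apply amp_id)
  show "restrict Phi multiplier_algebra (shift k) = T k" for k
    using blinfun_compose_eqD[OF X_shift]
    by (intro blinfun_eqI) (simp add: shift_eq multiplier_algebra_shift Phi_apply)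
qed (rule Phi_completely_contractive Phi_weak_star_continuous)+

lemma functional_calculus_eq: "functional_calculus T = restrict Phi multiplier_algebra"
  unfolding functional_calculus_def
  by (rule the_equality) (simp_all add: is_functional_calculus_Phi functional_calculus_unique)

lemma Ann_c_eq: "Ann_c T = {A \<in> multiplier_algebra. Phi A = 0}"
  by (auto simp: Ann_c_def functional_calculus_eq)

end

section \<open>The quasi-affine transform\<close>

text \<open>The case of one copy, with \<open>unit\<close> as index type, in which the generating
  operator is itself a multiplier.\<close>

lemma cyclic_space_multiplier:
  fixes f :: "'d::finite drury_arveson"
  obtains M where "M \<in> multiplier_algebra" "M da_one \<in> cyclic_space shift_op f"
    "f \<in> cyclic_space shift_op (M da_one)"
proof -
  let ?F = "single () f"
  obtain C where C: "C \<in> cbounded" "\<And>k. C o\<^sub>L shift_op k = amp (shift_op k) o\<^sub>L C"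
    "C da_one \<in> cyclic_space (\<lambda>k. amp (shift_op k)) ?F" "?F \<in> cyclic_space (\<lambda>k. amp (shift_op k)) (C da_one)"
    using cyclic_space_multiplier_generator by blast
  define M where "M = proj () o\<^sub>L C"
  have "M o\<^sub>L shift_op k = shift_op k o\<^sub>L M" for k
  proof (rule blinfun_eqI)
    fix g show "(M o\<^sub>L shift_op k) g = (shift_op k o\<^sub>L M) g"
      using blinfun_compose_eqD[OF C(2), of k g] by (simp add: M_def proj.rep_eq)
  qed
  then have "M \<in> multiplier_algebra"
    by (simp add: multiplier_algebra_eq M_def cbounded_compose proj_cbounded C(1))
  moreover have "proj () ?F = f" by (simp add: proj.rep_eq single.rep_eq)
  ultimately show thesis
    using that[of M] cyclic_space_image[OF proj_cbounded proj_amp C(3), of "()"]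
      cyclic_space_image[OF proj_cbounded proj_amp C(4), of "()"]
    by (simp add: M_def)
qed

lemma csubspace_range: "A \<in> cbounded \<Longrightarrow> csubspace (range (blinfun_apply A))"
proof (rule complex_vector.subspaceI)
  assume A: "A \<in> cbounded"
  show "0 \<in> range (blinfun_apply A)" by (metis blinfun.zero_right rangeI)
  show "x + y \<in> range (blinfun_apply A)" if "x \<in> range (blinfun_apply A)" "y \<in> range (blinfun_apply A)" for x y
    using that by (auto simp flip: blinfun.add_right)
  show "c *\<^sub>C x \<in> range (blinfun_apply A)" if "x \<in> range (blinfun_apply A)" for c x
    using that by (auto simp flip: cbounded_scaleC[OF A])
qed

text \<open>Restricting \<open>Y\<close> to the orthogonal complement of its kernel makes it
  injective without changing its range. Compression to that complement discards only vectors of the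
  kernel, so the intertwining relation survives.\<close>

lemma quasi_affine_transformI:
  fixes T :: "'d::finite \<Rightarrow> 'h::chilbert_space \<Rightarrow>\<^sub>L 'h"
  assumes Y: "Y \<in> cbounded" "\<And>k. Y o\<^sub>L shift_op k = T k o\<^sub>L Y"
    and kernel: "{f. Y f = 0} = ideal_space J" and range: "closure (range (blinfun_apply Y)) = UNIV"
  shows "quasi_affine_transform (quotient_space J) (compressed_shift J) UNIV (\<lambda>k. blinfun_apply (T k))"
proof -
  let ?E = "quotient_space J" and ?I = "ideal_space J"
  have I: "csubspace ?I" "closed ?I" by (simp_all add: ideal_space_def csubspace_cclosed_span)
  have E: "csubspace ?E" unfolding quotient_space_def by (rule csubspace_orthogonal)
  have Y_I: "Y f = 0 \<longleftrightarrow> f \<in> ?I" for f using kernel by blast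
  have decomp: "\<exists>e\<in>?E. \<exists>u\<in>?I. g = u + e" for g
  proof -
    obtain u where u: "u \<in> ?I" "\<And>w. w \<in> ?I \<Longrightarrow> cinner (g - u) w = 0"
      using projection_exists[OF I] by metis
    then have "g - u \<in> ?E" by (simp add: quotient_space_def)
    moreover have "g = u + (g - u)" by simp
    ultimately show ?thesis using u(1) by blast
  qed
  have inj: "inj_on (blinfun_apply Y) ?E"
  proof (rule inj_onI)
    fix x y assume xy: "x \<in> ?E" "y \<in> ?E" "Y x = Y y"
    then have "x - y \<in> ?I" by (simp add: blinfun.diff_right flip: Y_I)
    moreover have "x - y \<in> ?E" using E xy(1,2) by (rule complex_vector.subspace_diff)
    ultimately have "cinner (x - y) (x - y) = 0" by (simp add: quotient_space_def)
    then show "x = y" by (simp add: cinner_self)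
  qed
  have "range (blinfun_apply Y) \<subseteq> blinfun_apply Y ` ?E"
  proof
    fix y assume "y \<in> range (blinfun_apply Y)"
    then obtain g where "y = Y g" by blast
    moreover obtain u e where "e \<in> ?E" "u \<in> ?I" "g = u + e" using decomp by blast
    moreover from this have "Y u = 0" by (simp add: Y_I)
    ultimately show "y \<in> blinfun_apply Y ` ?E" by (simp add: blinfun.add_right)
  qed
  then have dense: "UNIV \<subseteq> closure (blinfun_apply Y ` ?E)"
    using range closure_mono by blast
  have intertwine: "Y (compressed_shift J k x) = T k (Y x)" for k x
  proof -
    obtain u e where ue: "e \<in> ?E" "u \<in> ?I" "shift_op k x = u + e" using decomp by blast
    have "cinner u w = 0" if "w \<in> ?E" for w
      using that ue(2) cinner_eq_0_commute by (auto simp: quotient_space_def)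
    then have "ortho_proj ?E (shift_op k x) = e"
      using E ue by (intro ortho_proj_eqI) auto
    moreover have "Y u = 0" using ue(2) by (simp add: Y_I)
    ultimately have "Y (compressed_shift J k x) = Y (shift_op k x)"
      by (simp add: compressed_shift_def shift_eq ue(3) blinfun.add_right)
    then show ?thesis using blinfun_compose_eqD[OF Y(2)] by simp
  qed
  show ?thesis
    unfolding quasi_affine_transform_def
    using inj dense intertwine cbounded_scaleC[OF Y(1)] norm_blinfun[of Y]
    by (intro exI[of _ "blinfun_apply Y"] conjI exI[of _ "norm Y"]) (auto simp: blinfun.add_right)
qed

lemma (in poisson_model) quasi_affine_transform_cyclic:
  assumes "cyclic_vector T \<xi>"
  shows "quasi_affine_transform (quotient_space (Ann_c T)) (compressed_shift (Ann_c T))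
    UNIV (\<lambda>k. blinfun_apply (T k))"
proof -
  let ?S = "\<lambda>k. amp (shift_op k) :: (nat, 'd drury_arveson) ell2 \<Rightarrow>\<^sub>L _"
  obtain C where C: "C \<in> cbounded" "\<And>k. C o\<^sub>L shift_op k = ?S k o\<^sub>L C"
    "K \<xi> \<in> cyclic_space ?S (C da_one)"
    using cyclic_space_multiplier_generator[of "K \<xi>"] by blast
  define Y where "Y = X o\<^sub>L C"
  \<comment> \<open>A cyclic vector to replace \<xi>: it lies in the range of \<open>Y\<close>, and
    its orbit generates \<xi>.\<close>
  define \<eta> where "\<eta> = Y da_one"
  have Y_cb: "Y \<in> cbounded" by (simp add: Y_def cbounded_compose X_cbounded C(1))
  have Y_shift: "Y o\<^sub>L shift_op k = T k o\<^sub>L Y" for k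
  proof (rule blinfun_eqI)
    fix g show "(Y o\<^sub>L shift_op k) g = (T k o\<^sub>L Y) g"
      using blinfun_compose_eqD[OF C(2), of k g] blinfun_compose_eqD[OF X_shift, of k "C g"]
      by (simp add: Y_def)
  qed
  have "\<xi> \<in> cyclic_space T \<eta>"
    using cyclic_space_image[of X ?S T "K \<xi>" "C da_one"] X_cbounded X_shift C(3)
    by (simp add: \<eta>_def Y_def)
  then have "cyclic_space T \<xi> \<subseteq> cyclic_space T \<eta>"
    by (intro cyclic_space_minimal csubspace_cyclic_space closed_cyclic_space
        cyclic_space_invariant T_cbounded)
  then have \<eta>_cyclic: "cyclic_space T \<eta> = UNIV"
    using assms by (auto simp: cyclic_vector_def cyclic_space_def)
  have word_Y: "word_op T u (Y g) = Y (word_op shift_op u g)" for u g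
    using blinfun_compose_eqD[OF word_op_commute[of Y shift_op T u, OF Y_shift], of g] by simp
  have "cyclic_space T \<eta> \<subseteq> closure (range (blinfun_apply Y))"
    unfolding cyclic_space_def
  proof (rule cclosed_span_minimal)
    show "range (\<lambda>u. word_op T u \<eta>) \<subseteq> closure (range (blinfun_apply Y))"
      by (auto simp: \<eta>_def word_Y intro!: closure_subset[THEN subsetD])
  qed (auto intro: csubspace_closure csubspace_range Y_cb)
  with \<eta>_cyclic have dense: "closure (range (blinfun_apply Y)) = UNIV" by blast
  have Phi_Y: "Phi A (Y f) = Y (A f)" if "A \<in> multiplier_algebra" for A f
    using blinfun_compose_eqD[OF amp_multiplier_commute[OF C(1,2) that], of f]
    by (simp add: Y_def Phi_X[OF that])
  have ker_closed: "csubspace {f. A f = 0}" "closed {f. A f = 0}" if "A \<in> cbounded"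
    for A :: "'x::chilbert_space \<Rightarrow>\<^sub>L 'y::chilbert_space"
    using csubspace_vimage[OF that, of "{0}"] closed_vimage_blinfun[of "{0}" A]
    by (simp_all add: complex_vector.subspace_single_0)
  have "{f. Y f = 0} = ideal_space (Ann_c T)"
  proof (intro equalityI subsetI)
    fix f assume "f \<in> ideal_space (Ann_c T)"
    moreover have "ideal_space (Ann_c T) \<subseteq> {f. Y f = 0}"
      unfolding ideal_space_def
    proof (rule cclosed_span_minimal)
      show "{blinfun_apply \<theta> f |\<theta> f. \<theta> \<in> Ann_c T} \<subseteq> {f. Y f = 0}"
        by (auto simp: Ann_c_eq simp flip: Phi_Y)
    qed (rule ker_closed[OF Y_cb])+
    ultimately show "f \<in> {f. Y f = 0}" by blast
  next
    fix f assume f: "f \<in> {f. Y f = 0}"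
    obtain M where M: "M \<in> multiplier_algebra" "M da_one \<in> cyclic_space shift_op f"
      "f \<in> cyclic_space shift_op (M da_one)"
      using cyclic_space_multiplier by blast
    have "cyclic_space shift_op f \<subseteq> {f. Y f = 0}"
      using f blinfun_compose_eqD[OF Y_shift] by (intro cyclic_space_minimal ker_closed[OF Y_cb]) auto
    with M(2) have "Y (M da_one) = 0" by blast
    then have "Phi M \<eta> = 0" by (simp add: \<eta>_def Phi_Y[OF M(1)])
    \<comment> \<open>\<open>Phi M\<close> commutes with \<open>T\<close>, so its kernel is
      invariant and contains the whole orbit of \<eta>.\<close>
    then have "cyclic_space T \<eta> \<subseteq> {x. Phi M x = 0}"
      by (intro cyclic_space_minimal ker_closed Phi_cbounded M(1)) (auto simp: Phi_T_commute[OF M(1)])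
    then have "Phi M = 0"
      by (intro blinfun_eqI) (auto simp: \<eta>_cyclic)
    then have "M \<in> Ann_c T" by (simp add: Ann_c_eq M(1))
    \<comment> \<open>\<open>M\<close> passes through the shifts, so the orbit of
      \<open>M da_one\<close> consists of values of the single ideal element
      \<open>M\<close>.\<close>
    have "cyclic_space shift_op (M da_one) \<subseteq> ideal_space (Ann_c T)"
      unfolding cyclic_space_def ideal_space_def
    proof (intro closure_mono complex_vector.span_mono subsetI)
      fix g assume "g \<in> range (\<lambda>u. word_op shift_op u (M da_one))"
      then obtain u where "g = word_op shift_op u (M da_one)" by blast
      then have "g = M (word_op shift_op u da_one)"
        using blinfun_compose_eqD[OF word_op_commute[of M shift_op shift_op u,
            OF multiplier_commute_shift[OF M(1)]], of da_one] by simp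
      with \<open>M \<in> Ann_c T\<close> show "g \<in> {blinfun_apply \<theta> f |\<theta> f. \<theta> \<in> Ann_c T}" by blast
    qed
    with M(3) show "f \<in> ideal_space (Ann_c T)" by blast
  qed
  from quasi_affine_transformI[OF Y_cb Y_shift this dense] show ?thesis .
qed

theorem theorem1p1:
  fixes T :: "'d::finite \<Rightarrow> ('h::chilbert_space \<Rightarrow>\<^sub>L 'h)"
  assumes "row_contraction T"
    and "commuting_tuple T"
    and "pure_tuple T"
    and "cyclic_tuple T"
  shows "quasi_affine_transform
    (quotient_space (Ann_c T)) (compressed_shift (Ann_c T))
    UNIV (\<lambda>k. blinfun_apply (T k))"
proof -
  obtain \<xi> where \<xi>: "cyclic_vector T \<xi>"
    using assms(4) by (auto simp: cyclic_tuple_def)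
  interpret cyclic_row_contraction T \<xi>
    by unfold_locales (fact assms \<xi>)+
  obtain X K where "poisson_model T X K" by (rule poisson)
  then interpret poisson_model T X K .
  show ?thesis using \<xi> by (rule quasi_affine_transform_cyclic)
qed

end
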